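(* Let $\alpha\in(0,1)$ and let $\beta$ be an even integer with $\alpha\beta>1+\frac\pi2$. Let $\varphi(t)=\sum_{n=0}^\infty\alpha^n\cos(\beta^n\pi t)$ be the Weierstraß function, and let $\nu=-\frac{\log\alpha}{\log\beta}$. Let $H(t)=\xi_{\varphi(t)}\xi_{\varphi(t)}^T$ for $t\in(0,1)$, and let $\kappa_H$ be the function produced by the algorithm with a fixed constant $c>0$. Then \[ \log\Bigl(\max_{|z|=r}\|W_H(1;z)\|\Bigr)\asymp r^{\frac1{1+\nu}}\asymp\kappa_H(r),\qquad r>1, \] and \[ 0<\limsup_{r\to\infty}\frac{n_H(r)}{r^{1/(1+\nu)}}<\infty . \]
   Context: Notation: $\xi_\phi=(\cos\phi,\sin\phi)^T$, $J=\begin{pmatrix}0&-1\\1&0\end{pmatrix}$, and $\Omega(s,t)=\int_s^tH$. Fundamental solution: $W_H(t;z)$ solves $\partial_tW_H(t;z)J=zW_H(t;z)H(t)$ with $W_H(0;z)=I$ on $[0,1]$; $W_H(1;\cdot)$ is the monodromy matrix. Counting function: $n_H(r)=\#\{\lambda\in\sigma_H:|\lambda|<r\}$, where $\sigma_H$ is the (discrete, simple) spectrum of the self-adjoint operator part of the relation $A_H$. Here $A_H$ consists of pairs $(f,g)$ in $L^2(H)$ such that $f$ is absolutely continuous with $f'=JHg$ a.e., $(1,0)f(0)=0$ and $(0,1)f(1)=0$. $L^2(H)$ is the closed subspace of $L^2(H(t)dt)$ of functions $f$ such that $\xi_\phi^Tf$ is a.e. constant on every interval where $H=\xi_\phi\xi_\phi^T$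 a.e. Algorithm for $\kappa_H$ (constant $c$): for $r>0$ set $\sigma_0=0$. Recursively: - if $\det\Omega(\sigma_{j-1},1)>c/r^2$, let $\sigma_j\in(\sigma_{j-1},1)$ be the unique point with $\det\Omega(\sigma_{j-1},\sigma_j)=c/r^2$; - otherwise $\sigma_j=1$, $\kappa_H(r)=j$, and stop. Asymptotic notation: $\asymp$ means two-sided bounds with positive constants. *)

theory Defs
  imports "HOL-Analysis.Analysis"
begin

definition xi :: "real \<Rightarrow> real^2" where
  "xi \<phi> = vector [cos \<phi>, sin \<phi>]"

definition Jmat :: "real^2^2" where
  "Jmat = vector [vector [0, -1], vector [1, 0]]"

definition cmat :: "real^2^2 \<Rightarrow> complex^2^2" where
  "cmat A = (\<chi> i j. complex_of_real (A $ i $ j))"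

definition ham_of_angle :: "(real \<Rightarrow> real) \<Rightarrow> real \<Rightarrow> real^2^2" where
  "ham_of_angle \<phi> t = (\<chi> i j. xi (\<phi> t) $ i * xi (\<phi> t) $ j)"

definition Omega :: "(real \<Rightarrow> real^2^2) \<Rightarrow> real \<Rightarrow> real \<Rightarrow> real^2^2" where
  "Omega H s t = integral {s..t} H"

definition fund_sol :: "(real \<Rightarrow> real^2^2) \<Rightarrow> complex \<Rightarrow> (real \<Rightarrow> complex^2^2) \<Rightarrow> bool" where
  "fund_sol H z W \<longleftrightarrow> W 0 = mat 1 \<and>
     (\<forall>t\<in>{0..1}. \<exists>D. (W has_vector_derivative D) (at t within {0..1}) \<and>
         D ** cmat Jmat = mat z ** W t ** cmat (H t))"

definition W_H :: "(real \<Rightarrow> real^2^2) \<Rightarrow> real \<Rightarrow> complex \<Rightarrow> complex^2^2" where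
  "W_H H t z = (THE M. \<exists>W. fund_sol H z W \<and> W t = M)"

definition mat_norm :: "complex^2^2 \<Rightarrow> real" where
  "mat_norm M = onorm (\<lambda>v. M *v v)"

text \<open>Eigenvalues of A_H: (f, lam f) in A_H with f nonzero in L^2(H).
  f absolutely continuous with f' = J H (lam f) a.e. is written in integrated form.\<close>
definition L2H_normsq :: "(real \<Rightarrow> real^2^2) \<Rightarrow> (real \<Rightarrow> complex^2) \<Rightarrow> real" where
  "L2H_normsq H f = integral {0..1}
     (\<lambda>t. Re (\<Sum>i\<in>UNIV. \<Sum>j\<in>UNIV. cnj (f t $ i) * cmat (H t) $ i $ j * f t $ j))"

definition spectrum_H :: "(real \<Rightarrow> real^2^2) \<Rightarrow> complex set" where
  "spectrum_H H = {lam. \<exists>f :: real \<Rightarrow> complex^2.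
      continuous_on {0..1} f \<and>
      (\<forall>t\<in>{0..1}. f t = f 0 + integral {0..t} (\<lambda>s. cmat Jmat *v (cmat (H s) *v (lam *s f s)))) \<and>
      f 0 $ 1 = 0 \<and> f 1 $ 2 = 0 \<and>
      L2H_normsq H f \<noteq> 0}"

definition n_H :: "(real \<Rightarrow> real^2^2) \<Rightarrow> real \<Rightarrow> nat" where
  "n_H H r = card {lam \<in> spectrum_H H. norm lam < r}"

fun alg_sigma :: "(real \<Rightarrow> real^2^2) \<Rightarrow> real \<Rightarrow> real \<Rightarrow> nat \<Rightarrow> real" where
  "alg_sigma H c r 0 = 0"
| "alg_sigma H c r (Suc j) =
     (if det (Omega H (alg_sigma H c r j) 1) > c / r^2
      then (THE s. alg_sigma H c r j < s \<and> s < 1 \<and>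
                   det (Omega H (alg_sigma H c r j) s) = c / r^2)
      else 1)"

definition kappa_H :: "(real \<Rightarrow> real^2^2) \<Rightarrow> real \<Rightarrow> real \<Rightarrow> nat" where
  "kappa_H H c r = (LEAST j. j \<ge> 1 \<and> \<not> (det (Omega H (alg_sigma H c r (j - 1)) 1) > c / r^2))"

definition weierstrass :: "real \<Rightarrow> real \<Rightarrow> real \<Rightarrow> real" where
  "weierstrass \<alpha> \<beta> t = (\<Sum>n. \<alpha>^n * cos (\<beta>^n * pi * t))"

end

theory Submission
  imports Defs "HOL-Complex_Analysis.Complex_Analysis" "HOL-Real_Asymp.Real_Asymp"
begin

text \<open>
  Everything rests on \<open>det \<Omega>(s,t) \<asymp> (t - s)\<^bsup>2(1+\<nu>)\<^esup>\<close>. The upper bound is Hoelder continuity of \<open>\<phi>\<close>.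
  For the lower bound, note that \<open>2 det \<Omega>(s,t)\<close> is the integral of \<open>sin\<^sup>2(\<phi>(x) - \<phi>(y))\<close> over
  \<open>[s,t]\<^sup>2\<close>, and compare \<open>\<phi>\<close> with its reflection about the midpoint of an interval of length
  \<open>\<beta>\<^bsup>-k\<^esup>\<close>: for even \<open>\<beta>\<close> the terms of index \<open>n > k\<close> cancel, the term \<open>n = k\<close> is odd, and
  \<open>\<alpha>\<beta> > 1 + \<pi>/2\<close> makes it dominate the terms \<open>n < k\<close>. Hence every step of the algorithm has length
  comparable to \<open>r\<^bsup>-1/(1+\<nu>)\<^esup>\<close>.

  Upper bound for \<open>W\<close>: rotate by the \<open>k\<close>-th partial sum of \<open>\<phi>\<close> with \<open>\<beta>\<^sup>k\<close> about \<open>r\<^bsup>1/(1+\<nu>)\<^esup>\<close> and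
  apply Gronwall's inequality to a weighted norm. Lower bound: along the imaginary axis the form
  \<open>Im (w\<^sub>2 cnj w\<^sub>1)\<close> of a row \<open>(w\<^sub>1, w\<^sub>2)\<close> increases, and it gains a fixed factor on every interval on
  which \<open>y\<^sup>2 det \<Omega>\<close> is bounded above and below.

  The eigenvalues are the zeros of the entire function \<open>w\<^sub>2\<^sub>2(1;\<sqdot>)\<close>, which are real and simple. Dividing out
  zeros bounds their number from above. Were \<open>n(r) = o(r\<^bsup>1/(1+\<nu>)\<^esup>)\<close>, the product over the zeros (the
  order is less than 1) would contradict the lower bound for \<open>|w\<^sub>2\<^sub>2(1;iy)|\<close>.
\<close>

section \<open>Counting zeros of entire functions of order less than one\<close>

text \<open>The balance of scales comes from \<alpha> = b^(-\<nu>): over a distance b^(-k) the angle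
  varies by about \<alpha>^k, and r \<alpha>^k = b^k holds exactly when b^k = r^\<rho> with \<rho> =
  1 / (1 + \<nu>). As H has rank one, a row w of the fundamental solution is driven by the scalar w
  \<xi> alone, and transposed rows solve f' = J H z f; one scalar system serves both the monodromy
  matrix and the eigenvalue problem. The threshold 1 + pi / 2 compares slopes in units of (\<alpha>
  b)^k: under reflection the k-th term changes with slope at least 4 (Jordan's inequality), the
  earlier ones with slope at most 2 pi / (\<alpha> b - 1). The delicate claim is positivity of the
  limsup: growth alone has to force zeros. Since \<rho> < 1, the quotient left after dividing out
  the zeros in a large disc is bounded at each fixed point by a factor tending to 1 as the radius
  grows, so no infinite product has to be formed. The row (0, 1) starts with energy 0, so its lower
  bound needs an extra argument: the first interval creates energy, the last one turns it into size
  of the second entry.\<close>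

lemma entire_factor_zeros:
  fixes f :: "complex \<Rightarrow> complex"
  assumes "f holomorphic_on UNIV" "finite L" "0 \<notin> L" "\<And>w. w \<in> L \<Longrightarrow> f w = 0"
  shows "\<exists>g. g holomorphic_on UNIV \<and> (\<forall>z. f z = g z * (\<Prod>w\<in>L. 1 - z / w))"
  using assms(2,1,3,4)
proof (induction L arbitrary: f rule: finite_induct)
  case empty
  then show ?case by auto
next
  case (insert a L)
  \<comment> \<open>The difference quotient, completed at \<open>a\<close> by the derivative, is
    entire; the factor \<open>- a\<close> turns z - a into 1 - z / a, so the cofactor keeps its
    value at 0.\<close>
  define h where "h = (\<lambda>z. - a * (if z = a then deriv f a else (f z - f a) / (z - a)))"
  have "h holomorphic_on UNIV"
    unfolding h_def using pole_lemma_open[OF insert.prems(1) open_UNIV, of a]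
    by (intro holomorphic_intros)
  moreover have fh: "f z = h z * (1 - z / a)" for z
    using insert.prems(2) insert.prems(3)[of a] by (auto simp: h_def field_simps)
  moreover have "h w = 0" if "w \<in> L" for w
    using that fh[of w] insert.prems(2,3) insert.hyps by auto
  ultimately obtain g where "g holomorphic_on UNIV" "\<And>z. h z = g z * (\<Prod>w\<in>L. 1 - z / w)"
    using insert.IH[of h] insert.prems(2) by auto
  then show ?case
    using fh insert.hyps by (intro exI[of _ g]) (auto simp: mult_ac)
qed

text \<open>A zero of modulus at most R gives a factor of modulus at least (q + 1) - 1 = q on the
  circle of radius (q + 1) R, and the maximum principle carries the gain inwards. The choice q = 2
  counts zeros; q = 1 says that division does not enlarge the bound.\<close>

lemma entire_factor_bound:
  fixes f :: "complex \<Rightarrow> complex"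
  assumes "g holomorphic_on UNIV" "finite L" "0 \<notin> L" "\<And>z. f z = g z * (\<Prod>w\<in>L. 1 - z / w)"
    and "\<And>w. w \<in> L \<Longrightarrow> norm w \<le> R" "0 < R" "1 \<le> q"
    and "\<And>z. norm z = (q + 1) * R \<Longrightarrow> norm (f z) \<le> M" "norm z \<le> (q + 1) * R"
  shows "norm (g z) * q ^ card L \<le> M"
proof -
  have "norm (g v) \<le> M / q ^ card L" if v: "norm v = (q + 1) * R" for v
  proof -
    have "q ^ card L \<le> (\<Prod>w\<in>L. norm (1 - v / w))"
    proof -
      have "q \<le> norm (1 - v / w)" if "w \<in> L" for w
      proof -
        have "0 < norm w" "norm w \<le> R" using that assms by auto
        then have "(q + 1) * norm w \<le> (q + 1) * R" using assms(7) by (intro mult_left_mono) auto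
        then have "q + 1 \<le> norm (v / w)"
          using v \<open>0 < norm w\<close> by (simp add: norm_divide field_simps)
        then show ?thesis using norm_triangle_ineq2[of "v / w" 1] by (simp add: norm_minus_commute)
      qed
      then have "(\<Prod>w\<in>L. q) \<le> (\<Prod>w\<in>L. norm (1 - v / w))"
        using assms(7) by (intro prod_mono) auto
      then show ?thesis by simp
    qed
    then have "norm (g v) * q ^ card L \<le> norm (g v) * (\<Prod>w\<in>L. norm (1 - v / w))"
      by (intro mult_left_mono) auto
    also have "\<dots> = norm (f v)" using assms(4) by (simp add: norm_mult prod_norm)
    also have "\<dots> \<le> M" using assms(8) v by auto
    finally show ?thesis using assms(7) by (simp add: field_simps)
  qed
  then have "norm (g v) \<le> M / q ^ card L" if "v \<in> frontier (cball 0 ((q + 1) * R))" for v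
    using that by simp
  moreover have "g holomorphic_on interior (cball 0 ((q + 1) * R))"
    using assms(1) holomorphic_on_subset by blast
  moreover have "continuous_on (closure (cball 0 ((q + 1) * R))) g"
    using assms(1) holomorphic_on_imp_continuous_on continuous_on_subset by blast
  ultimately have "norm (g z) \<le> M / q ^ card L"
    using assms(9) maximum_modulus_frontier[of g "cball 0 ((q + 1) * R)" "M / q ^ card L" z]
    by (metis bounded_cball mem_cball_0)
  then show ?thesis using assms(7) by (simp add: field_simps)
qed

text \<open>A Jensen-type bound: each zero costs a factor 2, while the quotient still has the value
  1 at 0. It is shown for finite subsets first, because finiteness of the zero set is itself a
  consequence of the bound.\<close>

lemma card_zeros_le:
  fixes f :: "complex \<Rightarrow> complex"
  assumes "f holomorphic_on UNIV" "f 0 = 1" "0 < R"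
    and "\<And>z. norm z = 3 * R \<Longrightarrow> norm (f z) \<le> M"
  shows "finite {z. f z = 0 \<and> norm z \<le> R}" "2 ^ card {z. f z = 0 \<and> norm z \<le> R} \<le> M"
proof -
  have *: "2 ^ card L \<le> M" if "finite L" "L \<subseteq> {z. f z = 0 \<and> norm z \<le> R}" for L
  proof -
    have "0 \<notin> L" using assms that by auto
    moreover have "f w = 0" if "w \<in> L" for w using that \<open>L \<subseteq> _\<close> by blast
    ultimately have "\<exists>g. g holomorphic_on UNIV \<and> (\<forall>z. f z = g z * (\<Prod>w\<in>L. 1 - z / w))"
      using entire_factor_zeros[OF assms(1) that(1)] by blast
    then obtain g where "g holomorphic_on UNIV" and g: "\<And>z. f z = g z * (\<Prod>w\<in>L. 1 - z / w)"
      by metis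
    with \<open>0 \<notin> L\<close> have "norm (g 0) * 2 ^ card L \<le> M"
      using that assms by (intro entire_factor_bound[of g L f R 2 M 0]) auto
    moreover have "g 0 = 1" using g[of 0] assms by simp
    ultimately show ?thesis by simp
  qed
  show fin: "finite {z. f z = 0 \<and> norm z \<le> R}"
  proof (rule ccontr)
    assume "infinite {z. f z = 0 \<and> norm z \<le> R}"
    obtain n :: nat where n: "M < 2 ^ n" using real_arch_pow[of 2 M] by auto
    obtain L where "finite L" "card L = n" "L \<subseteq> {z. f z = 0 \<and> norm z \<le> R}"
      using infinite_arbitrarily_large[OF \<open>infinite _\<close>] by blast
    with *[of L] n show False by simp
  qed
  show "2 ^ card {z. f z = 0 \<and> norm z \<le> R} \<le> M" using *[OF fin] by simp
qed

text \<open>The map w / (2 A - w) sends the half-plane Re w < A into the unit disc and fixes 0, so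
  the Schwarz lemma applies to its composition with h.\<close>

lemma borel_caratheodory:
  fixes h :: "complex \<Rightarrow> complex"
  assumes "h holomorphic_on ball 0 R" "h 0 = 0" "0 < A" "\<And>z. norm z < R \<Longrightarrow> Re (h z) < A"
    and "norm z < R"
  shows "norm (h z) \<le> 2 * A * norm z / (R - norm z)"
proof -
  have R: "0 < R" using assms(5) norm_ge_zero[of z] by linarith
  define F where "F = (\<lambda>w. h (of_real R * w) / (2 * of_real A - h (of_real R * w)))"
  have in_ball: "norm (of_real R * w) < R" if "norm w < 1" for w :: complex
    using that R by (simp add: norm_mult)
  \<comment> \<open>Re (h w) < A says that h w is closer to 0 than to 2 A, the mirror image of 0 in
    the line Re = A.\<close>
  have lt: "norm (h w) < norm (2 * of_real A - h w)" if "norm w < R" for w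
  proof -
    have "(norm (h w))\<^sup>2 < (norm (2 * of_real A - h w))\<^sup>2"
      using assms(4)[OF that] assms(3) unfolding cmod_power2
      by (simp add: power2_eq_square algebra_simps) 
    then show ?thesis by (rule power2_less_imp_less) simp
  qed
  have "F holomorphic_on ball 0 1"
    unfolding F_def
  proof (intro holomorphic_intros)
    show "(\<lambda>w. h (of_real R * w)) holomorphic_on ball 0 1"
      using in_ball by (intro holomorphic_on_compose_gen[OF _ assms(1), unfolded o_def] holomorphic_intros) auto
    then show "(\<lambda>w. h (of_real R * w)) holomorphic_on ball 0 1" .
    show "2 * complex_of_real A - h (complex_of_real R * w) \<noteq> 0" if "w \<in> ball 0 1" for w
      using lt[OF in_ball[of w]] that norm_ge_zero[of "h (of_real R * w)"] by auto
  qed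
  moreover have "norm (F w) < 1" if "norm w < 1" for w
    using lt[OF in_ball[OF that]] norm_ge_zero[of "h (of_real R * w)"]
    unfolding F_def norm_divide by (subst divide_less_eq_1_pos) (linarith, simp)
  moreover have "norm (z / of_real R) < 1" using assms(5) R by (simp add: norm_divide)
  moreover have "F 0 = 0" by (simp add: F_def assms)
  ultimately have "norm (F (z / of_real R)) \<le> norm (z / of_real R)"
    using Schwarz_Lemma(1) by blast
  then have "norm (h z) / norm (2 * of_real A - h z) \<le> norm z / R"
    using R by (simp add: F_def norm_divide)
  moreover have pos: "0 < norm (2 * of_real A - h z)" using lt[OF assms(5)] norm_ge_zero[of "h z"] by linarith
  ultimately have "norm (h z) * R \<le> norm z * norm (2 * of_real A - h z)"
    using R by (simp add: field_simps)
  also have "\<dots> \<le> norm z * (2 * A + norm (h z))"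
    using norm_triangle_ineq4[of "2 * of_real A" "h z"] assms(3) by (intro mult_left_mono) (auto simp: norm_mult)
  finally have "norm (h z) * (R - norm z) \<le> 2 * A * norm z" by (simp add: algebra_simps)
  then show ?thesis using assms(5) by (simp add: field_simps)
qed

text \<open>Dividing out the zeros of modulus below \<open>R\<close> leaves a zero-free function there, whose
  logarithm is controlled by the growth of \<open>f\<close> through the Borel--Caratheodory inequality.\<close>

lemma entire_bound_by_zeros:
  fixes f :: "complex \<Rightarrow> complex"
  assumes "f holomorphic_on UNIV" "f 0 = 1" "\<And>z. f z = 0 \<Longrightarrow> deriv f z \<noteq> 0"
    and "0 < R" "0 < A" "\<And>z. norm z = 2 * R \<Longrightarrow> norm (f z) < exp A" "norm z < R"
    and "finite {w. f w = 0 \<and> norm w \<le> R}"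
  shows "norm (f z) \<le> exp (2 * A * norm z / (R - norm z)) *
           (\<Prod>w\<in>{w. f w = 0 \<and> norm w \<le> R}. 1 + norm z / norm w)"
proof -
  define L where "L = {w. f w = 0 \<and> norm w \<le> R}"
  have L: "finite L" "0 \<notin> L" using assms by (auto simp: L_def)
  have "f w = 0" if "w \<in> L" for w using that by (simp add: L_def)
  then have "\<exists>g. g holomorphic_on UNIV \<and> (\<forall>z. f z = g z * (\<Prod>w\<in>L. 1 - z / w))"
    using entire_factor_zeros[OF assms(1) L] by blast
  then obtain g where hol: "g holomorphic_on UNIV" and g: "\<And>z. f z = g z * (\<Prod>w\<in>L. 1 - z / w)"
    by metis
  have g0: "g 0 = 1" using g[of 0] assms by simp
  \<comment> \<open>A zero of \<open>g\<close> inside the disc would also be a zero of the product,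
    hence at least a double zero of \<open>f\<close>, against simplicity.\<close>
  have nz: "g w \<noteq> 0" if "norm w < R" for w
  proof
    assume "g w = 0"
    then have w: "f w = 0" "w \<in> L" using g[of w] that by (auto simp: L_def)
    have P: "(\<Prod>v\<in>L. 1 - w / v) = 0" using w L by (auto simp: prod_zero_iff)
    have "(g has_field_derivative deriv g w) (at w)"
      using hol by (simp add: holomorphic_derivI)
    moreover have "((\<lambda>z. \<Prod>v\<in>L. 1 - z / v) has_field_derivative deriv (\<lambda>z. \<Prod>v\<in>L. 1 - z / v) w) (at w)"
      using L by (intro holomorphic_derivI[of _ UNIV] holomorphic_intros) auto
    ultimately have "((\<lambda>z. g z * (\<Prod>v\<in>L. 1 - z / v)) has_field_derivative 0) (at w)"
      using \<open>g w = 0\<close> P by (auto intro!: derivative_eq_intros)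
    moreover have "(\<lambda>z. g z * (\<Prod>v\<in>L. 1 - z / v)) = f" using g by auto
    ultimately have "deriv f w = 0" by (simp add: DERIV_imp_deriv)
    with assms(3) w show False by auto
  qed
  have "g holomorphic_on ball 0 R" using hol holomorphic_on_subset by blast
  moreover have "g w \<noteq> 0" if "w \<in> ball 0 R" for w using that nz by simp
  moreover have "(0::complex) \<in> ball 0 R" using assms(4) by simp
  ultimately obtain h where h: "h holomorphic_on ball 0 R" "\<And>z. z \<in> ball 0 R \<Longrightarrow> exp (h z) = g z"
    using holomorphic_logarithm_exists[OF convex_ball open_ball] by metis
  define k where "k = (\<lambda>z. h z - h 0)"
  have k: "g z = exp (k z)" if "norm z < R" for z
    using h(2)[of z] h(2)[of 0] that assms(4) unfolding k_def exp_diff by (simp add: g0)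
  \<comment> \<open>The maximum over the sphere is attained, so the pointwise strict bound becomes
    the strict bound on the real part that \<open>borel_caratheodory\<close> asks for.\<close>
  let ?M = "Sup (norm ` f ` sphere 0 (2 * R))"
  have cpt: "compact (norm ` f ` sphere 0 (2 * R))"
    by (intro compact_continuous_image holomorphic_on_imp_continuous_on continuous_intros
        holomorphic_on_subset[OF assms(1)]) auto
  have gA: "norm (g z) \<le> ?M" if "norm z < R" for z
  proof -
    have "norm (f v) \<le> ?M" if "norm v = 2 * R" for v
      using that cpt by (intro cSup_upper) (auto dest: compact_imp_bounded bounded_imp_bdd_above)
    then have "norm (g z) * 1 ^ card L \<le> ?M"
      using that assms(4) by (intro entire_factor_bound[OF hol L g]) (auto simp: L_def)
    then show ?thesis by simp
  qed
  have "?M \<in> norm ` f ` sphere 0 (2 * R)"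
    using cpt assms(4) by (intro closed_contains_Sup)
      (auto dest: compact_imp_bounded compact_imp_closed bounded_imp_bdd_above)
  then have MA: "?M < exp A" using assms(6) by auto
  have "Re (k z) < A" if "norm z < R" for z
  proof -
    have "exp (Re (k z)) < exp A" using gA[OF that] MA unfolding k[OF that] norm_exp_eq_Re by linarith
    then show ?thesis by simp
  qed
  then have "norm (k z) \<le> 2 * A * norm z / (R - norm z)"
    using assms(5,7) by (intro borel_caratheodory) (auto simp: k_def intro!: holomorphic_intros h(1))
  then have "norm (g z) \<le> exp (2 * A * norm z / (R - norm z))"
    using k[OF assms(7)] complex_Re_le_cmod[of "k z"] by simp
  moreover have "(\<Prod>w\<in>L. norm (1 - z / w)) \<le> (\<Prod>w\<in>L. 1 + norm z / norm w)"
    by (intro prod_mono) (auto intro!: order_trans[OF norm_triangle_ineq4] simp: norm_divide)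
  moreover have "norm (f z) = norm (g z) * (\<Prod>w\<in>L. norm (1 - z / w))"
    using g[of z] by (simp add: norm_mult prod_norm)
  ultimately show ?thesis
    unfolding L_def[symmetric] by (auto intro!: mult_mono prod_nonneg)
qed

section \<open>Sums over zeros controlled by the counting function\<close>

text \<open>Counting bounds the j-th smallest value from below: if at most e t^(1/s) elements lie
  below t, it is at least (j / e)^s. The induction strips off the largest element, whose rank is the
  cardinality.\<close>

lemma sum_le_sum_by_count:
  fixes F :: "real \<Rightarrow> real" and m :: "'a \<Rightarrow> real"
  assumes "finite L" "0 < s" "0 < e" "\<And>w. w \<in> L \<Longrightarrow> 0 < m w"
    and "\<And>t. 0 < t \<Longrightarrow> real (card {w \<in> L. m w \<le> t}) \<le> e * t powr (1 / s)"
    and "\<And>x y. 0 < x \<Longrightarrow> x \<le> y \<Longrightarrow> F y \<le> F x"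
  shows "(\<Sum>w\<in>L. F (m w)) \<le> (\<Sum>j=1..card L. F ((real j / e) powr s))"
  using assms(1,4,5)
proof (induction "card L" arbitrary: L)
  case 0
  then show ?case by simp
next
  case (Suc n)
  then have "L \<noteq> {}" by auto
  then obtain w where w: "w \<in> L" "\<And>v. v \<in> L \<Longrightarrow> m v \<le> m w"
    using Max_in[of "m ` L"] Max_ge[of "m ` L"] Suc.prems(1) by fastforce
  have c: "card L = Suc (card (L - {w}))" "n = card (L - {w})"
    using w Suc by (auto simp: card_Diff_singleton)
  have "(\<Sum>v\<in>L - {w}. F (m v)) \<le> (\<Sum>j=1..card (L - {w}). F ((real j / e) powr s))"
  proof (rule Suc.hyps(1)[OF c(2)])
    fix t :: real assume "0 < t"
    have "card {v \<in> L - {w}. m v \<le> t} \<le> card {v \<in> L. m v \<le> t}"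
      using Suc.prems by (intro card_mono) auto
    then show "real (card {v \<in> L - {w}. m v \<le> t}) \<le> e * t powr (1 / s)"
      using Suc.prems(3)[OF \<open>0 < t\<close>] by linarith
  qed (use Suc.prems in auto)
  moreover have "F (m w) \<le> F ((real (card L) / e) powr s)"
  proof (rule assms(6))
    have "{v \<in> L. m v \<le> m w} = L" using w by auto
    then have "real (card L) \<le> e * m w powr (1 / s)"
      using Suc.prems(3)[of "m w"] Suc.prems(2) w by auto
    then have "(real (card L) / e) powr s \<le> (m w powr (1 / s)) powr s"
      using assms(2,3) by (intro powr_mono2) (auto simp: field_simps)
    also have "\<dots> = m w" using assms(2) Suc.prems(2)[OF w(1)] by (simp add: powr_powr)
    finally show "(real (card L) / e) powr s \<le> m w" .
    show "0 < (real (card L) / e) powr s" using assms(3) c by simp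
  qed
  ultimately show ?case
    using sum.remove[OF Suc.prems(1) w(1), of "\<lambda>v. F (m v)"] c by simp
qed

lemma sum_inverse_sqrt_le: "(\<Sum>j=1..n. 1 / sqrt (real j)) \<le> 2 * sqrt (real n)"
proof (induction n)
  case (Suc n)
  have "2 * sqrt (real n) * sqrt (real (Suc n)) \<le> real n + real (Suc n)"
    using arith_geo_mean_sqrt[of "real n" "real (Suc n)"] by (simp add: real_sqrt_mult)
  moreover have "sqrt (real (Suc n)) * sqrt (real (Suc n)) = real (Suc n)" by simp
  ultimately have "1 / sqrt (real (Suc n)) \<le> 2 * sqrt (real (Suc n)) - 2 * sqrt (real n)"
    by (simp add: field_simps del: real_sqrt_mult_self)
  then show ?case using Suc by simp
qed simp

text \<open>Integral comparison as a telescoping sum: x^(1-s) (1 + (s-1)/x) \<le> (x-1)^(1-s), from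
  1 + u \<le> exp u and ln (1 - 1/x) \<le> -1/x.\<close>

lemma sum_powr_tail_le:
  assumes "1 < s" "0 < m" "m \<le> n"
  shows "(\<Sum>j=Suc m..n. real j powr (- s)) \<le> (real m powr (1 - s) - real n powr (1 - s)) / (s - 1)"
  using assms(3)
proof (induction n rule: dec_induct)
  case base
  then show ?case by simp
next
  case (step n)
  define x where "x = real (Suc n)"
  have x: "1 < x" "real n = x * (1 - 1 / x)" using step assms by (auto simp: x_def field_simps)
  have "1 + (s - 1) / x \<le> exp ((s - 1) / x)" by (rule exp_ge_add_one_self)
  also have "\<dots> \<le> exp ((s - 1) * - ln (1 - 1 / x))"
  proof -
    have "ln (1 - 1 / x) \<le> - (1 / x)" using x ln_le_minus_one[of "1 - 1 / x"] by simp
    then have "(s - 1) * (1 / x) \<le> (s - 1) * - ln (1 - 1 / x)" using assms by (intro mult_left_mono) auto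
    then show ?thesis by simp
  qed
  also have "\<dots> = (1 - 1 / x) powr (1 - s)" using x by (simp add: powr_def algebra_simps)
  finally have "x powr (1 - s) * (1 + (s - 1) / x) \<le> x powr (1 - s) * (1 - 1 / x) powr (1 - s)"
    by (intro mult_left_mono) auto
  also have "\<dots> = real n powr (1 - s)" using x by (simp add: powr_mult)
  also have "x powr (1 - s) * (1 + (s - 1) / x) = x powr (1 - s) + (s - 1) * x powr (- s)"
  proof -
    have "x powr (1 - s) = x * x powr (- s)" using x powr_add[of x 1 "- s"] by simp
    then show ?thesis using x by (simp add: field_simps)
  qed
  finally have "x powr (- s) \<le> (real n powr (1 - s) - x powr (1 - s)) / (s - 1)"
    using assms by (simp add: field_simps)
  then show ?case using step by (simp add: x_def diff_divide_distrib)
qed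

text \<open>Linearity in A is the point: a small density of zeros then produces only a small
  multiple of the growth. Terms with j \<le> A use ln (1 + x^s) \<le> 3 s sqrt x, the others ln (1 +
  u) \<le> u; s > 1 makes the tail summable.\<close>

lemma sum_ln_powr_le:
  assumes "1 < s" "0 < A"
  shows "(\<Sum>j=1..n. ln (1 + (A / real j) powr s)) \<le> (6 * s + 1 + 1 / (s - 1)) * A"
proof -
  define m where "m = nat \<lfloor>A\<rfloor>"
  have m: "real m \<le> A" "A < real m + 1" using assms by (auto simp: m_def)
  define f where "f = (\<lambda>j. ln (1 + (A / real j) powr s))"
  have f0: "0 \<le> f j" for j by (simp add: f_def)
  have "(\<Sum>j=1..n. f j) \<le> (\<Sum>j\<in>{1..m} \<union> {m+1..n}. f j)"
    using f0 by (intro sum_mono2) auto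
  also have "\<dots> = (\<Sum>j=1..m. f j) + (\<Sum>j=m+1..n. f j)" by (intro sum.union_disjoint) auto
  also have "(\<Sum>j=1..m. f j) \<le> (\<Sum>j=1..m. 3 * s * sqrt A * (1 / sqrt (real j)))"
  proof (rule sum_mono)
    fix j assume j: "j \<in> {1..m}"
    define x where "x = A / real j"
    have x: "1 \<le> x" using j m by (auto simp: x_def field_simps)
    have "1 + x powr s \<le> 2 * x powr s" using x assms by (simp add: ge_one_powr_ge_zero)
    also have "\<dots> \<le> (2::real) powr s * x powr s"
      using assms powr_mono[of 1 s 2] by (intro mult_right_mono) auto
    finally have "ln (1 + x powr s) \<le> ln ((2 * x) powr s)"
      using x by (simp add: powr_mult add_pos_pos)
    also have "\<dots> = s * (ln 2 + 2 * ln (sqrt x))" using x by (simp add: ln_powr ln_mult ln_sqrt)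
    also have "\<dots> \<le> s * (3 * sqrt x)"
      using assms ln_le_minus_one[of "sqrt x"] ln_le_minus_one[of "2::real"] x real_sqrt_ge_one[of x]
      by (intro mult_left_mono) linarith+
    finally show "f j \<le> 3 * s * sqrt A * (1 / sqrt (real j))"
      by (simp add: f_def x_def real_sqrt_divide mult_ac)
  qed
  also have "\<dots> \<le> 3 * s * sqrt A * (2 * sqrt (real m))"
    unfolding sum_distrib_left[symmetric] using assms sum_inverse_sqrt_le[of m]
    by (intro mult_left_mono) auto
  also have "\<dots> \<le> 3 * s * sqrt A * (2 * sqrt A)"
    using m assms by (intro mult_left_mono) auto
  also have "\<dots> = 6 * s * A" using assms by simp
  also have "(\<Sum>j=m+1..n. f j) \<le> A + A / (s - 1)"
  proof (cases "m + 1 \<le> n")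
    case True
    have fj: "f j \<le> A powr s * real j powr (- s)" if "j > 0" for j
      using assms that ln_add_one_self_le_self[of "(A / real j) powr s"]
      by (simp add: f_def powr_divide powr_minus divide_simps)
    \<comment> \<open>Term m + 1 is split off because the tail estimate starts one index later; its
      argument A / (m + 1) is below 1, so A bounds it directly.\<close>
    have "(\<Sum>j=m+1..n. f j) = f (m + 1) + (\<Sum>j=Suc (m+1)..n. f j)"
      using True by (simp add: sum.atLeast_Suc_atMost)
    also have "(\<Sum>j=Suc (m+1)..n. f j) \<le> (\<Sum>j=Suc (m+1)..n. A powr s * real j powr (- s))"
      by (intro sum_mono fj) auto
    also have "\<dots> \<le> A powr s * ((real (m+1) powr (1 - s) - real n powr (1 - s)) / (s - 1))"
      unfolding sum_distrib_left[symmetric] using True assms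
      by (intro mult_left_mono sum_powr_tail_le) auto
    also have "\<dots> \<le> A powr s * (A powr (1 - s) / (s - 1))"
    proof -
      have "real (m+1) powr (1 - s) \<le> A powr (1 - s)"
        using m assms by (intro powr_mono2') auto
      then have "real (m+1) powr (1 - s) - real n powr (1 - s) \<le> A powr (1 - s)"
        using powr_ge_zero[of "real n" "1 - s"] by linarith
      then show ?thesis using assms by (intro mult_left_mono divide_right_mono) auto
    qed
    also have "\<dots> = A / (s - 1)" using assms by (simp flip: powr_add)
    also have "f (m + 1) \<le> A"
    proof -
      define x where "x = A / real (m + 1)"
      have x: "0 < x" "x \<le> 1" "x \<le> A" using assms m by (auto simp: x_def field_simps)
      have "f (m + 1) \<le> x powr s" using ln_add_one_self_le_self[of "x powr s"] by (simp add: f_def x_def)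
      also have "\<dots> \<le> x powr 1" using x assms by (intro powr_mono') auto
      also have "\<dots> \<le> A" using x by simp
      finally show ?thesis .
    qed
    finally show ?thesis by simp
  next
    case False
    then show ?thesis using assms by simp
  qed
  finally show ?thesis by (simp add: f_def algebra_simps)
qed


section \<open>Upper and lower density of zeros\<close>

lemma Limsup_card_zeros_finite:
  fixes f :: "complex \<Rightarrow> complex"
  assumes "f holomorphic_on UNIV" "f 0 = 1" "0 < \<rho>"
    and "\<And>z. 1 \<le> norm z \<Longrightarrow> norm (f z) \<le> exp (C * norm z powr \<rho>)"
  shows "Limsup at_top (\<lambda>r. ereal (real (card {z. f z = 0 \<and> norm z < r}) / r powr \<rho>)) < \<infinity>"
proof -
  define K where "K = C * 3 powr \<rho> / ln 2"
  have "real (card {z. f z = 0 \<and> norm z < r}) / r powr \<rho> \<le> K" if r: "1 \<le> r" for r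
  proof -
    have M: "norm (f z) \<le> exp (C * (3 * r) powr \<rho>)" if "norm z = 3 * r" for z
      using assms(4)[of z] that r by simp
    have r0: "0 < r" using r by simp
    note Z = card_zeros_le[OF assms(1,2) r0 M]
    have "card {z. f z = 0 \<and> norm z < r} \<le> card {z. f z = 0 \<and> norm z \<le> r}"
      using Z(1) by (intro card_mono) auto
    moreover have "ln (2 ^ card {z. f z = 0 \<and> norm z \<le> r}) \<le> ln (exp (C * (3 * r) powr \<rho>))"
      using Z(2) by (intro ln_mono) auto
    then have "real (card {z. f z = 0 \<and> norm z \<le> r}) * ln 2 \<le> C * 3 powr \<rho> * r powr \<rho>"
      using r by (simp add: ln_realpow powr_mult)
    then have "real (card {z. f z = 0 \<and> norm z \<le> r}) \<le> K * r powr \<rho>"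
      by (simp add: K_def field_simps)
    ultimately show ?thesis using r by (simp add: divide_le_eq)
  qed
  then have "\<forall>\<^sub>F r in at_top. ereal (real (card {z. f z = 0 \<and> norm z < r}) / r powr \<rho>) \<le> ereal K"
    by (intro eventually_mono[OF eventually_ge_at_top[of 1]]) auto
  then have "Limsup at_top (\<lambda>r. ereal (real (card {z. f z = 0 \<and> norm z < r}) / r powr \<rho>)) \<le> ereal K"
    by (rule Limsup_bounded)
  then show ?thesis by (rule le_less_trans) simp
qed

text \<open>By contradiction: if the density of zeros were eventually below e / 2, then log |f(iy)|
  would be at most K e y^\<rho> up to logarithmic terms, against the lower bound c y^\<rho>.\<close>

lemma Limsup_card_zeros_pos:
  fixes f :: "complex \<Rightarrow> complex"
  assumes "f holomorphic_on UNIV" "f 0 = 1" "0 < \<rho>" "\<rho> < 1" "0 < C" "0 < c"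
    and upper: "\<And>z. 1 \<le> norm z \<Longrightarrow> norm (f z) \<le> exp (C * norm z powr \<rho>)"
    and simple: "\<And>z. f z = 0 \<Longrightarrow> deriv f z \<noteq> 0"
    and lower: "\<forall>\<^sub>F y in at_top. exp (c * y powr \<rho>) \<le> norm (f (\<i> * of_real y))"
  shows "0 < Limsup at_top (\<lambda>r. ereal (real (card {z. f z = 0 \<and> norm z < r}) / r powr \<rho>))"
proof (rule ccontr)
  define s where "s = 1 / \<rho>"
  define K where "K = 6 * s + 1 + 1 / (s - 1)"
  have s: "1 < s" "\<rho> = 1 / s" using assms by (auto simp: s_def field_simps)
  have K: "0 < K" using s by (simp add: K_def add_pos_pos)
  \<comment> \<open>K is the constant of \<open>sum_ln_powr_le\<close>, so K e = c / 4; together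
    with the share c / 2 reserved for the zeros in \<open>L0\<close> this stays below c.\<close>
  define e where "e = c / (4 * K)"
  have e: "0 < e" using K assms by (simp add: e_def)
  define n where "n = (\<lambda>r. real (card {z. f z = 0 \<and> norm z < r}))"
  have fin: "finite {z. f z = 0 \<and> norm z \<le> R}" if "0 < R" for R
  proof -
    have "finite {z. f z = 0 \<and> norm z \<le> max R 1}"
    proof (rule card_zeros_le(1)[OF assms(1,2)])
      show "norm (f z) \<le> exp (C * (3 * max R 1) powr \<rho>)" if "norm z = 3 * max R 1" for z
        using upper[of z] that by simp
    qed simp
    then show ?thesis by (rule rev_finite_subset) auto
  qed
  assume "\<not> ?thesis"
  then have "Limsup at_top (\<lambda>r. ereal (n r / r powr \<rho>)) < ereal (e / 2)"
    using e unfolding n_def by (simp add: le_less_trans not_less)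
  then have "\<forall>\<^sub>F r in at_top. ereal (n r / r powr \<rho>) < ereal (e / 2)"
    by (rule Limsup_lessD)
  then obtain B where B: "\<And>r. B \<le> r \<Longrightarrow> n r / r powr \<rho> < e / 2"
    unfolding eventually_at_top_linorder less_ereal.simps by blast
  define r0 where "r0 = max B 1"
  have r0: "0 < r0" "\<And>r. r0 \<le> r \<Longrightarrow> n r / r powr \<rho> < e / 2"
    using B by (auto simp: r0_def)
  \<comment> \<open>The density bound is known only from \<open>r0\<close> on; the zeros below form
    a finite exceptional set, whose contribution is logarithmic in y.\<close>
  define L0 where "L0 = {z. f z = 0 \<and> norm z \<le> r0}"
  have L0: "finite L0" "0 \<notin> L0" using fin[OF r0(1)] assms(2) by (auto simp: L0_def)
  have bound: "ln (norm (f (\<i> * of_real y))) \<le> 1 + (\<Sum>w\<in>L0. ln (1 + y / norm w)) + K * e * y powr \<rho>"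
    if y: "0 < y" "f (\<i> * of_real y) \<noteq> 0" for y
  proof -
    \<comment> \<open>As \<rho> < 1, the exponent supplied by \<open>entire_bound_by_zeros\<close>
      tends to 0 for fixed y; R is taken so large that it is below 1.\<close>
    have "((\<lambda>R. 4 * C * (2 * R) powr \<rho> * y / (R - y)) \<longlongrightarrow> 0) at_top"
      using assms(3,4) by real_asymp
    then have "\<forall>\<^sub>F R in at_top. 4 * C * (2 * R) powr \<rho> * y / (R - y) < 1"
      by (rule order_tendstoD) simp
    then have "\<forall>\<^sub>F R in at_top. 4 * C * (2 * R) powr \<rho> * y / (R - y) < 1 \<and> max 1 (max r0 y) < R"
      by (intro eventually_conj eventually_gt_at_top)
    then obtain R where R: "4 * C * (2 * R) powr \<rho> * y / (R - y) < 1" "1 < R" "r0 < R" "y < R"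
      by (auto simp: eventually_at_top_linorder)
    define L where "L = {w. f w = 0 \<and> norm w \<le> R}"
    have L: "finite L" "L0 \<subseteq> L" "0 \<notin> L" using fin[of R] R assms(2) by (auto simp: L_def L0_def)
    have lt: "norm (f z) < exp (2 * C * (2 * R) powr \<rho>)" if "norm z = 2 * R" for z
    proof -
      have "norm (f z) \<le> exp (C * (2 * R) powr \<rho>)" using upper[of z] that R by simp
      also have "\<dots> < exp (2 * C * (2 * R) powr \<rho>)" using R assms by simp
      finally show ?thesis .
    qed
    have "norm (f (\<i> * of_real y)) \<le> exp (2 * (2 * C * (2 * R) powr \<rho>) * norm (\<i> * of_real y) / (R - norm (\<i> * of_real y))) *
        (\<Prod>w\<in>L. 1 + norm (\<i> * of_real y) / norm w)"
      unfolding L_def using R y assms fin[of R]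
      by (intro entire_bound_by_zeros[OF assms(1,2) simple] lt) (auto simp: norm_mult)
    also have "\<dots> \<le> exp 1 * (\<Prod>w\<in>L. 1 + y / norm w)"
      using R(1) y by (intro mult_mono) (auto intro!: prod_nonneg simp: norm_mult mult_ac)
    finally have "ln (norm (f (\<i> * of_real y))) \<le> ln (exp 1 * (\<Prod>w\<in>L. 1 + y / norm w))"
      using y by (intro ln_mono) auto
    also have "\<dots> = 1 + (\<Sum>w\<in>L. ln (1 + y / norm w))"
    proof -
      have p: "0 < 1 + y / norm w" for w :: complex using y by (intro add_pos_nonneg) auto
      have "ln (\<Prod>w\<in>L. 1 + y / norm w) = (\<Sum>w\<in>L. ln (1 + y / norm w))"
        using L(1) less_imp_neq[OF p] by (intro ln_prod) auto
      moreover have "0 < (\<Prod>w\<in>L. 1 + y / norm w)" using p by (intro prod_pos) auto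
      ultimately show ?thesis by (simp add: ln_mult_pos)
    qed
    also have "(\<Sum>w\<in>L. ln (1 + y / norm w)) = (\<Sum>w\<in>L - L0. ln (1 + y / norm w)) + (\<Sum>w\<in>L0. ln (1 + y / norm w))"
      by (rule sum.subset_diff[OF L(2,1)])
    also have "(\<Sum>w\<in>L - L0. ln (1 + y / norm w)) \<le> (\<Sum>j=1..card (L - L0). ln (1 + y / (real j / e) powr s))"
    proof (rule sum_le_sum_by_count)
      show "finite (L - L0)" using L by simp
      show "real (card {w \<in> L - L0. norm w \<le> t}) \<le> e * t powr (1 / s)" if "0 < t" for t
      proof (cases "t \<le> r0")
        case True
        then have "{w \<in> L - L0. norm w \<le> t} = {}" by (auto simp: L_def L0_def)
        then show ?thesis using e by (simp only: card.empty) simp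
      next
        case False
        \<comment> \<open>Doubling t passes from \<open>\<le>\<close> to the strict inequality in
          \<open>n\<close>; the loss 2^\<rho> \<le> 2 is why the density was bounded by e /
          2.\<close>
        have "finite {z. f z = 0 \<and> norm z < 2 * t}"
          using that by (intro finite_subset[OF _ fin[of "2 * t"]]) auto
        then have "card {w \<in> L - L0. norm w \<le> t} \<le> card {z. f z = 0 \<and> norm z < 2 * t}"
          using that by (intro card_mono) (auto simp: L_def)
        then have "real (card {w \<in> L - L0. norm w \<le> t}) \<le> n (2 * t)" by (simp add: n_def)
        also have "\<dots> \<le> e / 2 * (2 * t) powr \<rho>"
          using r0(2)[of "2 * t"] False that by (simp add: divide_less_eq)
        also have "\<dots> \<le> e * t powr \<rho>"
        proof -
          have "(2::real) powr \<rho> \<le> 2 powr 1" using assms by (intro powr_mono) auto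
          then have "e / 2 * (2 powr \<rho> * t powr \<rho>) \<le> e / 2 * (2 * t powr \<rho>)"
            using e by (intro mult_left_mono mult_right_mono) auto
          then show ?thesis using that by (simp add: powr_mult)
        qed
        finally show ?thesis using s by simp
      qed
      show "ln (1 + y / b) \<le> ln (1 + y / a)" if "0 < a" "a \<le> b" for a b
        using that y by (intro ln_mono) (auto intro!: divide_left_mono add_pos_nonneg)
    qed (use e s L in \<open>auto\<close>)
    \<comment> \<open>As s = 1 / \<rho>, the quotient is an s-th power, in the form that
      \<open>sum_ln_powr_le\<close> treats with A = e y^\<rho>.\<close>
    also have "\<dots> = (\<Sum>j=1..card (L - L0). ln (1 + (e * y powr \<rho> / real j) powr s))"
    proof (intro sum.cong refl)
      fix j assume "j \<in> {1..card (L - L0)}"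
      then have "(e * y powr \<rho> / real j) powr s = e powr s * (y powr \<rho>) powr s / real j powr s"
        using e by (simp add: powr_divide powr_mult)
      also have "(y powr \<rho>) powr s = y" using s y by (simp add: powr_powr)
      finally show "ln (1 + y / (real j / e) powr s) = ln (1 + (e * y powr \<rho> / real j) powr s)"
        using e by (simp only:) (simp add: powr_divide mult_ac)
    qed
    also have "\<dots> \<le> K * (e * y powr \<rho>)"
      unfolding K_def using e y(1) by (intro sum_ln_powr_le[OF s(1)]) simp
    finally show ?thesis by (simp add: mult_ac)
  qed
  have "((\<lambda>y. (\<Sum>w\<in>L0. ln (1 + y / norm w) / y powr \<rho>) + 1 / y powr \<rho>) \<longlongrightarrow> (\<Sum>w\<in>L0. 0) + 0) at_top"
  proof (intro tendsto_add tendsto_sum)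
    show "((\<lambda>y. ln (1 + y / norm w) / y powr \<rho>) \<longlongrightarrow> 0) at_top" if "w \<in> L0" for w
    proof -
      have "0 < norm w" using L0 that by auto
      then show ?thesis using assms(3) by real_asymp
    qed
    show "((\<lambda>y. 1 / y powr \<rho>) \<longlongrightarrow> 0) at_top" using assms(3) by real_asymp
  qed
  then have "\<forall>\<^sub>F y in at_top. (\<Sum>w\<in>L0. ln (1 + y / norm w) / y powr \<rho>) + 1 / y powr \<rho> < c / 2"
    using assms by (intro order_tendstoD) auto
  with lower have "\<forall>\<^sub>F y in at_top. exp (c * y powr \<rho>) \<le> norm (f (\<i> * of_real y)) \<and>
      (\<Sum>w\<in>L0. ln (1 + y / norm w) / y powr \<rho>) + 1 / y powr \<rho> < c / 2 \<and> 0 < y"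
    by (intro eventually_conj eventually_gt_at_top)
  then obtain y where y: "exp (c * y powr \<rho>) \<le> norm (f (\<i> * of_real y))"
      "(\<Sum>w\<in>L0. ln (1 + y / norm w) / y powr \<rho>) + 1 / y powr \<rho> < c / 2" "0 < y"
    by (auto simp: eventually_at_top_linorder)
  have nz: "f (\<i> * of_real y) \<noteq> 0"
  proof
    assume "f (\<i> * of_real y) = 0"
    with y(1) exp_gt_zero[of "c * y powr \<rho>"] show False by (simp del: exp_gt_zero)
  qed
  then have "c * y powr \<rho> \<le> ln (norm (f (\<i> * of_real y)))"
    using y(1) by (subst ln_ge_iff) auto
  also have "\<dots> \<le> 1 + (\<Sum>w\<in>L0. ln (1 + y / norm w)) + K * e * y powr \<rho>"
    using bound[OF y(3) nz] .
  also have "1 + (\<Sum>w\<in>L0. ln (1 + y / norm w)) = ((\<Sum>w\<in>L0. ln (1 + y / norm w) / y powr \<rho>) + 1 / y powr \<rho>) * y powr \<rho>"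
    using y(3) by (simp add: sum_divide_distrib[symmetric] field_simps)
  also have "\<dots> < c / 2 * y powr \<rho>" using y by (intro mult_strict_right_mono) auto
  also have "K * e = c / 4" using K by (simp add: e_def)
  finally have "c * y powr \<rho> < 3 / 4 * (c * y powr \<rho>)" by (simp add: algebra_simps)
  then show False using assms(6) y(3) by simp
qed

section \<open>The determinant of \<open>\<Omega>\<close>\<close>

text \<open>Jordan's inequality: the concave sine lies above its chord.\<close>

lemma sin_ge_linear:
  assumes "0 \<le> x" "x \<le> pi / 2"
  shows "2 / pi * x \<le> sin x"
proof -
  have "convex_on {0..pi / 2} (\<lambda>x. - sin x)"
  proof (rule f''_ge0_imp_convex)
    show "((\<lambda>x. - sin x) has_real_derivative - cos x) (at x)" for x :: real
      by (auto intro!: derivative_eq_intros)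
    show "((\<lambda>x. - cos x) has_real_derivative sin x) (at x)" for x :: real
      by (auto intro!: derivative_eq_intros)
    show "0 \<le> sin x" if "x \<in> {0..pi / 2}" for x :: real
      using that by (intro sin_ge_zero) auto
  qed simp
  then have "- sin ((1 - 2 / pi * x) *\<^sub>R 0 + (2 / pi * x) *\<^sub>R (pi / 2))
      \<le> (1 - 2 / pi * x) * - sin 0 + (2 / pi * x) * - sin (pi / 2)"
    using assms by (intro convex_onD) (auto simp: field_simps)
  then show ?thesis by simp
qed

lemma abs_sin_ge_linear:
  assumes "\<bar>x\<bar> \<le> pi / 2"
  shows "2 / pi * \<bar>x\<bar> \<le> \<bar>sin x\<bar>"
  using sin_ge_linear[of "\<bar>x\<bar>"] assms by (auto simp: abs_if split: if_splits)

lemma ham_of_angle_nth: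
  "ham_of_angle \<phi> t $ 1 $ 1 = (cos (\<phi> t))\<^sup>2" "ham_of_angle \<phi> t $ 1 $ 2 = cos (\<phi> t) * sin (\<phi> t)"
  "ham_of_angle \<phi> t $ 2 $ 1 = cos (\<phi> t) * sin (\<phi> t)" "ham_of_angle \<phi> t $ 2 $ 2 = (sin (\<phi> t))\<^sup>2"
  by (auto simp: ham_of_angle_def xi_def power2_eq_square)

lemma continuous_on_ham_of_angle:
  assumes "continuous_on S \<phi>"
  shows "continuous_on S (ham_of_angle \<phi>)"
proof -
  have "continuous_on S (\<lambda>x. xi (\<phi> x) $ i)" for i
    using exhaust_2[of i] continuous_on_cos[OF assms] continuous_on_sin[OF assms] by (auto simp: xi_def)
  then show ?thesis
    unfolding ham_of_angle_def by (intro continuous_on_vec_lambda continuous_on_mult)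
qed

lemma Omega_nth:
  assumes "continuous_on UNIV \<phi>"
  shows "Omega (ham_of_angle \<phi>) s t $ i $ j = integral {s..t} (\<lambda>x. ham_of_angle \<phi> x $ i $ j)"
proof -
  have "bounded_linear (\<lambda>A :: real^2^2. A $ i $ j)"
    by (intro bounded_linear_compose[OF bounded_linear_vec_nth bounded_linear_vec_nth])
  moreover have "ham_of_angle \<phi> integrable_on {s..t}"
    using assms by (intro integrable_continuous_real continuous_on_ham_of_angle) (auto intro: continuous_on_subset)
  ultimately show ?thesis
    using integral_linear[of "ham_of_angle \<phi>" "{s..t}" "\<lambda>A. A $ i $ j"] by (simp add: Omega_def o_def)
qed

abbreviation detO :: "(real \<Rightarrow> real) \<Rightarrow> real \<Rightarrow> real \<Rightarrow> real" where
  "detO \<phi> s t \<equiv> det (Omega (ham_of_angle \<phi>) s t)"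

lemma sin_squared_diff:
  "(sin (x - y :: real))\<^sup>2 = (sin x)\<^sup>2 * (cos y)\<^sup>2 + (cos x)\<^sup>2 * (sin y)\<^sup>2 - 2 * (cos x * sin x) * (cos y * sin y)"
  by (simp add: sin_diff power2_eq_square algebra_simps)

lemma integral_sin_squared_diff:
  assumes "continuous_on UNIV \<phi>"
  shows "integral {s..t} (\<lambda>x. (sin (\<phi> x - y))\<^sup>2) =
    (cos y)\<^sup>2 * Omega (ham_of_angle \<phi>) s t $ 2 $ 2 + (sin y)\<^sup>2 * Omega (ham_of_angle \<phi>) s t $ 1 $ 1
    - 2 * (cos y * sin y) * Omega (ham_of_angle \<phi>) s t $ 1 $ 2"
proof -
  have c: "continuous_on {s..t} \<phi>" using assms continuous_on_subset by blast
  have i: "(\<lambda>x. (sin (\<phi> x))\<^sup>2 * (cos y)\<^sup>2) integrable_on {s..t}"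
    "(\<lambda>x. (cos (\<phi> x))\<^sup>2 * (sin y)\<^sup>2) integrable_on {s..t}"
    "(\<lambda>x. 2 * (cos (\<phi> x) * sin (\<phi> x)) * (cos y * sin y)) integrable_on {s..t}"
    using c by (auto intro!: integrable_continuous_real continuous_intros)
  have "integral {s..t} (\<lambda>x. (sin (\<phi> x - y))\<^sup>2) = integral {s..t} (\<lambda>x. (sin (\<phi> x))\<^sup>2 * (cos y)\<^sup>2)
      + integral {s..t} (\<lambda>x. (cos (\<phi> x))\<^sup>2 * (sin y)\<^sup>2)
      - integral {s..t} (\<lambda>x. 2 * (cos (\<phi> x) * sin (\<phi> x)) * (cos y * sin y))"
    unfolding sin_squared_diff using i by (simp add: integral_diff integral_add integrable_add)
  then show ?thesis by (simp add: Omega_nth[OF assms] ham_of_angle_nth)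
qed

text \<open>The determinant is the Gram determinant of cos \<phi> and sin \<phi> in L^2, and the
  integrand is the square of their 2 x 2 minor at x and y (Lagrange's identity).\<close>

lemma det_Omega_eq:
  assumes "continuous_on UNIV \<phi>"
  shows "2 * detO \<phi> s t =
    integral {s..t} (\<lambda>y. integral {s..t} (\<lambda>x. (sin (\<phi> x - \<phi> y))\<^sup>2))"
proof -
  have c: "continuous_on {s..t} \<phi>" using assms continuous_on_subset by blast
  define A where "A = Omega (ham_of_angle \<phi>) s t"
  have i: "(\<lambda>x. (cos (\<phi> x))\<^sup>2 * A $ 2 $ 2) integrable_on {s..t}"
    "(\<lambda>x. (sin (\<phi> x))\<^sup>2 * A $ 1 $ 1) integrable_on {s..t}"
    "(\<lambda>x. 2 * (cos (\<phi> x) * sin (\<phi> x)) * A $ 1 $ 2) integrable_on {s..t}"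
    using c by (auto intro!: integrable_continuous_real continuous_intros)
  have "integral {s..t} (\<lambda>y. integral {s..t} (\<lambda>x. (sin (\<phi> x - \<phi> y))\<^sup>2)) =
      integral {s..t} (\<lambda>x. (cos (\<phi> x))\<^sup>2 * A $ 2 $ 2) + integral {s..t} (\<lambda>x. (sin (\<phi> x))\<^sup>2 * A $ 1 $ 1)
      - integral {s..t} (\<lambda>x. 2 * (cos (\<phi> x) * sin (\<phi> x)) * A $ 1 $ 2)"
    unfolding integral_sin_squared_diff[OF assms] A_def[symmetric]
    using i by (simp add: integral_diff integral_add integrable_add)
  also have "\<dots> = A $ 1 $ 1 * A $ 2 $ 2 + A $ 2 $ 2 * A $ 1 $ 1 - 2 * (A $ 1 $ 2 * A $ 1 $ 2)"
    by (simp add: A_def Omega_nth[OF assms] ham_of_angle_nth)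
  also have "A $ 1 $ 2 = A $ 2 $ 1" by (simp add: A_def Omega_nth[OF assms] ham_of_angle_nth)
  finally show ?thesis
    unfolding A_def[symmetric] by (simp add: det_2)
       (simp add: A_def Omega_nth[OF assms] ham_of_angle_nth)
qed

lemma continuous_on_integral_sin:
  fixes \<phi> :: "real \<Rightarrow> real"
  assumes "continuous_on UNIV \<phi>"
  shows "continuous_on S (\<lambda>y. integral {s..t} (\<lambda>x. (sin (\<phi> x - \<phi> y))\<^sup>2))"
  using continuous_on_subset[OF assms, of S]
  unfolding integral_sin_squared_diff[OF assms] by (auto intro!: continuous_intros)

lemma integrable_sin_squared:
  fixes \<phi> :: "real \<Rightarrow> real"
  assumes "continuous_on UNIV \<phi>"
  shows "(\<lambda>x. (sin (\<phi> x - y))\<^sup>2) integrable_on {s..t}"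
  using continuous_on_subset[OF assms, of "{s..t}"]
  by (auto intro!: integrable_continuous_real continuous_intros)

lemma integral_sin_squared_mono:
  fixes \<phi> :: "real \<Rightarrow> real"
  assumes "continuous_on UNIV \<phi>" "s \<le> s'" "t' \<le> t"
  shows "integral {s'..t'} (\<lambda>x. (sin (\<phi> x - y))\<^sup>2) \<le> integral {s..t} (\<lambda>x. (sin (\<phi> x - y))\<^sup>2)"
  using assms by (intro integral_subset_le integrable_sin_squared) auto

lemma integrable_integral_sin:
  fixes \<phi> :: "real \<Rightarrow> real"
  assumes "continuous_on UNIV \<phi>"
  shows "(\<lambda>y. integral {s..t} (\<lambda>x. (sin (\<phi> x - \<phi> y))\<^sup>2)) integrable_on {s'..t'}"
  by (intro integrable_continuous_real continuous_on_integral_sin assms)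

text \<open>The squares over [s,t] and [t,u] lie in the square over [s,u] and meet only in a corner,
  and the integrand of \<open>det_Omega_eq\<close> is nonnegative.\<close>

lemma det_Omega_superadditive:
  assumes "continuous_on UNIV \<phi>" "s \<le> t" "t \<le> u"
  shows "detO \<phi> s t + detO \<phi> t u \<le> detO \<phi> s u"
proof -
  let ?g = "\<lambda>s t y. integral {s..t} (\<lambda>x. (sin (\<phi> x - \<phi> y))\<^sup>2)"
  have "integral {s..t} (?g s t) + integral {t..u} (?g t u) \<le> integral {s..t} (?g s u) + integral {t..u} (?g s u)"
    using assms by (intro add_mono integral_le integrable_integral_sin integral_sin_squared_mono) auto
  also have "\<dots> = integral {s..u} (?g s u)"
    using assms by (intro Henstock_Kurzweil_Integration.integral_combine integrable_integral_sin)
  finally show ?thesis using det_Omega_eq[OF assms(1)] by (metis distrib_left mult_le_cancel_left_pos zero_less_numeral)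
qed

lemma det_Omega_nonneg:
  assumes "continuous_on UNIV \<phi>"
  shows "0 \<le> detO \<phi> s t"
proof -
  have "0 \<le> integral {s..t} (\<lambda>y. integral {s..t} (\<lambda>x. (sin (\<phi> x - \<phi> y))\<^sup>2))"
    by (intro integral_nonneg integrable_integral_sin integrable_sin_squared assms) auto
  then show ?thesis using det_Omega_eq[OF assms, of s t] by simp
qed

lemma det_Omega_mono:
  assumes "continuous_on UNIV \<phi>" "s \<le> s'" "s' \<le> t'" "t' \<le> t"
  shows "detO \<phi> s' t' \<le> detO \<phi> s t"
  using det_Omega_superadditive[OF assms(1), of s s' t] det_Omega_superadditive[OF assms(1), of s' t' t]
    det_Omega_nonneg[OF assms(1), of s s'] det_Omega_nonneg[OF assms(1), of t' t] assms by linarith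

lemma det_Omega_le:
  assumes "continuous_on UNIV \<phi>" "s \<le> t"
    and "\<And>x y. x \<in> {s..t} \<Longrightarrow> y \<in> {s..t} \<Longrightarrow> \<bar>\<phi> x - \<phi> y\<bar> \<le> d"
  shows "2 * detO \<phi> s t \<le> (t - s)\<^sup>2 * d\<^sup>2"
proof -
  have "integral {s..t} (\<lambda>x. (sin (\<phi> x - \<phi> y))\<^sup>2) \<le> (t - s) * d\<^sup>2" if "y \<in> {s..t}" for y
  proof -
    have "(sin (\<phi> x - \<phi> y))\<^sup>2 \<le> d\<^sup>2" if "x \<in> {s..t}" for x
    proof -
      have "\<bar>sin (\<phi> x - \<phi> y)\<bar> \<le> d"
        using abs_sin_x_le_abs_x[of "\<phi> x - \<phi> y"] assms(3)[OF that \<open>y \<in> _\<close>] by linarith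
      then show ?thesis using power_mono[of "\<bar>sin (\<phi> x - \<phi> y)\<bar>" d 2] by simp
    qed
    then have "integral {s..t} (\<lambda>x. (sin (\<phi> x - \<phi> y))\<^sup>2) \<le> integral {s..t} (\<lambda>x. d\<^sup>2)"
      by (intro integral_le integrable_sin_squared assms) auto
    then show ?thesis using assms by simp
  qed
  then have "integral {s..t} (\<lambda>y. integral {s..t} (\<lambda>x. (sin (\<phi> x - \<phi> y))\<^sup>2)) \<le> integral {s..t} (\<lambda>y. (t - s) * d\<^sup>2)"
    by (intro integral_le integrable_integral_sin assms) auto
  then show ?thesis using assms(2) det_Omega_eq[OF assms(1), of s t] by (simp add: power2_eq_square mult_ac)
qed

text \<open>Comparing \<open>\<phi>\<close> with its mirror image bounds its variance from below.\<close>

lemma det_Omega_ge_reflection: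
  fixes p l :: real
  assumes "continuous_on UNIV \<phi>" "0 < l"
    and "\<And>x y. x \<in> {p - l..p + l} \<Longrightarrow> y \<in> {p - l..p + l} \<Longrightarrow> \<bar>\<phi> x - \<phi> y\<bar> \<le> pi / 2"
    and "\<And>x. x \<in> {p - l..p + l} \<Longrightarrow> d * \<bar>x - p\<bar> \<le> \<bar>\<phi> x - \<phi> (2 * p - x)\<bar>" "0 \<le> d"
  shows "2 / (3 * pi\<^sup>2) * d\<^sup>2 * l ^ 4 \<le> det (Omega (ham_of_angle \<phi>) (p - l) (p + l))"
proof -
  let ?J = "{p - l..p + l}"
  have "2 / (3 * pi\<^sup>2) * d\<^sup>2 * l ^ 3 \<le> integral ?J (\<lambda>x. (sin (\<phi> x - \<phi> y))\<^sup>2)" if y: "y \<in> ?J" for y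
  proof -
    define g where "g = (\<lambda>x. (sin (\<phi> x - \<phi> y))\<^sup>2)"
    have cg: "continuous_on S g" for S
      unfolding g_def using continuous_on_subset[OF assms(1), of S] by (auto intro!: continuous_intros)
    have g: "g integrable_on ?J" by (intro integrable_continuous_real cg)
    have cr: "continuous_on ?J (\<lambda>x. g (2 * p - x))"
      by (intro continuous_on_compose2[OF cg[of UNIV]] continuous_intros) auto
    have "((\<lambda>x. g (- x)) has_integral integral ?J g) {- (p + l) .. - (p - l)}"
      using integrable_integral[OF g] by (simp only: has_integral_reflect_real)
    then have "((\<lambda>x. g (- (x - 2 * p))) has_integral integral ?J g) {p - l..p + l}"
      using has_integral_affinity'[of "\<lambda>x. g (- x)" "integral ?J g" "- (p + l)" "- (p - l)" 1 "- 2 * p"]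
      by (simp add: algebra_simps)
    then have eq: "integral ?J (\<lambda>x. g (2 * p - x)) = integral ?J g"
      by (simp add: integral_unique)
    \<comment> \<open>Antiderivative for the second moment about the midpoint, which is 2 l^3 /
      3.\<close>
    define F where "F = (\<lambda>x. (x - p) ^ 3 / 3)"
    have hi: "((\<lambda>x. (x - p)\<^sup>2) has_integral (F (p + l) - F (p - l))) ?J"
      using assms(2) unfolding F_def
      by (intro fundamental_theorem_of_calculus)
         (auto intro!: derivative_eq_intros simp: has_real_derivative_iff_has_vector_derivative[symmetric] power2_eq_square)
    have i2: "(\<lambda>x. 2 / pi\<^sup>2 * d\<^sup>2 * (x - p)\<^sup>2) integrable_on ?J"
      by (intro integrable_continuous_real continuous_intros)
    have "4 / (3 * pi\<^sup>2) * d\<^sup>2 * l ^ 3 = 2 / pi\<^sup>2 * d\<^sup>2 * (F (p + l) - F (p - l))"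
      by (simp add: F_def field_simps)
    also have "\<dots> = integral ?J (\<lambda>x. 2 / pi\<^sup>2 * d\<^sup>2 * (x - p)\<^sup>2)"
      using hi by (simp add: integral_unique)
    \<comment> \<open>For fixed y, the values of \<phi> at x and at its mirror image cannot both be
      close to \<phi> y: (a - b)^2 \<le> 2 (a^2 + b^2) for their deviations a, b, and Jordan's
      inequality passes to the sines.\<close>
    also have "\<dots> \<le> integral ?J (\<lambda>x. g x + g (2 * p - x))"
    proof (rule integral_le[OF i2])
      show "(\<lambda>x. g x + g (2 * p - x)) integrable_on ?J"
        by (intro integrable_continuous_real continuous_on_add cg cr)
      fix x assume x: "x \<in> ?J"
      then have x': "2 * p - x \<in> ?J" by auto
      define a where "a = \<phi> x - \<phi> y"
      define b where "b = \<phi> (2 * p - x) - \<phi> y"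
      have ab: "\<bar>a\<bar> \<le> pi / 2" "\<bar>b\<bar> \<le> pi / 2" using assms(3) x x' y by (auto simp: a_def b_def)
      have sq: "4 / pi\<^sup>2 * c\<^sup>2 \<le> (sin c)\<^sup>2" if "\<bar>c\<bar> \<le> pi / 2" for c
        using power_mono[OF abs_sin_ge_linear[OF that], of 2] by (simp add: power_mult_distrib power_divide)
      have "(d * \<bar>x - p\<bar>)\<^sup>2 \<le> \<bar>a - b\<bar>\<^sup>2"
        using assms(4)[OF x] assms(5) by (intro power_mono) (auto simp: a_def b_def)
      also have "\<dots> \<le> 2 * (a\<^sup>2 + b\<^sup>2)"
        using zero_le_power2[of "a + b"] by (simp add: power2_eq_square algebra_simps)
      finally have "2 / pi\<^sup>2 * (d\<^sup>2 * (x - p)\<^sup>2) \<le> 2 / pi\<^sup>2 * (2 * (a\<^sup>2 + b\<^sup>2))"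
        by (intro mult_left_mono) (auto simp: power_mult_distrib)
      also have "\<dots> \<le> (sin a)\<^sup>2 + (sin b)\<^sup>2" using sq[OF ab(1)] sq[OF ab(2)] by (simp add: algebra_simps)
      finally show "2 / pi\<^sup>2 * d\<^sup>2 * (x - p)\<^sup>2 \<le> g x + g (2 * p - x)" by (simp add: g_def a_def b_def)
    qed
    also have "\<dots> = 2 * integral ?J g"
      using g cr by (subst integral_add) (auto simp: eq intro: integrable_continuous_real)
    finally show ?thesis by (simp add: g_def)
  qed
  then have "integral ?J (\<lambda>y. 2 / (3 * pi\<^sup>2) * d\<^sup>2 * l ^ 3) \<le> integral ?J (\<lambda>y. integral ?J (\<lambda>x. (sin (\<phi> x - \<phi> y))\<^sup>2))"
    by (intro integral_le integrable_integral_sin assms) auto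
  then show ?thesis using assms(2) unfolding det_Omega_eq[OF assms(1), symmetric]
    by (simp add: power_numeral_reduce algebra_simps)
qed

section \<open>The Weierstrass function\<close>

locale weierstrass_angle =
  fixes \<alpha> :: real and \<beta> :: int
  assumes alpha: "0 < \<alpha>" "\<alpha> < 1" and even_beta: "even \<beta>"
    and alpha_beta: "\<alpha> * real_of_int \<beta> > 1 + pi / 2"
begin

definition b :: real where "b = real_of_int \<beta>"

definition \<nu> :: real where "\<nu> = - ln \<alpha> / ln b"

definition \<phi> :: "real \<Rightarrow> real" where "\<phi> = weierstrass \<alpha> b"

definition \<theta> :: "nat \<Rightarrow> real \<Rightarrow> real" where "\<theta> k t = (\<Sum>n<k. \<alpha> ^ n * cos (b ^ n * pi * t))"

text \<open>Bound for the oscillation of \<phi> over a distance b^(-k), in units of \<alpha>^k: the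
  slope of the partial sum \<theta> k contributes the first summand, the tails at the two points the
  second.\<close>

definition osc :: real where "osc = pi / (\<alpha> * b - 1) + 2 / (1 - \<alpha>)"

lemma ab_gt: "1 + pi / 2 < \<alpha> * b" "1 < \<alpha> * b"
  using alpha_beta pi_gt_zero unfolding b_def by linarith+

lemma b_gt_1: "1 < b"
proof -
  have "0 < b" using ab_gt(2) alpha by (metis mult.commute zero_less_mult_pos2 less_trans zero_less_one)
  then have "\<alpha> * b \<le> 1 * b" using alpha by (intro mult_right_mono) auto
  then show ?thesis using ab_gt by simp
qed

lemma b_nz: "b \<noteq> 0" using b_gt_1 by simp

lemma nu: "0 < \<nu>" "\<nu> < 1"
proof -
  have "0 < ln b" "ln \<alpha> < 0" using b_gt_1 alpha by auto
  then show "0 < \<nu>" by (simp add: \<nu>_def divide_neg_pos)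
  have "0 < ln (\<alpha> * b)" using ab_gt by simp
  then have "- ln \<alpha> < ln b" using alpha b_gt_1 by (simp add: ln_mult)
  then show "\<nu> < 1" using \<open>0 < ln b\<close> unfolding \<nu>_def by (subst divide_less_eq_1_pos) auto
qed

lemma alpha_eq: "\<alpha> = b powr (- \<nu>)"
  using alpha b_gt_1 by (simp add: powr_def \<nu>_def)

lemma alpha_power: "\<alpha> ^ k = (1 / b ^ k) powr \<nu>"
proof -
  have "\<alpha> ^ k = (b powr (- \<nu>)) powr real k" 
    using b_gt_1 by (subst alpha_eq, subst powr_realpow) auto
  also have "\<dots> = (b powr real k) powr (- \<nu>)" by (simp add: powr_powr mult.commute)
  also have "\<dots> = (1 / b ^ k) powr \<nu>" using b_gt_1 by (simp add: powr_realpow powr_minus powr_divide divide_inverse inverse_powr)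
  finally show ?thesis .
qed

lemma summable_phi: "summable (\<lambda>n. \<alpha> ^ n * cos (b ^ n * pi * t))"
proof (rule summable_comparison_test')
  show "summable (\<lambda>n. \<alpha> ^ n)" using alpha by (intro summable_geometric) auto
  show "norm (\<alpha> ^ n * cos (b ^ n * pi * t)) \<le> \<alpha> ^ n" for n
    using alpha by (simp add: abs_mult mult_left_le)
qed

text \<open>Self-similarity: the terms from index k on form a rescaled copy of \<phi>, so questions
  at scale b^(-k) reduce to scale 1 plus a smooth partial sum.\<close>

lemma phi_split: "\<phi> t = \<theta> k t + \<alpha> ^ k * \<phi> (b ^ k * t)"
proof -
  have "\<phi> t = (\<Sum>n. \<alpha> ^ (n + k) * cos (b ^ (n + k) * pi * t)) + \<theta> k t"
    unfolding \<phi>_def weierstrass_def \<theta>_def by (rule suminf_split_initial_segment[OF summable_phi])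
  also have "(\<Sum>n. \<alpha> ^ (n + k) * cos (b ^ (n + k) * pi * t)) = \<alpha> ^ k * \<phi> (b ^ k * t)"
    unfolding \<phi>_def weierstrass_def using summable_phi[of "b ^ k * t"]
    by (subst suminf_mult[symmetric]) (auto simp: power_add mult_ac)
  finally show ?thesis by simp
qed

lemma abs_phi_le: "\<bar>\<phi> t\<bar> \<le> 1 / (1 - \<alpha>)"
proof -
  have "norm (\<Sum>n. \<alpha> ^ n * cos (b ^ n * pi * t)) \<le> (\<Sum>n. \<alpha> ^ n)"
    using alpha by (intro norm_suminf_le summable_geometric) (auto simp: abs_mult mult_left_le)
  then show ?thesis using alpha by (simp add: \<phi>_def weierstrass_def suminf_geometric)
qed

lemma abs_phi_minus_theta_le: "\<bar>\<phi> t - \<theta> k t\<bar> \<le> \<alpha> ^ k / (1 - \<alpha>)"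
proof -
  have "\<bar>\<phi> t - \<theta> k t\<bar> = \<alpha> ^ k * \<bar>\<phi> (b ^ k * t)\<bar>"
    using alpha by (subst phi_split[of t k]) (simp add: abs_mult)
  also have "\<dots> \<le> \<alpha> ^ k * (1 / (1 - \<alpha>))"
    using alpha abs_phi_le by (intro mult_left_mono) auto
  finally show ?thesis by simp
qed

definition \<theta>' :: "nat \<Rightarrow> real \<Rightarrow> real" where
  "\<theta>' k t = (\<Sum>n<k. \<alpha> ^ n * (- sin (b ^ n * pi * t) * (b ^ n * pi)))"

lemma theta_derivative: "(\<theta> k has_real_derivative \<theta>' k t) (at t within S)"
  unfolding \<theta>_def \<theta>'_def by (auto intro!: derivative_eq_intros sum.cong)

lemma abs_theta'_le: "\<bar>\<theta>' k t\<bar> \<le> pi / (\<alpha> * b - 1) * (\<alpha> * b) ^ k"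
proof -
  have "\<bar>\<theta>' k t\<bar> \<le> (\<Sum>n<k. \<bar>\<alpha> ^ n * (- sin (b ^ n * pi * t) * (b ^ n * pi))\<bar>)"
    unfolding \<theta>'_def by (rule sum_abs)
  also have "\<dots> \<le> (\<Sum>n<k. pi * (\<alpha> * b) ^ n)"
  proof (rule sum_mono)
    fix n
    have "\<bar>\<alpha> ^ n * (- sin (b ^ n * pi * t) * (b ^ n * pi))\<bar> = \<bar>sin (b ^ n * pi * t)\<bar> * (pi * (\<alpha> * b) ^ n)"
      using alpha b_gt_1 by (simp add: abs_mult power_mult_distrib)
    also have "\<dots> \<le> 1 * (pi * (\<alpha> * b) ^ n)"
      using ab_gt by (intro mult_right_mono) auto
    finally show "\<bar>\<alpha> ^ n * (- sin (b ^ n * pi * t) * (b ^ n * pi))\<bar> \<le> pi * (\<alpha> * b) ^ n" by simp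
  qed
  also have "\<dots> = pi * (((\<alpha> * b) ^ k - 1) / (\<alpha> * b - 1))"
    using ab_gt by (simp add: sum_distrib_left[symmetric] geometric_sum)
  also have "\<dots> \<le> pi / (\<alpha> * b - 1) * (\<alpha> * b) ^ k"
    using ab_gt by (simp add: divide_right_mono)
  finally show ?thesis .
qed

lemma abs_theta_diff_le: "\<bar>\<theta> k x - \<theta> k y\<bar> \<le> pi / (\<alpha> * b - 1) * (\<alpha> * b) ^ k * \<bar>x - y\<bar>"
  using field_differentiable_bound[of UNIV "\<theta> k" "\<theta>' k" "pi / (\<alpha> * b - 1) * (\<alpha> * b) ^ k" x y]
    theta_derivative abs_theta'_le by (simp add: convex_UNIV)

lemma osc_pos: "0 < osc"
  using ab_gt alpha by (auto simp: osc_def intro!: add_pos_pos divide_pos_pos)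

lemma abs_phi_diff_le:
  assumes "\<bar>x - y\<bar> \<le> 1 / b ^ k"
  shows "\<bar>\<phi> x - \<phi> y\<bar> \<le> osc * \<alpha> ^ k"
proof -
  have "\<bar>\<theta> k x - \<theta> k y\<bar> \<le> pi / (\<alpha> * b - 1) * (\<alpha> * b) ^ k * \<bar>x - y\<bar>" by (rule abs_theta_diff_le)
  also have "\<dots> \<le> pi / (\<alpha> * b - 1) * (\<alpha> * b) ^ k * (1 / b ^ k)"
    using ab_gt assms by (intro mult_left_mono) auto
  also have "\<dots> = pi / (\<alpha> * b - 1) * \<alpha> ^ k" using b_gt_1 by (simp add: power_mult_distrib)
  finally show ?thesis
    using abs_phi_minus_theta_le[of x k] abs_phi_minus_theta_le[of y k]
    by (simp add: osc_def ring_distribs)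
qed

lemma continuous_phi: "continuous_on UNIV \<phi>"
proof -
  have "\<exists>d>0. \<forall>y. dist y x < d \<longrightarrow> dist (\<phi> y) (\<phi> x) < e" if "0 < e" for x e
  proof -
    obtain k where k: "\<alpha> ^ k < e / osc"
      using real_arch_pow_inv[of "e / osc" \<alpha>] alpha divide_pos_pos[OF \<open>0 < e\<close> osc_pos] by auto
    have "dist (\<phi> y) (\<phi> x) < e" if "dist y x < 1 / b ^ k" for y
    proof -
      have "\<bar>\<phi> y - \<phi> x\<bar> \<le> osc * \<alpha> ^ k" using that by (intro abs_phi_diff_le) (auto simp: dist_real_def)
      also have "\<dots> < e" using k osc_pos by (simp add: field_simps)
      finally show ?thesis by (simp add: dist_real_def)
    qed
    then show ?thesis using b_gt_1 by (intro exI[of _ "1 / b ^ k"]) auto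
  qed
  then show ?thesis by (auto simp: continuous_on_iff)
qed

text \<open>For even \<open>\<beta>\<close> every term but the first is symmetric about a half-integer, while the first one
  is antisymmetric.\<close>

lemma phi_reflect: "\<phi> u - \<phi> (2 * real_of_int m + 1 - u) = 2 * cos (pi * u)"
proof -
  let ?v = "2 * real_of_int m + 1 - u"
  have "cos (b ^ Suc n * pi * ?v) = cos (b ^ Suc n * pi * u)" for n
  proof -
    obtain j where j: "\<beta> = 2 * j" using even_beta by auto
    define N where "N = j * \<beta> ^ n * (2 * m + 1)"
    have "b ^ Suc n * pi * ?v = 2 * pi * real_of_int N - b ^ Suc n * pi * u"
      unfolding b_def N_def by (simp add: j algebra_simps)
    also have "cos \<dots> = cos (b ^ Suc n * pi * u)"
      by (simp only: cos_diff cos_int_2pin sin_int_2pin mult_1 mult_zero_left add_0_right)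
    finally show ?thesis .
  qed
  moreover have "cos (pi * ?v) = - cos (pi * u)"
  proof -
    have "pi * ?v = (2 * real_of_int m * pi + pi) - pi * u" by (simp add: algebra_simps)
    also have "cos \<dots> = - cos (pi * u)"
      using cos_int_2pin[of m] sin_int_2pin[of m] by (simp add: cos_diff cos_add sin_add mult_ac)
    finally show ?thesis .
  qed
  moreover have "\<phi> w = cos (pi * w) + (\<Sum>n. \<alpha> ^ Suc n * cos (b ^ Suc n * pi * w))" for w
    using suminf_split_head[OF summable_phi[of w]] by (simp add: \<phi>_def weierstrass_def)
  ultimately show ?thesis by simp
qed

lemma abs_cos_ge:
  assumes "\<bar>u - (real_of_int m + 1 / 2)\<bar> \<le> 1 / 2"
  shows "2 * \<bar>u - (real_of_int m + 1 / 2)\<bar> \<le> \<bar>cos (pi * u)\<bar>"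
proof -
  define w where "w = u - (real_of_int m + 1 / 2)"
  have "cos (pi * u) = cos (pi * (real_of_int m + 1 / 2) + pi * w)" by (simp add: w_def algebra_simps)
  also have "\<dots> = - sin (pi * (real_of_int m + 1 / 2)) * sin (pi * w)"
    by (simp add: cos_add ring_distribs sin_add cos_add)
  finally have "\<bar>cos (pi * u)\<bar> = \<bar>sin (pi * (real_of_int m + 1 / 2))\<bar> * \<bar>sin (pi * w)\<bar>" by (simp add: abs_mult)
  also have "\<bar>sin (pi * (real_of_int m + 1 / 2))\<bar> = 1"
  proof -
    have "\<bar>cos (pi * real_of_int m)\<bar> = 1" by (cases "even m") (auto simp: cos_npi_int)
    then show ?thesis by (simp add: ring_distribs sin_add)
  qed
  finally have "\<bar>cos (pi * u)\<bar> = \<bar>sin (pi * w)\<bar>" by simp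
  moreover have "2 / pi * \<bar>pi * w\<bar> \<le> \<bar>sin (pi * w)\<bar>"
  proof (rule abs_sin_ge_linear)
    have "pi * \<bar>w\<bar> \<le> pi * (1 / 2)" using assms by (intro mult_left_mono) (auto simp: w_def)
    then show "\<bar>pi * w\<bar> \<le> pi / 2" by (simp add: abs_mult)
  qed
  ultimately show ?thesis by (simp add: w_def abs_mult)
qed

text \<open>In units of 2 (\<alpha> b)^k, the slope 2 of the reflected k-th term minus the slope of
  the partial sum before it. Positivity is exactly the assumption \<alpha> b > 1 + pi / 2.\<close>

definition gap :: real where "gap = 2 - pi / (\<alpha> * b - 1)"

lemma gap_pos: "0 < gap"
  using ab_gt by (simp add: gap_def field_simps)

text \<open>p is the midpoint of the interval from m / b^k to (m + 1) / b^k; scaling by b^k turns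
  the reflection at p into the map u \<mapsto> 2 m + 1 - u of \<open>phi_reflect\<close>.\<close>

lemma phi_reflect_ge:
  fixes m :: int and k :: nat
  defines "p \<equiv> (real_of_int m + 1 / 2) / b ^ k"
  assumes "\<bar>t - p\<bar> \<le> 1 / (2 * b ^ k)"
  shows "2 * gap * \<alpha> ^ k * b ^ k * \<bar>t - p\<bar> \<le> \<bar>\<phi> t - \<phi> (2 * p - t)\<bar>"
proof -
  have bk: "0 < b ^ k" using b_gt_1 by simp
  have u: "b ^ k * t - (real_of_int m + 1 / 2) = b ^ k * (t - p)" using b_nz by (simp add: p_def field_simps)
  have ua: "\<bar>b ^ k * t - (real_of_int m + 1 / 2)\<bar> = b ^ k * \<bar>t - p\<bar>"
    unfolding u using bk by (simp add: abs_mult)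
  have "b ^ k * \<bar>t - p\<bar> \<le> b ^ k * (1 / (2 * b ^ k))" using bk assms by (intro mult_left_mono) auto
  then have "b ^ k * \<bar>t - p\<bar> \<le> 1 / 2" using b_nz by simp
  then have c: "2 * (b ^ k * \<bar>t - p\<bar>) \<le> \<bar>cos (pi * (b ^ k * t))\<bar>"
    using abs_cos_ge[of "b ^ k * t" m] by (simp only: ua)
  have "\<phi> (b ^ k * t) - \<phi> (b ^ k * (2 * p - t)) = 2 * cos (pi * (b ^ k * t))"
    using phi_reflect[of "b ^ k * t" m] b_nz by (simp add: p_def right_diff_distrib)
  then have eq: "\<phi> t - \<phi> (2 * p - t) = (\<theta> k t - \<theta> k (2 * p - t)) + \<alpha> ^ k * (2 * cos (pi * (b ^ k * t)))"
    using phi_split[of t k] phi_split[of "2 * p - t" k] by (simp add: algebra_simps)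
  have "\<bar>\<theta> k t - \<theta> k (2 * p - t)\<bar> \<le> pi / (\<alpha> * b - 1) * (\<alpha> * b) ^ k * \<bar>t - (2 * p - t)\<bar>"
    by (rule abs_theta_diff_le)
  also have "\<bar>t - (2 * p - t)\<bar> = 2 * \<bar>t - p\<bar>" by (simp add: abs_if)
  finally have 1: "\<bar>\<theta> k t - \<theta> k (2 * p - t)\<bar> \<le> \<alpha> ^ k * (pi / (\<alpha> * b - 1) * (2 * (b ^ k * \<bar>t - p\<bar>)))"
    by (simp add: power_mult_distrib mult_ac)
  have 2: "\<alpha> ^ k * (2 * (2 * (b ^ k * \<bar>t - p\<bar>))) \<le> \<bar>\<alpha> ^ k * (2 * cos (pi * (b ^ k * t)))\<bar>"
    using alpha c by (simp add: abs_mult mult_ac)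
  have "2 * gap * \<alpha> ^ k * b ^ k * \<bar>t - p\<bar> =
      \<alpha> ^ k * (2 * (2 * (b ^ k * \<bar>t - p\<bar>))) - \<alpha> ^ k * (pi / (\<alpha> * b - 1) * (2 * (b ^ k * \<bar>t - p\<bar>)))"
    by (simp add: gap_def left_diff_distrib right_diff_distrib mult_ac)
  also have "\<dots> \<le> \<bar>\<phi> t - \<phi> (2 * p - t)\<bar>" unfolding eq using 1 2 by linarith
  finally show ?thesis .
qed

section \<open>Two-sided power law for the determinant\<close>

abbreviation H where "H \<equiv> ham_of_angle \<phi>"

abbreviation D where "D s t \<equiv> det (Omega H s t)"

text \<open>The assumption keeps all angle differences within pi / 2, where the sine is comparable
  to its argument; \<open>det_Omega_ge_reflection\<close> is used with half-length 1 / (2 b^k) and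
  slope 2 gap (\<alpha> b)^k.\<close>

lemma det_ge_dyadic:
  assumes "osc * \<alpha> ^ k \<le> pi / 2"
  shows "gap\<^sup>2 / (6 * pi\<^sup>2) * (\<alpha> ^ k / b ^ k)\<^sup>2 \<le> D (real_of_int m / b ^ k) (real_of_int (m + 1) / b ^ k)"
proof -
  define p where "p = (real_of_int m + 1 / 2) / b ^ k"
  define l where "l = 1 / (2 * b ^ k)"
  have bk: "0 < b ^ k" using b_gt_1 by simp
  have pl: "p - l = real_of_int m / b ^ k" "p + l = real_of_int (m + 1) / b ^ k"
    using b_nz by (auto simp: p_def l_def field_simps)
  have "2 / (3 * pi\<^sup>2) * (2 * gap * \<alpha> ^ k * b ^ k)\<^sup>2 * l ^ 4 \<le> D (p - l) (p + l)"
  proof (rule det_Omega_ge_reflection[OF continuous_phi])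
    show "0 < l" using bk by (simp add: l_def)
    show "\<bar>\<phi> x - \<phi> y\<bar> \<le> pi / 2" if "x \<in> {p - l..p + l}" "y \<in> {p - l..p + l}" for x y
    proof -
      have "\<bar>x - y\<bar> \<le> 2 * l" using that by auto
      then have "\<bar>x - y\<bar> \<le> 1 / b ^ k" by (simp add: l_def)
      then show ?thesis using abs_phi_diff_le[of x y k] assms by linarith
    qed
    show "2 * gap * \<alpha> ^ k * b ^ k * \<bar>x - p\<bar> \<le> \<bar>\<phi> x - \<phi> (2 * p - x)\<bar>" if "x \<in> {p - l..p + l}" for x
      unfolding p_def using that by (intro phi_reflect_ge) (auto simp: p_def l_def abs_le_iff)
    show "0 \<le> 2 * gap * \<alpha> ^ k * b ^ k" using alpha gap_pos bk by simp
  qed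
  moreover have "2 / (3 * pi\<^sup>2) * (2 * gap * \<alpha> ^ k * b ^ k)\<^sup>2 * l ^ 4 = gap\<^sup>2 / (6 * pi\<^sup>2) * (\<alpha> ^ k / b ^ k)\<^sup>2"
    using bk by (simp add: l_def field_simps power2_eq_square power4_eq_xxxx)
  ultimately show ?thesis unfolding pl by linarith
qed

lemma det_ge:
  "\<exists>c0>0. \<forall>s t. s < t \<longrightarrow> t \<le> s + 1 \<longrightarrow> c0 * (t - s) powr (2 * (1 + \<nu>)) \<le> D s t"
proof -
  obtain k0 where k0: "\<alpha> ^ k0 < pi / 2 / osc"
    using real_arch_pow_inv[of "pi / 2 / osc" \<alpha>] alpha osc_pos by auto
  define c where "c = gap\<^sup>2 / (6 * pi\<^sup>2)"
  have c: "0 < c" using gap_pos by (simp add: c_def)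
  define q where "q = 1 / (2 * b ^ (k0 + 1))"
  have q: "0 < q" using b_gt_1 by (simp add: q_def)
  have "c * q powr (2 * (1 + \<nu>)) * (t - s) powr (2 * (1 + \<nu>)) \<le> D s t" if "s < t" "t \<le> s + 1" for s t
  proof -
    define l where "l = t - s"
    have l: "0 < l" "l \<le> 1" using that by (auto simp: l_def)
    have "\<exists>k. 2 / b ^ k \<le> l"
    proof -
      obtain k where "(1 / b) ^ k < l / 2" using real_arch_pow_inv[of "l / 2" "1 / b"] l b_gt_1 by auto
      then show ?thesis by (intro exI[of _ k]) (simp add: power_divide field_simps)
    qed
    \<comment> \<open>The coarsest scale at which [s,t] is sure to contain a full cell of the grid
      of mesh b^(-k): the 2 allows for rounding up the left end.\<close>
    define k1 where "k1 = (LEAST k. 2 / b ^ k \<le> l)"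
    have k1: "2 / b ^ k1 \<le> l" unfolding k1_def using LeastI_ex[OF \<open>\<exists>k. _\<close>] .
    have "k1 \<noteq> 0" using k1 l by (cases k1) auto
    then have "\<not> 2 / b ^ (k1 - 1) \<le> l" unfolding k1_def by (intro not_less_Least) simp
    moreover have "b ^ k1 = b * b ^ (k1 - 1)" using \<open>k1 \<noteq> 0\<close> by (metis power_eq_if)
    ultimately have k1': "l / (2 * b) \<le> 1 / b ^ k1" using b_gt_1 by (simp add: field_simps)
    \<comment> \<open>\<open>k0\<close> further refinements bring the oscillation below pi / 2. The
      constant \<open>q\<close> records the losses: 1 / (2 b) from the minimality of
      \<open>k1\<close> and b^(-k0) from the refinement.\<close>
    define k where "k = k1 + k0"
    define m where "m = \<lceil>b ^ k * s\<rceil>"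
    have bk: "0 < b ^ k" "0 < b ^ k0" "1 \<le> b ^ k0" using b_gt_1 by auto
    have "2 / b ^ k \<le> 2 / b ^ k1" using b_gt_1 by (intro divide_left_mono) (auto simp: k_def)
    then have kl: "2 / b ^ k \<le> l" using k1 by linarith
    have m: "b ^ k * s \<le> real_of_int m" "real_of_int m < b ^ k * s + 1"
      unfolding m_def using ceiling_correct[of "b ^ k * s"] by linarith+
    have "s \<le> real_of_int m / b ^ k" using m bk by (simp add: field_simps)
    moreover have "real_of_int (m + 1) / b ^ k \<le> t"
    proof -
      have "real_of_int (m + 1) / b ^ k \<le> (b ^ k * s + 2) / b ^ k" using m bk by (intro divide_right_mono) auto
      also have "\<dots> = s + 2 / b ^ k" using b_nz by (simp add: field_simps)
      finally show ?thesis using kl by (simp add: l_def)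
    qed
    moreover have "real_of_int m / b ^ k \<le> real_of_int (m + 1) / b ^ k"
      using bk by (intro divide_right_mono) auto
    ultimately have "D (real_of_int m / b ^ k) (real_of_int (m + 1) / b ^ k) \<le> D s t"
      by (intro det_Omega_mono[OF continuous_phi])
    moreover have "osc * \<alpha> ^ k \<le> pi / 2"
    proof -
      have "\<alpha> ^ k \<le> \<alpha> ^ k0" using alpha by (intro power_decreasing) (auto simp: k_def)
      then have "osc * \<alpha> ^ k \<le> osc * \<alpha> ^ k0" using osc_pos by (intro mult_left_mono) auto
      also have "\<dots> \<le> pi / 2" using k0 osc_pos by (simp add: field_simps)
      finally show ?thesis .
    qed
    ultimately have "c * (\<alpha> ^ k / b ^ k)\<^sup>2 \<le> D s t"
      using det_ge_dyadic[of k m] by (simp add: c_def)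
    moreover have "(q * l) powr (2 * (1 + \<nu>)) \<le> (\<alpha> ^ k / b ^ k)\<^sup>2"
    proof -
      have "q * l = l / (2 * b) / b ^ k0" by (simp add: q_def)
      also have "\<dots> \<le> 1 / b ^ k1 / b ^ k0" using k1' bk by (intro divide_right_mono) auto
      also have "\<dots> = 1 / b ^ k" by (simp add: k_def power_add)
      finally have "(q * l) powr (2 * (1 + \<nu>)) \<le> (1 / b ^ k) powr (2 * (1 + \<nu>))"
        using q l nu by (intro powr_mono2) auto
      also have "\<dots> = ((1 / b ^ k) powr (1 + \<nu>)) powr 2" by (simp add: powr_powr mult.commute)
      also have "\<dots> = ((1 / b ^ k) powr (1 + \<nu>))\<^sup>2" using bk by (simp add: powr_numeral)
      also have "(1 / b ^ k) powr (1 + \<nu>) = 1 / b ^ k * \<alpha> ^ k" using bk by (simp add: powr_add alpha_power)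
      finally show ?thesis by simp
    qed
    then have "c * (q * l) powr (2 * (1 + \<nu>)) \<le> c * (\<alpha> ^ k / b ^ k)\<^sup>2" using c by (intro mult_left_mono) auto
    ultimately show ?thesis using q l by (simp add: powr_mult l_def mult.assoc)
  qed
  then show ?thesis using c q by (intro exI[of _ "c * q powr (2 * (1 + \<nu>))"]) auto
qed

lemma det_le:
  "\<exists>C0>0. \<forall>s t. s < t \<longrightarrow> t \<le> s + 1 \<longrightarrow> D s t \<le> C0 * (t - s) powr (2 * (1 + \<nu>))"
proof -
  define C where "C = osc\<^sup>2 * (b powr \<nu>)\<^sup>2"
  have "D s t \<le> C * (t - s) powr (2 * (1 + \<nu>))" if "s < t" "t \<le> s + 1" for s t
  proof -
    define l where "l = t - s"
    have l: "0 < l" "l \<le> 1" using that by (auto simp: l_def)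
    have ex: "\<exists>k. 1 / b ^ k < l"
    proof -
      obtain k where "(1 / b) ^ k < l" using real_arch_pow_inv[of l "1 / b"] l b_gt_1 by auto
      then show ?thesis by (intro exI[of _ k]) (simp add: power_divide)
    qed
    \<comment> \<open>The first scale strictly finer than l, so l lies between b^(-k1) and b^(-(k1 -
      1)) and the oscillation at the coarser of the two is of order l^\<nu>.\<close>
    define k1 where "k1 = (LEAST k. 1 / b ^ k < l)"
    have k1: "1 / b ^ k1 < l" unfolding k1_def using LeastI_ex[OF ex] .
    have "k1 \<noteq> 0" using k1 l by (cases k1) auto
    then obtain k where k: "k1 = Suc k" by (cases k1) auto
    then have "\<not> 1 / b ^ k < l" using not_less_Least[of k "\<lambda>k. 1 / b ^ k < l"] k1_def by simp
    then have lk: "l \<le> 1 / b ^ k" by simp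
    have "1 / b ^ k = b * (1 / b ^ k1)" using b_gt_1 by (simp add: k)
    also have "\<dots> \<le> b * l" using k1 b_gt_1 by (intro mult_left_mono) auto
    finally have "(1 / b ^ k) powr \<nu> \<le> (b * l) powr \<nu>" using nu b_gt_1 by (intro powr_mono2) auto
    then have ak: "\<alpha> ^ k \<le> b powr \<nu> * l powr \<nu>" using b_gt_1 l by (simp add: alpha_power powr_mult)
    have "2 * D s t \<le> (t - s)\<^sup>2 * (osc * \<alpha> ^ k)\<^sup>2"
      using that lk by (intro det_Omega_le[OF continuous_phi] abs_phi_diff_le) (auto simp: l_def)
    also have "\<dots> \<le> l\<^sup>2 * (osc * (b powr \<nu> * l powr \<nu>))\<^sup>2"
      unfolding l_def[symmetric] using osc_pos alpha ak by (intro mult_left_mono power_mono) auto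
    also have "\<dots> = C * (l * l powr \<nu>)\<^sup>2" by (simp add: C_def power_mult_distrib)
    also have "l * l powr \<nu> = l powr (1 + \<nu>)" using l by (simp add: powr_add)
    also have "(l powr (1 + \<nu>))\<^sup>2 = l powr (2 * (1 + \<nu>))"
      using l by (simp add: powr_powr mult.commute flip: powr_numeral)
    finally show ?thesis using det_Omega_nonneg[OF continuous_phi, of s t] by (simp add: l_def)
  qed
  moreover have "0 < C" using osc_pos b_gt_1 by (simp add: C_def)
  ultimately show ?thesis by blast
qed

end

section \<open>Rows of the fundamental solution\<close>

text \<open>The component of the row along \<open>xi (\<phi> t)\<close>. As H has rank one, it alone
  drives the equation, and its squared modulus is the density of the L^2(H) norm.\<close>

definition row_F :: "(real \<Rightarrow> real) \<Rightarrow> (real \<Rightarrow> complex) \<Rightarrow> (real \<Rightarrow> complex) \<Rightarrow> real \<Rightarrow> complex" where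
  "row_F \<phi> f g t = f t * of_real (cos (\<phi> t)) + g t * of_real (sin (\<phi> t))"

text \<open>A row \<open>(f, g)\<close> of the fundamental solution: \<open>\<partial>\<^sub>t (f, g) J = z (f, g) H\<close> solved for the derivatives.\<close>

definition row_sol :: "(real \<Rightarrow> real) \<Rightarrow> complex \<Rightarrow> (real \<Rightarrow> complex) \<Rightarrow> (real \<Rightarrow> complex) \<Rightarrow> bool" where
  "row_sol \<phi> z f g \<longleftrightarrow> (\<forall>t\<in>{0..1}.
     (f has_vector_derivative - (z * row_F \<phi> f g t * of_real (sin (\<phi> t)))) (at t within {0..1}) \<and>
     (g has_vector_derivative z * row_F \<phi> f g t * of_real (cos (\<phi> t))) (at t within {0..1}))"

lemma row_solD:
  assumes "row_sol \<phi> z f g" "t \<in> {0..1}"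
  shows "(f has_vector_derivative - (z * row_F \<phi> f g t * of_real (sin (\<phi> t)))) (at t within {0..1})"
    "(g has_vector_derivative z * row_F \<phi> f g t * of_real (cos (\<phi> t))) (at t within {0..1})"
  using assms by (auto simp: row_sol_def)

lemma row_sol_continuous:
  assumes "row_sol \<phi> z f g"
  shows "continuous_on {0..1} f" "continuous_on {0..1} g"
  using row_solD[OF assms] has_vector_derivative_continuous continuous_on_eq_continuous_within by blast+

lemma row_F_continuous:
  assumes "row_sol \<phi> z f g" "continuous_on UNIV \<phi>"
  shows "continuous_on {0..1} (row_F \<phi> f g)"
  unfolding row_F_def using row_sol_continuous[OF assms(1)] continuous_on_subset[OF assms(2), of "{0..1}"]
  by (auto intro!: continuous_intros)

lemma row_sol_lincomb:
  assumes "row_sol \<phi> z f g" "row_sol \<phi> z f' g'"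
  shows "row_sol \<phi> z (\<lambda>t. c * f t + d * f' t) (\<lambda>t. c * g t + d * g' t)"
  unfolding row_sol_def
proof (intro ballI conjI)
  fix t :: real assume "t \<in> {0..1}"
  note D = row_solD[OF assms(1) this] row_solD[OF assms(2) this]
  show "((\<lambda>t. c * f t + d * f' t) has_vector_derivative
      - (z * row_F \<phi> (\<lambda>t. c * f t + d * f' t) (\<lambda>t. c * g t + d * g' t) t * of_real (sin (\<phi> t)))) (at t within {0..1})"
    by (rule has_vector_derivative_eq_rhs[OF has_vector_derivative_add[OF
          has_vector_derivative_mult_right[OF D(1)] has_vector_derivative_mult_right[OF D(3)]]])
       (simp add: row_F_def algebra_simps)
  show "((\<lambda>t. c * g t + d * g' t) has_vector_derivative
      z * row_F \<phi> (\<lambda>t. c * f t + d * f' t) (\<lambda>t. c * g t + d * g' t) t * of_real (cos (\<phi> t))) (at t within {0..1})"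
    by (rule has_vector_derivative_eq_rhs[OF has_vector_derivative_add[OF
          has_vector_derivative_mult_right[OF D(2)] has_vector_derivative_mult_right[OF D(4)]]])
       (simp add: row_F_def algebra_simps)
qed

lemma row_sol_cnj:
  assumes "row_sol \<phi> z f g"
  shows "row_sol \<phi> (cnj z) (\<lambda>t. cnj (f t)) (\<lambda>t. cnj (g t))"
  unfolding row_sol_def
proof (intro ballI conjI)
  fix t :: real assume "t \<in> {0..1}"
  note D = row_solD[OF assms this]
  show "((\<lambda>t. cnj (f t)) has_vector_derivative
      - (cnj z * row_F \<phi> (\<lambda>t. cnj (f t)) (\<lambda>t. cnj (g t)) t * of_real (sin (\<phi> t)))) (at t within {0..1})"
    by (rule has_vector_derivative_eq_rhs[OF has_vector_derivative_cnj[OF D(1)]]) (simp add: row_F_def)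
  show "((\<lambda>t. cnj (g t)) has_vector_derivative
      cnj z * row_F \<phi> (\<lambda>t. cnj (f t)) (\<lambda>t. cnj (g t)) t * of_real (cos (\<phi> t))) (at t within {0..1})"
    by (rule has_vector_derivative_eq_rhs[OF has_vector_derivative_cnj[OF D(2)]]) (simp add: row_F_def)
qed

lemma row_F_cnj: "row_F \<phi> (\<lambda>t. cnj (f t)) (\<lambda>t. cnj (g t)) t = cnj (row_F \<phi> f g t)"
  by (simp add: row_F_def)

section \<open>Lagrange identity and energy\<close>

text \<open>The Wronskian form of two rows has derivative (z - w) times the product of their driving
  components. Paired with a conjugate row it yields the energy identity, and in the limit z
  \<rightarrow> w the simplicity of the eigenvalues.\<close>

lemma row_sol_lagrange:
  assumes "row_sol \<phi> z f g" "row_sol \<phi> w f' g'" "0 \<le> s" "s \<le> t" "t \<le> 1"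
  shows "((\<lambda>x. (z - w) * (row_F \<phi> f g x * row_F \<phi> f' g' x)) has_integral
    ((g t * f' t - f t * g' t) - (g s * f' s - f s * g' s))) {s..t}"
proof (rule fundamental_theorem_of_calculus[OF assms(4)])
  fix x assume x: "x \<in> {s..t}"
  then have "x \<in> {0..1}" using assms by auto
  note D = row_solD[OF assms(1) this] row_solD[OF assms(2) this]
  have "((\<lambda>x. g x * f' x - f x * g' x) has_vector_derivative
      (z - w) * (row_F \<phi> f g x * row_F \<phi> f' g' x)) (at x within {0..1})"
    by (rule has_vector_derivative_eq_rhs[OF has_vector_derivative_diff[OF
          has_vector_derivative_mult[OF D(2) D(3)] has_vector_derivative_mult[OF D(1) D(4)]]])
       (simp add: row_F_def algebra_simps)
  then show "((\<lambda>x. g x * f' x - f x * g' x) has_vector_derivative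
      (z - w) * (row_F \<phi> f g x * row_F \<phi> f' g' x)) (at x within {s..t})"
    by (rule has_vector_derivative_within_subset) (use assms in auto)
qed

lemma row_F_sq_integrable:
  assumes "row_sol \<phi> z f g" "continuous_on UNIV \<phi>" "0 \<le> s" "t \<le> 1"
  shows "(\<lambda>x. (norm (row_F \<phi> f g x))\<^sup>2) integrable_on {s..t}"
proof -
  have "continuous_on {s..t} (row_F \<phi> f g)"
    using assms by (intro continuous_on_subset[OF row_F_continuous[OF assms(1,2)]]) auto
  then show ?thesis by (intro integrable_continuous_real continuous_intros)
qed

text \<open>\<open>row_sol_lagrange\<close> for a row and its conjugate, which solves the equation
  with parameter \<open>cnj z\<close>; both sides are 2 i times real quantities.\<close>

lemma row_sol_energy:
  assumes "row_sol \<phi> z f g" "continuous_on UNIV \<phi>" "0 \<le> s" "s \<le> t" "t \<le> 1"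
  shows "Im (g t * cnj (f t)) = Im (g s * cnj (f s)) + Im z * integral {s..t} (\<lambda>x. (norm (row_F \<phi> f g x))\<^sup>2)"
proof -
  define I where "I = integral {s..t} (\<lambda>x. (norm (row_F \<phi> f g x))\<^sup>2)"
  have "((\<lambda>x. (norm (row_F \<phi> f g x))\<^sup>2) has_integral I) {s..t}"
    unfolding I_def by (intro integrable_integral row_F_sq_integrable[OF assms(1,2,3,5)])
  then have "((\<lambda>x. 2 * Im z * (norm (row_F \<phi> f g x))\<^sup>2) has_integral 2 * Im z * I) {s..t}"
    by (rule has_integral_mult_right)
  moreover have "((\<lambda>x. (z - cnj z) * (row_F \<phi> f g x * cnj (row_F \<phi> f g x))) has_integral
    ((g t * cnj (f t) - f t * cnj (g t)) - (g s * cnj (f s) - f s * cnj (g s)))) {s..t}"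
    using row_sol_lagrange[OF assms(1) row_sol_cnj[OF assms(1)] assms(3-5)] by (simp only: row_F_cnj)
  then have "((\<lambda>x. Im ((z - cnj z) * (row_F \<phi> f g x * cnj (row_F \<phi> f g x)))) has_integral
    Im ((g t * cnj (f t) - f t * cnj (g t)) - (g s * cnj (f s) - f s * cnj (g s)))) {s..t}"
    by (rule has_integral_linear[OF _ bounded_linear_Im, unfolded o_def])
  then have "((\<lambda>x. 2 * Im z * (norm (row_F \<phi> f g x))\<^sup>2) has_integral
    (2 * Im (g t * cnj (f t)) - 2 * Im (g s * cnj (f s)))) {s..t}"
    by (simp add: complex_mult_cnj cmod_power2 algebra_simps)
  ultimately have "2 * Im z * I = 2 * Im (g t * cnj (f t)) - 2 * Im (g s * cnj (f s))"
    by (rule has_integral_unique)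
  then show ?thesis by (simp add: I_def)
qed

section \<open>Growth bound and uniqueness\<close>

lemma gronwall_exp:
  fixes E E' :: "real \<Rightarrow> real"
  assumes "\<And>t. t \<in> {0..1} \<Longrightarrow> (E has_real_derivative E' t) (at t within {0..1})"
    and "\<And>t. t \<in> {0..1} \<Longrightarrow> E' t \<le> M * E t" and "t \<in> {0..1}"
  shows "E t \<le> E 0 * exp (M * t)"
proof (cases "t = 0")
  case False
  then have t: "0 < t" "t \<le> 1" using assms(3) by auto
  define h where "h = (\<lambda>t. E t * exp (- M * t))"
  have d: "(h has_real_derivative (E' t - M * E t) * exp (- M * t)) (at t within {0..1})" if "t \<in> {0..1}" for t
    unfolding h_def by (auto intro!: derivative_eq_intros assms(1) that simp: algebra_simps)
  have "h t \<le> h 0"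
  proof (rule DERIV_nonpos_imp_decreasing_open[OF less_imp_le[OF t(1)]])
    fix x assume x: "0 < x" "x < t"
    then have "x \<in> {0..1}" "at x within {0..1} = at x"
      using t by (auto simp: at_within_Icc_at)
    then show "\<exists>y. (h has_real_derivative y) (at x) \<and> y \<le> 0"
      using d[of x] assms(2)[of x] by (auto intro!: exI mult_nonpos_nonneg)
  next
    have "continuous_on {0..1} h"
      using d DERIV_continuous continuous_on_eq_continuous_within by blast
    then show "continuous_on {0..t} h" by (rule continuous_on_subset) (use t in auto)
  qed
  then have "E t * exp (- M * t) * exp (M * t) \<le> E 0 * exp (M * t)"
    by (intro mult_right_mono) (auto simp: h_def)
  moreover have "E t * exp (- M * t) * exp (M * t) = E t" by (simp add: mult.assoc flip: exp_add)
  ultimately show ?thesis by linarith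
qed simp

lemma has_real_derivative_norm_sq:
  fixes p :: "real \<Rightarrow> complex"
  assumes "(p has_vector_derivative p') (at t within S)"
  shows "((\<lambda>t. (norm (p t))\<^sup>2) has_real_derivative 2 * Re (cnj (p t) * p')) (at t within S)"
proof -
  have "((\<lambda>t. Re (p t)) has_vector_derivative Re p') (at t within S)"
    "((\<lambda>t. Im (p t)) has_vector_derivative Im p') (at t within S)"
    using bounded_linear.has_vector_derivative[OF bounded_linear_Re assms]
      bounded_linear.has_vector_derivative[OF bounded_linear_Im assms] by auto
  then have "((\<lambda>t. Re (p t)) has_real_derivative Re p') (at t within S)"
    "((\<lambda>t. Im (p t)) has_real_derivative Im p') (at t within S)"
    by (auto simp: has_real_derivative_iff_has_vector_derivative)
  note D = this
  have "((\<lambda>t. (Re (p t))\<^sup>2 + (Im (p t))\<^sup>2) has_real_derivative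
      (2 * Re (p t) * Re p' + 2 * Im (p t) * Im p')) (at t within S)"
    using DERIV_add[OF DERIV_power[OF D(1), of 2] DERIV_power[OF D(2), of 2]] by (simp add: mult_ac)
  then show ?thesis unfolding cmod_power2 by (simp add: algebra_simps)
qed

text \<open>In coordinates rotating with a smooth approximation \<open>\<theta>\<close> of \<open>\<phi>\<close>, the weight \<open>A\<^sup>2\<close> balances the two
  components of the solution.\<close>

lemma row_sol_growth:
  assumes sol: "row_sol \<phi> z f g"
    and \<theta>: "\<And>t. t \<in> {0..1} \<Longrightarrow> (\<theta> has_real_derivative \<theta>' t) (at t within {0..1})"
    and A: "0 < A" "\<And>t. t \<in> {0..1} \<Longrightarrow> \<bar>\<phi> t - \<theta> t\<bar> \<le> A" "\<And>t. t \<in> {0..1} \<Longrightarrow> \<bar>\<theta>' t\<bar> \<le> B"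
    and t: "t \<in> {0..1}"
  shows "(norm (f t))\<^sup>2 + (norm (g t))\<^sup>2 \<le>
    (1 + 1 / A\<^sup>2) * ((1 + A\<^sup>2) * ((norm (f 0))\<^sup>2 + (norm (g 0))\<^sup>2) * exp ((4 * norm z * A + B * (1 / A + A)) * t))"
proof -
  define M where "M = 4 * norm z * A + B * (1 / A + A)"
  \<comment> \<open>\<open>p\<close> and \<open>q\<close> are the coordinates of the row along
    \<open>xi (\<theta> t)\<close> and along the direction orthogonal to it.\<close>
  define p where "p = (\<lambda>t. f t * of_real (cos (\<theta> t)) + g t * of_real (sin (\<theta> t)))"
  define q where "q = (\<lambda>t. g t * of_real (cos (\<theta> t)) - f t * of_real (sin (\<theta> t)))"
  define p' where "p' = (\<lambda>t. of_real (\<theta>' t) * q t - z * row_F \<phi> f g t * of_real (sin (\<phi> t - \<theta> t)))"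
  define q' where "q' = (\<lambda>t. z * row_F \<phi> f g t * of_real (cos (\<phi> t - \<theta> t)) - of_real (\<theta>' t) * p t)"
  have B: "0 \<le> B" using A(3)[of 0] by simp
  have cs: "((\<lambda>t. complex_of_real (cos (\<theta> t))) has_vector_derivative - of_real (\<theta>' t * sin (\<theta> t))) (at t within {0..1})" (is ?C)
    "((\<lambda>t. complex_of_real (sin (\<theta> t))) has_vector_derivative of_real (\<theta>' t * cos (\<theta> t))) (at t within {0..1})" (is ?S)
    if "t \<in> {0..1}" for t
  proof -
    have "((\<lambda>t. cos (\<theta> t)) has_vector_derivative - (\<theta>' t * sin (\<theta> t))) (at t within {0..1})"
      "((\<lambda>t. sin (\<theta> t)) has_vector_derivative \<theta>' t * cos (\<theta> t)) (at t within {0..1})"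
      unfolding has_real_derivative_iff_has_vector_derivative[symmetric]
      using \<theta>[OF that] by (auto intro!: derivative_eq_intros)
    from this[THEN bounded_linear.has_vector_derivative[OF bounded_linear_of_real]]
    show ?C ?S
      by simp_all
  qed
  have dp: "(p has_vector_derivative p' t) (at t within {0..1})" if "t \<in> {0..1}" for t
    unfolding p_def
    by (rule has_vector_derivative_eq_rhs[OF has_vector_derivative_add[OF
          has_vector_derivative_mult[OF row_solD(1)[OF sol that] cs(1)[OF that]]
          has_vector_derivative_mult[OF row_solD(2)[OF sol that] cs(2)[OF that]]]])
       (simp add: p'_def q_def sin_diff algebra_simps)
  have dq: "(q has_vector_derivative q' t) (at t within {0..1})" if "t \<in> {0..1}" for t
    unfolding q_def
    by (rule has_vector_derivative_eq_rhs[OF has_vector_derivative_diff[OF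
          has_vector_derivative_mult[OF row_solD(2)[OF sol that] cs(1)[OF that]]
          has_vector_derivative_mult[OF row_solD(1)[OF sol that] cs(2)[OF that]]]])
       (simp add: q'_def p_def cos_diff algebra_simps)
  have norms: "(norm (p t))\<^sup>2 + (norm (q t))\<^sup>2 = (norm (f t))\<^sup>2 + (norm (g t))\<^sup>2" for t
  proof -
    have "(norm (p t))\<^sup>2 + (norm (q t))\<^sup>2 = ((norm (f t))\<^sup>2 + (norm (g t))\<^sup>2) * ((sin (\<theta> t))\<^sup>2 + (cos (\<theta> t))\<^sup>2)"
      unfolding p_def q_def cmod_power2
      by (simp add: power2_eq_square algebra_simps del: sin_cos_squared_add sin_cos_squared_add2 sin_cos_squared_add3)
    then show ?thesis by simp
  qed
  define E where "E = (\<lambda>t. (norm (p t))\<^sup>2 + A\<^sup>2 * (norm (q t))\<^sup>2)"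
  have "E t \<le> E 0 * exp (M * t)"
  proof (rule gronwall_exp[OF _ _ t])
    fix t :: real assume t: "t \<in> {0..1}"
    show "(E has_real_derivative 2 * Re (cnj (p t) * p' t) + A\<^sup>2 * (2 * Re (cnj (q t) * q' t))) (at t within {0..1})"
      unfolding E_def
      by (intro DERIV_add DERIV_cmult has_real_derivative_norm_sq dp dq t)
    \<comment> \<open>With Y = A |q| every occurrence of |z| acquires a factor A: in p' through sin
      (\<phi> - \<theta>), in q' through the weight, as A^2 |q| = A Y. The rotation contributes the
      terms B / A and B A.\<close>
    define X where "X = norm (p t)"
    define Y where "Y = A * norm (q t)"
    define e where "e = \<phi> t - \<theta> t"
    define N where "N = norm (row_F \<phi> f g t)"
    have XY: "0 \<le> X" "0 \<le> Y" using A by (auto simp: X_def Y_def)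
    have e: "\<bar>sin e\<bar> \<le> A" using abs_sin_x_le_abs_x[of e] A(2)[OF t] by (simp add: e_def)
    have "row_F \<phi> f g t = p t * of_real (cos e) + q t * of_real (sin e)"
    proof -
      have "cos (\<phi> t) = cos (\<theta> t) * cos e - sin (\<theta> t) * sin e"
        "sin (\<phi> t) = sin (\<theta> t) * cos e + cos (\<theta> t) * sin e"
        using cos_add[of "\<theta> t" e] sin_add[of "\<theta> t" e] by (auto simp: e_def)
      then show ?thesis unfolding row_F_def p_def q_def by (simp only: of_real_add of_real_diff of_real_mult) (simp add: algebra_simps)
    qed
    then have "N \<le> X * \<bar>cos e\<bar> + norm (q t) * \<bar>sin e\<bar>"
      using norm_triangle_ineq[of "p t * of_real (cos e)" "q t * of_real (sin e)"]
      by (simp add: norm_mult X_def N_def)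
    also have "\<dots> \<le> X * 1 + norm (q t) * A"
      using e XY by (intro add_mono mult_left_mono) auto
    finally have F: "N \<le> X + Y" by (simp add: Y_def mult.commute)
    have N0: "0 \<le> N" by (simp add: N_def)
    have "norm (p' t) \<le> \<bar>\<theta>' t\<bar> * norm (q t) + norm z * N * \<bar>sin e\<bar>"
      unfolding p'_def e_def[symmetric] N_def
      by (rule order_trans[OF norm_triangle_ineq4]) (simp add: norm_mult)
    also have "\<dots> \<le> B * norm (q t) + norm z * (X + Y) * A"
      using e F N0 XY A(3)[OF t] by (intro add_mono mult_mono mult_nonneg_nonneg) auto
    also have "norm (q t) = Y / A" using A by (simp add: Y_def)
    finally have "X * norm (p' t) \<le> X * (B * (Y / A) + norm z * (X + Y) * A)"
      using XY(1) by (rule mult_left_mono)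
    then have pp: "2 * Re (cnj (p t) * p' t) \<le> 2 * (X * (B * (Y / A) + norm z * (X + Y) * A))"
      using complex_Re_le_cmod[of "cnj (p t) * p' t"] unfolding norm_mult complex_mod_cnj X_def by linarith
    have "norm (q' t) \<le> norm z * N * \<bar>cos e\<bar> + \<bar>\<theta>' t\<bar> * norm (p t)"
      unfolding q'_def e_def[symmetric] N_def
      by (rule order_trans[OF norm_triangle_ineq4]) (simp add: norm_mult)
    also have "\<dots> \<le> norm z * (X + Y) * 1 + B * X"
      using F N0 XY A(3)[OF t] by (intro add_mono mult_mono mult_nonneg_nonneg) (auto simp: X_def)
    finally have "norm (q t) * norm (q' t) \<le> norm (q t) * (norm z * (X + Y) * 1 + B * X)"
      by (rule mult_left_mono) simp
    then have "2 * Re (cnj (q t) * q' t) \<le> 2 * (norm (q t) * (norm z * (X + Y) * 1 + B * X))"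
      using complex_Re_le_cmod[of "cnj (q t) * q' t"] unfolding norm_mult complex_mod_cnj by linarith
    then have "A\<^sup>2 * (2 * Re (cnj (q t) * q' t)) \<le> A\<^sup>2 * (2 * (norm (q t) * (norm z * (X + Y) * 1 + B * X)))"
      by (rule mult_left_mono) simp
    also have "\<dots> = A * (2 * (Y * (norm z * (X + Y) + B * X)))"
      by (simp add: Y_def power2_eq_square mult_ac)
    finally have "A\<^sup>2 * (2 * Re (cnj (q t) * q' t)) \<le> A * (2 * (Y * (norm z * (X + Y) + B * X)))" .
    with pp have "2 * Re (cnj (p t) * p' t) + A\<^sup>2 * (2 * Re (cnj (q t) * q' t))
        \<le> 2 * (X * (B * (Y / A) + norm z * (X + Y) * A)) + A * (2 * (Y * (norm z * (X + Y) + B * X)))"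
      by linarith
    also have "\<dots> = 2 * norm z * A * (X + Y)\<^sup>2 + B * (1 / A + A) * (2 * (X * Y))"
      using A(1) by (simp add: field_simps power2_eq_square)
    also have "\<dots> \<le> 2 * norm z * A * (2 * (X\<^sup>2 + Y\<^sup>2)) + B * (1 / A + A) * (X\<^sup>2 + Y\<^sup>2)"
      using A(1) B zero_le_power2[of "X - Y"]
      by (intro add_mono mult_left_mono) (auto simp: power2_eq_square algebra_simps)
    also have "\<dots> = M * E t" by (simp add: M_def E_def X_def Y_def power_mult_distrib algebra_simps)
    finally show "2 * Re (cnj (p t) * p' t) + A\<^sup>2 * (2 * Re (cnj (q t) * q' t)) \<le> M * E t" .
  qed
  also have "E 0 \<le> (1 + A\<^sup>2) * ((norm (f 0))\<^sup>2 + (norm (g 0))\<^sup>2)"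
    unfolding norms[symmetric] E_def by (simp add: algebra_simps)
  finally have "E t \<le> (1 + A\<^sup>2) * ((norm (f 0))\<^sup>2 + (norm (g 0))\<^sup>2) * exp (M * t)" by simp
  then have "(1 + 1 / A\<^sup>2) * E t \<le> (1 + 1 / A\<^sup>2) * ((1 + A\<^sup>2) * ((norm (f 0))\<^sup>2 + (norm (g 0))\<^sup>2) * exp (M * t))"
    by (intro mult_left_mono) auto
  moreover have "(norm (f t))\<^sup>2 + (norm (g t))\<^sup>2 \<le> (1 + 1 / A\<^sup>2) * E t"
    unfolding norms[symmetric] E_def using A(1) by (simp add: field_simps)
  ultimately show ?thesis unfolding M_def by linarith
qed

text \<open>The growth bound for the difference of the two rows, with comparison angle constantly 0
  and a bound of \<phi> on [0,1] as A: zero initial data stay zero.\<close>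

lemma row_sol_unique:
  assumes "row_sol \<phi> z f g" "row_sol \<phi> z f' g'" "continuous_on UNIV \<phi>" "f 0 = f' 0" "g 0 = g' 0" "t \<in> {0..1}"
  shows "f t = f' t" "g t = g' t"
proof -
  have "compact (\<phi> ` {0..1})"
    using assms(3) by (intro compact_continuous_image) (auto intro: continuous_on_subset)
  then obtain A where A: "0 < A" "\<And>t. t \<in> {0..1} \<Longrightarrow> \<bar>\<phi> t\<bar> \<le> A"
    using compact_imp_bounded[of "\<phi> ` {0..1}"] unfolding bounded_pos by auto
  have sol: "row_sol \<phi> z (\<lambda>t. 1 * f t + (- 1) * f' t) (\<lambda>t. 1 * g t + (- 1) * g' t)"
    by (intro row_sol_lincomb assms)
  have "(norm (f t - f' t))\<^sup>2 + (norm (g t - g' t))\<^sup>2 \<le> 0"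
    using row_sol_growth[OF sol, of "\<lambda>_. 0" "\<lambda>_. 0" A 0 t] A assms by simp
  then have "(norm (f t - f' t))\<^sup>2 + (norm (g t - g' t))\<^sup>2 = 0"
    by (intro antisym) auto
  then show "f t = f' t" "g t = g' t"
    using zero_le_power2[of "norm (f t - f' t)"] zero_le_power2[of "norm (g t - g' t)"]
    by (auto simp: add_nonneg_eq_0_iff)
qed

section \<open>Comparison with a frozen row\<close>

lemma integral_Cauchy_Schwarz:
  fixes u v :: "real \<Rightarrow> real"
  assumes "continuous_on {s..t} u" "continuous_on {s..t} v"
  shows "(integral {s..t} (\<lambda>x. u x * v x))\<^sup>2 \<le> integral {s..t} (\<lambda>x. (u x)\<^sup>2) * integral {s..t} (\<lambda>x. (v x)\<^sup>2)"
proof -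
  define P where "P = integral {s..t} (\<lambda>x. (u x)\<^sup>2)"
  define Q where "Q = integral {s..t} (\<lambda>x. (v x)\<^sup>2)"
  define R where "R = integral {s..t} (\<lambda>x. u x * v x)"
  have i: "(\<lambda>x. (u x)\<^sup>2) integrable_on {s..t}" "(\<lambda>x. (v x)\<^sup>2) integrable_on {s..t}"
    "(\<lambda>x. u x * v x) integrable_on {s..t}"
    using assms by (auto intro!: integrable_continuous_real continuous_intros)
  have pos: "0 \<le> P - 2 * c * R + c\<^sup>2 * Q" for c
  proof -
    have "((\<lambda>x. (u x)\<^sup>2 - 2 * c * (u x * v x) + c\<^sup>2 * (v x)\<^sup>2) has_integral P - 2 * c * R + c\<^sup>2 * Q) {s..t}"
      unfolding P_def Q_def R_def
      by (intro has_integral_add has_integral_diff has_integral_mult_right integrable_integral i)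
    moreover have "(u x)\<^sup>2 - 2 * c * (u x * v x) + c\<^sup>2 * (v x)\<^sup>2 = (u x - c * v x)\<^sup>2" for x
      by (simp add: power2_eq_square algebra_simps)
    ultimately have "((\<lambda>x. (u x - c * v x)\<^sup>2) has_integral P - 2 * c * R + c\<^sup>2 * Q) {s..t}" by (simp only:)
    then show ?thesis by (rule has_integral_nonneg) simp
  qed
  have Q0: "0 \<le> Q" unfolding Q_def by (intro integral_nonneg i) auto
  have "R\<^sup>2 \<le> P * Q"
  proof (cases "Q = 0")
    case True
    have "R = 0"
    proof (rule ccontr)
      assume "R \<noteq> 0"
      \<comment> \<open>With Q = 0 the quadratic is affine in c, and this c gives it the value
        -1.\<close>
      then show False using pos[of "(P + 1) / (2 * R)"] True by (simp add: field_simps)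
    qed
    then show ?thesis using True by simp
  next
    case False
    then show ?thesis using pos[of "R / Q"] Q0 by (simp add: field_simps power2_eq_square)
  qed
  then show ?thesis by (simp add: P_def Q_def R_def)
qed

lemma norm_diff_le_integral:
  fixes h h' :: "real \<Rightarrow> complex"
  assumes "\<And>x. x \<in> {s..t} \<Longrightarrow> (h has_vector_derivative h' x) (at x within {s..t})"
    and "continuous_on {s..t} h'" "v \<in> {s..t}" "w \<in> {s..t}"
  shows "norm (h v - h w) \<le> integral {s..t} (\<lambda>x. norm (h' x))"
proof -
  have *: "norm (h v - h w) \<le> integral {s..t} (\<lambda>x. norm (h' x))" if "v \<in> {s..t}" "w \<in> {s..t}" "w \<le> v" for v w
  proof -
    have c: "continuous_on {w..v} h'" using assms(2) that by (auto intro: continuous_on_subset)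
    have "(h' has_integral (h v - h w)) {w..v}"
      using that by (intro fundamental_theorem_of_calculus has_vector_derivative_within_subset[OF assms(1)]) auto
    then have "h v - h w = integral {w..v} h'" by (simp add: integral_unique)
    also have "norm \<dots> \<le> integral {w..v} (\<lambda>x. norm (h' x))"
      using c by (intro integral_norm_bound_integral integrable_continuous_real continuous_intros) auto
    also have "\<dots> \<le> integral {s..t} (\<lambda>x. norm (h' x))"
      using c assms(2) that by (intro integral_subset_le integrable_continuous_real continuous_intros) auto
    finally show ?thesis .
  qed
  show ?thesis
  proof (cases "w \<le> v")
    case True
    then show ?thesis using * assms by blast
  next
    case False
    then show ?thesis using *[of w v] assms by (simp add: norm_minus_commute)
  qed
qed

text \<open>The Hermitian form of a real symmetric matrix at the row (a, b); for
  \<open>Omega\<close> it is the energy integral of a row that stays constant on the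
  interval.\<close>

definition quad :: "real^2^2 \<Rightarrow> complex \<Rightarrow> complex \<Rightarrow> real" where
  "quad A a b = (norm a)\<^sup>2 * A $ 1 $ 1 + 2 * Re (a * cnj b) * A $ 1 $ 2 + (norm b)\<^sup>2 * A $ 2 $ 2"

lemma integral_norm_sq_eq_quad:
  assumes "continuous_on UNIV \<phi>"
  shows "integral {s..t} (\<lambda>x. (norm (a * of_real (cos (\<phi> x)) + b * of_real (sin (\<phi> x))))\<^sup>2) =
    quad (Omega (ham_of_angle \<phi>) s t) a b"
proof -
  have c: "continuous_on {s..t} \<phi>" using assms continuous_on_subset by blast
  have eq: "(norm (a * of_real (cos y) + b * of_real (sin y)))\<^sup>2 =
      (norm a)\<^sup>2 * (cos y)\<^sup>2 + 2 * Re (a * cnj b) * (cos y * sin y) + (norm b)\<^sup>2 * (sin y)\<^sup>2" for y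
    unfolding cmod_power2 by (simp add: power2_eq_square algebra_simps)
  have i: "(\<lambda>x. (norm a)\<^sup>2 * (cos (\<phi> x))\<^sup>2) integrable_on {s..t}"
    "(\<lambda>x. 2 * Re (a * cnj b) * (cos (\<phi> x) * sin (\<phi> x))) integrable_on {s..t}"
    "(\<lambda>x. (norm b)\<^sup>2 * (sin (\<phi> x))\<^sup>2) integrable_on {s..t}"
    using c by (auto intro!: integrable_continuous_real continuous_intros)
  show ?thesis unfolding eq quad_def Omega_nth[OF assms] ham_of_angle_nth
    using i by (simp add: integral_add integrable_add)
qed

text \<open>Freezing the solution at a point \<open>\<tau>\<close> costs only a constant factor as long as
  \<open>|z|\<^sup>2 det \<Omega>(s,t)\<close> stays bounded.\<close>

lemma row_sol_frozen:
  assumes sol: "row_sol \<phi> z f g" and \<phi>: "continuous_on UNIV \<phi>"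
    and st: "0 \<le> s" "s \<le> t" "t \<le> 1" "\<tau> \<in> {s..t}"
  shows "quad (Omega (ham_of_angle \<phi>) s t) (f \<tau>) (g \<tau>) \<le>
    2 * (1 + 2 * (norm z)\<^sup>2 * detO \<phi> s t) * integral {s..t} (\<lambda>x. (norm (row_F \<phi> f g x))\<^sup>2)"
proof -
  define I where "I = integral {s..t} (\<lambda>x. (norm (row_F \<phi> f g x))\<^sup>2)"
  define S where "S = (\<lambda>w. integral {s..t} (\<lambda>x. (sin (\<phi> x - \<phi> w))\<^sup>2))"
  define G where "G = (\<lambda>w. f \<tau> * of_real (cos (\<phi> w)) + g \<tau> * of_real (sin (\<phi> w)))"
  have sub: "{s..t} \<subseteq> {0..1}" using st by auto
  have c\<phi>: "continuous_on {s..t} \<phi>" using \<phi> continuous_on_subset by blast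
  have cF: "continuous_on {s..t} (row_F \<phi> f g)"
    using row_F_continuous[OF sol \<phi>] sub continuous_on_subset by blast
  have I0: "0 \<le> I" unfolding I_def using row_F_sq_integrable[OF sol \<phi> st(1,3)] by (intro integral_nonneg) auto
  have pw: "(norm (G w))\<^sup>2 \<le> 2 * (norm (row_F \<phi> f g w))\<^sup>2 + 2 * (norm z)\<^sup>2 * I * S w" if w: "w \<in> {s..t}" for w
  proof -
    \<comment> \<open>The component along the fixed direction \<open>xi (\<phi> w)\<close>: at x = w
      it is \<open>row_F\<close>, and its derivative carries the factor sin (\<phi> x - \<phi> w),
      whose square, integrated over x and w, gives twice the determinant.\<close>
    define h where "h = (\<lambda>x. f x * of_real (cos (\<phi> w)) + g x * of_real (sin (\<phi> w)))"
    define h' where "h' = (\<lambda>x. - (z * row_F \<phi> f g x * of_real (sin (\<phi> x - \<phi> w))))"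
    have "(h has_vector_derivative h' x) (at x within {s..t})" if "x \<in> {s..t}" for x
    proof -
      have x: "x \<in> {0..1}" using that sub by auto
      have "(h has_vector_derivative h' x) (at x within {0..1})"
        unfolding h_def
        by (rule has_vector_derivative_eq_rhs[OF has_vector_derivative_add[OF
              has_vector_derivative_mult_left[OF row_solD(1)[OF sol x]]
              has_vector_derivative_mult_left[OF row_solD(2)[OF sol x]]]])
           (simp add: h'_def sin_diff algebra_simps)
      then show ?thesis using sub by (rule has_vector_derivative_within_subset)
    qed
    moreover have "continuous_on {s..t} h'"
      unfolding h'_def using cF c\<phi> by (auto intro!: continuous_intros)
    ultimately have "norm (h \<tau> - h w) \<le> integral {s..t} (\<lambda>x. norm (h' x))"
      using st(4) w by (rule norm_diff_le_integral)
    also have "\<dots> = norm z * integral {s..t} (\<lambda>x. norm (row_F \<phi> f g x) * \<bar>sin (\<phi> x - \<phi> w)\<bar>)"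
      by (simp add: h'_def norm_mult mult.assoc)
    finally have "(norm (h \<tau> - h w))\<^sup>2 \<le>
        (norm z * integral {s..t} (\<lambda>x. norm (row_F \<phi> f g x) * \<bar>sin (\<phi> x - \<phi> w)\<bar>))\<^sup>2"
      by (rule power_mono) simp
    also have "\<dots> = (norm z)\<^sup>2 * (integral {s..t} (\<lambda>x. norm (row_F \<phi> f g x) * \<bar>sin (\<phi> x - \<phi> w)\<bar>))\<^sup>2"
      by (rule power_mult_distrib)
    also have "\<dots> \<le> (norm z)\<^sup>2 * (I * S w)"
    proof (rule mult_left_mono)
      have "continuous_on {s..t} (\<lambda>x. norm (row_F \<phi> f g x))" "continuous_on {s..t} (\<lambda>x. \<bar>sin (\<phi> x - \<phi> w)\<bar>)"
        using cF c\<phi> by (auto intro!: continuous_intros)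
      from integral_Cauchy_Schwarz[OF this]
      show "(integral {s..t} (\<lambda>x. norm (row_F \<phi> f g x) * \<bar>sin (\<phi> x - \<phi> w)\<bar>))\<^sup>2 \<le> I * S w"
        by (simp add: I_def S_def)
    qed simp
    finally have 1: "(norm (h \<tau> - h w))\<^sup>2 \<le> (norm z)\<^sup>2 * (I * S w)" .
    have "norm (h \<tau>) \<le> norm (h w) + norm (h \<tau> - h w)" by (metis norm_triangle_sub add.commute)
    then have "(norm (h \<tau>))\<^sup>2 \<le> (norm (h w) + norm (h \<tau> - h w))\<^sup>2" by (intro power_mono) auto
    also have "\<dots> \<le> 2 * (norm (h w))\<^sup>2 + 2 * (norm (h \<tau> - h w))\<^sup>2"
      using zero_le_power2[of "norm (h w) - norm (h \<tau> - h w)"] by (simp add: power2_eq_square algebra_simps)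
    finally have "(norm (h \<tau>))\<^sup>2 \<le> 2 * (norm (h w))\<^sup>2 + 2 * ((norm z)\<^sup>2 * (I * S w))" using 1 by linarith
    then show ?thesis by (simp add: h_def G_def row_F_def mult.assoc)
  qed
  have i1: "(\<lambda>w. 2 * (norm (row_F \<phi> f g w))\<^sup>2) integrable_on {s..t}"
    using cF by (intro integrable_continuous_real continuous_intros)
  have i2: "(\<lambda>w. 2 * (norm z)\<^sup>2 * I * S w) integrable_on {s..t}"
    unfolding S_def by (intro integrable_continuous_real continuous_intros continuous_on_integral_sin \<phi>)
  have "quad (Omega (ham_of_angle \<phi>) s t) (f \<tau>) (g \<tau>) = integral {s..t} (\<lambda>w. (norm (G w))\<^sup>2)"
    unfolding G_def integral_norm_sq_eq_quad[OF \<phi>] ..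
  also have "\<dots> \<le> integral {s..t} (\<lambda>w. 2 * (norm (row_F \<phi> f g w))\<^sup>2 + 2 * (norm z)\<^sup>2 * I * S w)"
    using pw i1 i2 c\<phi> unfolding G_def
    by (intro integral_le integrable_add) (auto intro!: integrable_continuous_real continuous_intros)
  also have "\<dots> = 2 * I + 2 * (norm z)\<^sup>2 * I * integral {s..t} S"
    using i1 i2 by (simp add: integral_add I_def)
  also have "integral {s..t} S = 2 * detO \<phi> s t"
    unfolding S_def det_Omega_eq[OF \<phi>] ..
  finally show ?thesis by (simp add: I_def algebra_simps)
qed

section \<open>Power series in the spectral parameter\<close>

lemma series_has_vector_derivative:
  fixes c d :: "nat \<Rightarrow> real \<Rightarrow> complex"
  assumes "\<And>n t. t \<in> {0..1} \<Longrightarrow> (c n has_vector_derivative d n t) (at t within {0..1})"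
    and "\<And>n t. t \<in> {0..1} \<Longrightarrow> norm (d n t) \<le> M n" "summable M"
    and "\<And>t. t \<in> {0..1} \<Longrightarrow> summable (\<lambda>n. c n t)" "t \<in> {0..1}"
  shows "((\<lambda>t. \<Sum>n. c n t) has_vector_derivative (\<Sum>n. d n t)) (at t within {0..1})"
proof -
  have ul: "uniform_limit {0..1} (\<lambda>n t. \<Sum>i<n. d i t) (\<lambda>t. \<Sum>i. d i t) sequentially"
    using assms(2,3) by (rule Weierstrass_m_test)
  have "\<exists>g. \<forall>x\<in>{0..1}. (\<lambda>n. c n x) sums g x \<and> (g has_derivative (\<lambda>h. h *\<^sub>R (\<Sum>i. d i x))) (at x within {0..1})"
  proof (rule has_derivative_series)
    show "(c n has_derivative (\<lambda>h. h *\<^sub>R d n x)) (at x within {0..1})" if "x \<in> {0..1}" for n x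
      using assms(1)[OF that] by (simp add: has_vector_derivative_def)
    show "\<forall>\<^sub>F n in sequentially. \<forall>x\<in>{0..1}. \<forall>h. norm ((\<Sum>i<n. h *\<^sub>R d i x) - h *\<^sub>R (\<Sum>i. d i x)) \<le> e * norm h"
      if "0 < e" for e
    proof -
      have "\<forall>\<^sub>F n in sequentially. \<forall>x\<in>{0..1}. dist (\<Sum>i<n. d i x) (\<Sum>i. d i x) < e"
        using ul that by (simp add: uniform_limit_iff)
      then show ?thesis
      proof (rule eventually_mono, intro ballI allI)
        fix n and x h :: real
        assume "\<forall>x\<in>{0..1}. dist (\<Sum>i<n. d i x) (\<Sum>i. d i x) < e" "x \<in> {0..1}"
        then have "\<bar>h\<bar> * norm ((\<Sum>i<n. d i x) - (\<Sum>i. d i x)) \<le> \<bar>h\<bar> * e"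
          by (intro mult_left_mono) (auto simp: dist_norm less_imp_le)
        then show "norm ((\<Sum>i<n. h *\<^sub>R d i x) - h *\<^sub>R (\<Sum>i. d i x)) \<le> e * norm h"
          by (simp add: mult.commute flip: scaleR_sum_right scaleR_diff_right)
      qed
    qed
    show "(\<lambda>n. c n 0) sums (\<Sum>n. c n 0)" using assms(4)[of 0] by (simp add: summable_sums)
  qed auto
  then obtain g where g: "\<And>x. x \<in> {0..1} \<Longrightarrow> (\<lambda>n. c n x) sums g x"
    "\<And>x. x \<in> {0..1} \<Longrightarrow> (g has_derivative (\<lambda>h. h *\<^sub>R (\<Sum>i. d i x))) (at x within {0..1})"
    by blast
  have "(g has_vector_derivative (\<Sum>n. d n t)) (at t within {0..1})"
    using g(2)[OF assms(5)] by (simp add: has_vector_derivative_def)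
  moreover have "(\<Sum>n. c n x) = g x" if "x \<in> {0..1}" for x
    using sums_unique[OF g(1)[OF that]] by simp
  ultimately show ?thesis by (rule has_vector_derivative_transform[OF assms(5), rotated])
qed

text \<open>Picard iteration from the initial row (p, q), read as the coefficients of a power series
  in z. One real sequence gives existence for every z together with analyticity in z.\<close>

primrec row_coeff :: "(real \<Rightarrow> real) \<Rightarrow> real \<Rightarrow> real \<Rightarrow> nat \<Rightarrow> real \<Rightarrow> real \<times> real" where
  "row_coeff \<phi> p q 0 = (\<lambda>t. (p, q))"
| "row_coeff \<phi> p q (Suc n) = (\<lambda>t.
    (- integral {0..t} (\<lambda>x. (fst (row_coeff \<phi> p q n x) * cos (\<phi> x) + snd (row_coeff \<phi> p q n x) * sin (\<phi> x)) * sin (\<phi> x)),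
     integral {0..t} (\<lambda>x. (fst (row_coeff \<phi> p q n x) * cos (\<phi> x) + snd (row_coeff \<phi> p q n x) * sin (\<phi> x)) * cos (\<phi> x))))"

definition row_K :: "(real \<Rightarrow> real) \<Rightarrow> real \<Rightarrow> real \<Rightarrow> nat \<Rightarrow> real \<Rightarrow> real" where
  "row_K \<phi> p q n x = fst (row_coeff \<phi> p q n x) * cos (\<phi> x) + snd (row_coeff \<phi> p q n x) * sin (\<phi> x)"

definition row1 :: "(real \<Rightarrow> real) \<Rightarrow> real \<Rightarrow> real \<Rightarrow> complex \<Rightarrow> real \<Rightarrow> complex" where
  "row1 \<phi> p q z t = (\<Sum>n. z ^ n * of_real (fst (row_coeff \<phi> p q n t)))"

definition row2 :: "(real \<Rightarrow> real) \<Rightarrow> real \<Rightarrow> real \<Rightarrow> complex \<Rightarrow> real \<Rightarrow> complex" where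
  "row2 \<phi> p q z t = (\<Sum>n. z ^ n * of_real (snd (row_coeff \<phi> p q n t)))"

lemma row_coeff_Suc:
  "fst (row_coeff \<phi> p q (Suc n) t) = - integral {0..t} (\<lambda>x. row_K \<phi> p q n x * sin (\<phi> x))"
  "snd (row_coeff \<phi> p q (Suc n) t) = integral {0..t} (\<lambda>x. row_K \<phi> p q n x * cos (\<phi> x))"
  by (simp_all add: row_K_def)

declare row_coeff.simps(2) [simp del]

context
  fixes \<phi> :: "real \<Rightarrow> real" and p q :: real
  assumes \<phi>: "continuous_on UNIV \<phi>"
begin

abbreviation "ca n t \<equiv> fst (row_coeff \<phi> p q n t)"
abbreviation "cb n t \<equiv> snd (row_coeff \<phi> p q n t)"
abbreviation "cK \<equiv> row_K \<phi> p q"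
abbreviation "rF z \<equiv> row_F \<phi> (row1 \<phi> p q z) (row2 \<phi> p q z)"

lemma phi_cont: "continuous_on S \<phi>"
  using \<phi> continuous_on_subset by blast

lemma row_coeff_continuous:
  "continuous_on {0..1} (\<lambda>t. ca n t)" "continuous_on {0..1} (\<lambda>t. cb n t)"
proof (induction n)
  case (Suc n)
  have K: "continuous_on {0..1} (cK n)"
    unfolding row_K_def using Suc phi_cont by (auto intro!: continuous_intros)
  have "(\<lambda>x. cK n x * sin (\<phi> x)) integrable_on {0..1}"
    "(\<lambda>x. cK n x * cos (\<phi> x)) integrable_on {0..1}"
    using K phi_cont by (auto intro!: integrable_continuous_real continuous_intros)
  then show "continuous_on {0..1} (\<lambda>t. ca (Suc n) t)"
    "continuous_on {0..1} (\<lambda>t. cb (Suc n) t)"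
    unfolding row_coeff_Suc by (auto intro!: continuous_on_minus indefinite_integral_continuous_1)
qed auto

lemma row_K_continuous: "continuous_on {0..1} (cK n)"
  unfolding row_K_def
  by (intro continuous_on_add continuous_on_mult row_coeff_continuous continuous_on_cos continuous_on_sin phi_cont)

lemma row_coeff_deriv:
  assumes "t \<in> {0..1}"
  shows "((\<lambda>t. ca (Suc n) t) has_real_derivative - (cK n t * sin (\<phi> t))) (at t within {0..1})"
    "((\<lambda>t. cb (Suc n) t) has_real_derivative cK n t * cos (\<phi> t)) (at t within {0..1})"
  unfolding row_coeff_Suc using assms row_K_continuous phi_cont
  by (auto intro!: DERIV_minus integral_has_real_derivative continuous_intros)

lemma abs_row_K_le: "\<bar>cK n t\<bar> \<le> \<bar>ca n t\<bar> + \<bar>cb n t\<bar>"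
proof -
  have "\<bar>cK n t\<bar> \<le> \<bar>ca n t\<bar> * \<bar>cos (\<phi> t)\<bar> + \<bar>cb n t\<bar> * \<bar>sin (\<phi> t)\<bar>"
    unfolding row_K_def using abs_triangle_ineq by (simp flip: abs_mult)
  also have "\<dots> \<le> \<bar>ca n t\<bar> * 1 + \<bar>cb n t\<bar> * 1"
    by (intro add_mono mult_left_mono) auto
  finally show ?thesis by simp
qed

text \<open>Each iteration integrates a power of t; the factor 2 enters because both components are
  bounded by the same integral.\<close>

lemma row_coeff_bound:
  "t \<in> {0..1} \<Longrightarrow> \<bar>ca n t\<bar> + \<bar>cb n t\<bar> \<le> (\<bar>p\<bar> + \<bar>q\<bar>) * (2 * t) ^ n / fact n"
proof (induction n arbitrary: t)
  case (Suc n)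
  define C where "C = \<bar>p\<bar> + \<bar>q\<bar>"
  define u where "u = (\<lambda>x. C * (2 * x) ^ n / fact n)"
  define U where "U = (\<lambda>x. C * 2 ^ n * x ^ Suc n / fact (Suc n))"
  have "(u has_integral (U t - U 0)) {0..t}"
  proof (rule fundamental_theorem_of_calculus)
    fix x
    have "(U has_real_derivative u x) (at x within {0..t})"
      unfolding U_def u_def
      by (rule derivative_eq_intros refl | simp add: power_mult_distrib field_simps del: power_Suc of_nat_Suc)+
    then show "(U has_vector_derivative u x) (at x within {0..t})"
      by (simp add: has_real_derivative_iff_has_vector_derivative)
  qed (use Suc in auto)
  then have u: "u integrable_on {0..t}" "integral {0..t} u = U t"
    by (auto simp: integral_unique has_integral_integrable U_def)
  have bnd: "\<bar>integral {0..t} (\<lambda>x. cK n x * v x)\<bar> \<le> U t"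
    if "continuous_on {0..1} v" "\<And>x. \<bar>v x\<bar> \<le> 1" for v :: "real \<Rightarrow> real"
  proof -
    have "norm (integral {0..t} (\<lambda>x. cK n x * v x)) \<le> integral {0..t} u"
    proof (rule integral_norm_bound_integral)
      show "(\<lambda>x. cK n x * v x) integrable_on {0..t}"
        using Suc.prems by (intro integrable_continuous_real continuous_on_mult
            continuous_on_subset[OF row_K_continuous] continuous_on_subset[OF that(1)]) auto
      fix x assume x: "x \<in> {0..t}"
      then have "\<bar>cK n x\<bar> * \<bar>v x\<bar> \<le> u x * 1"
        using Suc.IH[of x] abs_row_K_le[of n x] Suc.prems that(2)[of x]
        by (intro mult_mono) (auto simp: u_def C_def)
      then show "norm (cK n x * v x) \<le> u x" by (simp add: abs_mult)
    qed (rule u)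
    then show ?thesis by (simp add: u)
  qed
  have "\<bar>integral {0..t} (\<lambda>x. cK n x * sin (\<phi> x))\<bar> \<le> U t"
    "\<bar>integral {0..t} (\<lambda>x. cK n x * cos (\<phi> x))\<bar> \<le> U t"
    by (intro bnd continuous_intros phi_cont; simp)+
  then have "\<bar>ca (Suc n) t\<bar> + \<bar>cb (Suc n) t\<bar> \<le> 2 * U t"
    unfolding row_coeff_Suc by simp
  also have "\<dots> = (\<bar>p\<bar> + \<bar>q\<bar>) * (2 * t) ^ Suc n / fact (Suc n)"
    by (simp add: U_def C_def power_mult_distrib)
  finally show ?case .
qed simp

text \<open>Majorant of the n-th term, uniform in t in [0,1] and |z| \<le> R; an exponential
  series.\<close>

definition row_M :: "real \<Rightarrow> nat \<Rightarrow> real" where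
  "row_M R n = (\<bar>p\<bar> + \<bar>q\<bar>) * (inverse (fact n) * (2 * R) ^ n)"

lemma summable_row_M: "summable (row_M R)"
  unfolding row_M_def by (intro summable_mult summable_exp)

lemma row_M_bounds:
  assumes "t \<in> {0..1}" "norm z \<le> R"
  shows "norm (z ^ n * complex_of_real (ca n t)) \<le> row_M R n" (is ?A)
    "norm (z ^ n * complex_of_real (cb n t)) \<le> row_M R n" (is ?B)
    "norm (z ^ n * complex_of_real (cK n t)) \<le> row_M R n" (is ?C)
proof -
  have R: "0 \<le> R" using assms(2) norm_ge_zero[of z] by linarith
  have *: "norm (z ^ n * complex_of_real x) \<le> row_M R n"
    if "\<bar>x\<bar> \<le> \<bar>ca n t\<bar> + \<bar>cb n t\<bar>" for x
  proof -
    have "\<bar>x\<bar> \<le> (\<bar>p\<bar> + \<bar>q\<bar>) * (2 * t) ^ n / fact n" using that row_coeff_bound[OF assms(1), of n] by linarith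
    also have "\<dots> \<le> (\<bar>p\<bar> + \<bar>q\<bar>) * 2 ^ n / fact n"
      using assms(1) by (intro divide_right_mono mult_left_mono power_mono) auto
    finally have "norm z ^ n * \<bar>x\<bar> \<le> R ^ n * ((\<bar>p\<bar> + \<bar>q\<bar>) * 2 ^ n / fact n)"
      using assms(2) R by (intro mult_mono power_mono) auto
    then show ?thesis by (simp add: row_M_def norm_mult norm_power power_mult_distrib divide_inverse mult_ac)
  qed
  show ?A ?B ?C
    using abs_row_K_le[of n t] by (intro *; simp)+
qed

lemma row_summable:
  assumes "t \<in> {0..1}"
  shows "summable (\<lambda>n. z ^ n * of_real (ca n t))"
    "summable (\<lambda>n. z ^ n * of_real (cb n t))"
    "summable (\<lambda>n. z ^ n * complex_of_real (cK n t))"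
  using row_M_bounds[OF assms, of z "norm z"]
  by (auto intro!: summable_comparison_test'[OF summable_row_M[of "norm z"]])

lemma row_F_eq:
  assumes "t \<in> {0..1}"
  shows "rF z t = (\<Sum>n. z ^ n * of_real (cK n t))"
proof -
  have "rF z t =
      (\<Sum>n. z ^ n * of_real (ca n t) * of_real (cos (\<phi> t))
        + z ^ n * of_real (cb n t) * of_real (sin (\<phi> t)))"
    unfolding row_F_def row1_def row2_def
    using row_summable[OF assms] by (simp add: suminf_mult2 suminf_add summable_mult2)
  then show ?thesis by (simp add: row_K_def algebra_simps)
qed

lemma row_sol_rows: "row_sol \<phi> z (row1 \<phi> p q z) (row2 \<phi> p q z)"
proof -
  \<comment> \<open>The t-derivatives of the coefficients involve the preceding coefficient; this
    index shift produces the factor z of the differential equation.\<close>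
  define a where "a = (\<lambda>n t. case n of 0 \<Rightarrow> 0 | Suc m \<Rightarrow> - (cK m t * sin (\<phi> t)))"
  define b where "b = (\<lambda>n t. case n of 0 \<Rightarrow> 0 | Suc m \<Rightarrow> cK m t * cos (\<phi> t))"
  define M where "M = (\<lambda>n. case n of 0 \<Rightarrow> 0 | Suc m \<Rightarrow> norm z * row_M (norm z) m)"
  have M: "summable M"
    by (subst summable_Suc_iff[symmetric]) (simp add: M_def summable_mult summable_row_M)
  have da: "((\<lambda>t. ca n t) has_real_derivative a n t) (at t within {0..1})"
    and db: "((\<lambda>t. cb n t) has_real_derivative b n t) (at t within {0..1})"
    if "t \<in> {0..1}" for n t
    using row_coeff_deriv[OF that] by (cases n; simp add: a_def b_def)+
  have dz: "((\<lambda>t. z ^ n * complex_of_real (u t)) has_vector_derivative z ^ n * of_real v) (at t within {0..1})"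
    if "(u has_real_derivative v) (at t within {0..1})" for u v t n
    using that by (intro has_vector_derivative_mult_right has_vector_derivative_of_real)
      (simp add: has_real_derivative_iff_has_vector_derivative)
  have nab: "norm (z ^ n * complex_of_real (a n t)) \<le> M n" (is ?A)
    "norm (z ^ n * complex_of_real (b n t)) \<le> M n" (is ?B)
    if "t \<in> {0..1}" for n t
  proof -
    have *: "norm z * norm z ^ m * (\<bar>cK m t\<bar> * \<bar>s\<bar>) \<le> norm z * row_M (norm z) m" if "\<bar>s\<bar> \<le> 1" for m s
    proof -
      have "norm z ^ m * \<bar>cK m t\<bar> * \<bar>s\<bar> \<le> row_M (norm z) m * 1"
        using row_M_bounds(3)[OF \<open>t \<in> _\<close>, of z "norm z" m] that
        by (intro mult_mono) (auto simp: norm_mult norm_power row_M_def)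
      then show ?thesis by (simp add: mult.assoc mult_left_mono)
    qed
    show ?A ?B
      using *[OF abs_sin_le_one] *[OF abs_cos_le_one]
      by (cases n; simp add: a_def b_def M_def norm_mult norm_power)+
  qed
  have "(row1 \<phi> p q z has_vector_derivative (\<Sum>n. z ^ n * of_real (a n t))) (at t within {0..1})"
    if t: "t \<in> {0..1}" for t
    unfolding row1_def
    by (rule series_has_vector_derivative[OF dz[OF da] nab(1) M row_summable(1) t])
  moreover have "(row2 \<phi> p q z has_vector_derivative (\<Sum>n. z ^ n * of_real (b n t))) (at t within {0..1})"
    if t: "t \<in> {0..1}" for t
    unfolding row2_def
    by (rule series_has_vector_derivative[OF dz[OF db] nab(2) M row_summable(2) t])
  moreover have "(\<Sum>n. z ^ n * of_real (a n t)) = - (z * rF z t * of_real (sin (\<phi> t)))" (is ?A)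
    "(\<Sum>n. z ^ n * of_real (b n t)) = z * rF z t * of_real (cos (\<phi> t))" (is ?B)
    if t: "t \<in> {0..1}" for t
  proof -
    have s: "summable (\<lambda>n. z ^ n * complex_of_real (a n t))" "summable (\<lambda>n. z ^ n * complex_of_real (b n t))"
      using nab[OF t] by (auto intro!: summable_comparison_test'[OF M])
    have "(\<Sum>n. z ^ n * complex_of_real (a n t)) = (\<Sum>n. (z ^ n * complex_of_real (cK n t)) * (- z * of_real (sin (\<phi> t))))"
      using suminf_split_head[OF s(1)] by (simp add: a_def mult_ac)
    also have "\<dots> = (\<Sum>n. z ^ n * complex_of_real (cK n t)) * (- z * of_real (sin (\<phi> t)))"
      by (rule suminf_mult2[symmetric, OF row_summable(3)[OF t]])
    finally show ?A
      by (simp add: row_F_eq[OF t])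
    have "(\<Sum>n. z ^ n * complex_of_real (b n t)) = (\<Sum>n. (z ^ n * complex_of_real (cK n t)) * (z * of_real (cos (\<phi> t))))"
      using suminf_split_head[OF s(2)] by (simp add: b_def mult_ac)
    also have "\<dots> = (\<Sum>n. z ^ n * complex_of_real (cK n t)) * (z * of_real (cos (\<phi> t)))"
      by (rule suminf_mult2[symmetric, OF row_summable(3)[OF t]])
    finally show ?B
      by (simp add: row_F_eq[OF t])
  qed
  ultimately show ?thesis by (simp add: row_sol_def)
qed

lemma row_initial: "row1 \<phi> p q z 0 = of_real p" "row2 \<phi> p q z 0 = of_real q"
proof -
  have "ca (Suc n) 0 = 0" "cb (Suc n) 0 = 0" for n
    by (simp_all add: row_coeff_Suc)
  then have "ca n 0 = (if n = 0 then p else 0)"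
    "cb n 0 = (if n = 0 then q else 0)" for n
    by (cases n; simp)+
  note c = this
  have "row1 \<phi> p q z 0 = (\<Sum>n\<in>{0}. z ^ n * of_real (ca n 0))"
    unfolding row1_def by (rule suminf_finite) (auto simp: c)
  moreover have "row2 \<phi> p q z 0 = (\<Sum>n\<in>{0}. z ^ n * of_real (cb n 0))"
    unfolding row2_def by (rule suminf_finite) (auto simp: c)
  ultimately show "row1 \<phi> p q z 0 = of_real p" "row2 \<phi> p q z 0 = of_real q" by simp_all
qed

lemma row2_holomorphic:
  assumes "t \<in> {0..1}"
  shows "(\<lambda>z. row2 \<phi> p q z t) holomorphic_on UNIV"
proof -
  have "(\<lambda>z. row2 \<phi> p q z t) holomorphic_on ball 0 R" for R
  proof (rule power_series_holomorphic)
    show "(\<lambda>n. of_real (cb n t) * (w - 0) ^ n) sums row2 \<phi> p q w t" for w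
      using summable_sums[OF row_summable(2)[OF assms, of w]] by (simp add: row2_def mult.commute)
  qed
  then have "(\<lambda>z. row2 \<phi> p q z t) field_differentiable at w" for w
    using holomorphic_on_imp_differentiable_at[OF _ open_ball, of _ 0 "norm w + 1" w] by simp
  then show ?thesis by (auto simp: holomorphic_on_def field_differentiable_at_within)
qed

text \<open>Joint continuity allows the limit in the spectral parameter to be taken under the
  integral when simplicity of the zeros is proved.\<close>

lemma row_F_continuous_param:
  "continuous_on (cball 0 R \<times> {0..1}) (\<lambda>(z, t). rF z t)"
proof -
  have "uniform_limit (cball 0 R \<times> {0..1}) (\<lambda>n (z, t). \<Sum>i<n. z ^ i * complex_of_real (cK i t))
      (\<lambda>(z, t). \<Sum>i. z ^ i * of_real (cK i t)) sequentially"
    unfolding case_prod_beta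
    by (rule Weierstrass_m_test[OF _ summable_row_M[of R]]) (intro row_M_bounds; auto)
  moreover have "\<forall>\<^sub>F n in sequentially. continuous_on (cball 0 R \<times> {0..1})
      (\<lambda>(z, t). \<Sum>i<n. z ^ i * complex_of_real (cK i t))"
    unfolding case_prod_beta
    by (intro always_eventually allI continuous_intros continuous_on_compose2[OF row_K_continuous]) auto
  ultimately have "continuous_on (cball 0 R \<times> {0..1}) (\<lambda>(z, t). \<Sum>i. z ^ i * complex_of_real (cK i t))"
    by (intro uniform_limit_theorem[where F = sequentially]) auto
  then show ?thesis
    by (rule continuous_on_cong[THEN iffD1, rotated 2]) (auto simp: row_F_eq)
qed

end

section \<open>Inequalities for the quadratic form\<close>

text \<open>By Cayley-Hamilton the difference of the two sides is |A v|^2 with v = (a, b), here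
  written out as a sum of four squares.\<close>

lemma quad_times_trace_ge:
  fixes A :: "real^2^2"
  assumes "A $ 1 $ 2 = A $ 2 $ 1"
  shows "det A * ((norm a)\<^sup>2 + (norm b)\<^sup>2) \<le> (A $ 1 $ 1 + A $ 2 $ 2) * quad A a b"
proof -
  have *: "(x + w) * (x * (a1\<^sup>2 + a2\<^sup>2) + 2 * (a1 * b1 + a2 * b2) * y + w * (b1\<^sup>2 + b2\<^sup>2))
      - (x * w - y * y) * ((a1\<^sup>2 + a2\<^sup>2) + (b1\<^sup>2 + b2\<^sup>2)) =
    (x * a1 + y * b1)\<^sup>2 + (x * a2 + y * b2)\<^sup>2 + (y * a1 + w * b1)\<^sup>2 + (y * a2 + w * b2)\<^sup>2"
    for x y w a1 a2 b1 b2 :: real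
    by algebra
  have "0 \<le> (A $ 1 $ 1 + A $ 2 $ 2) * quad A a b - det A * ((norm a)\<^sup>2 + (norm b)\<^sup>2)"
    using *[of "A $ 1 $ 1" "A $ 2 $ 2" "Re a" "Im a" "Re b" "Im b" "A $ 1 $ 2"]
    unfolding quad_def det_2 cmod_power2 assms[symmetric] by (simp add: mult.commute)
  then show ?thesis by simp
qed

text \<open>P and Q are the values of the real form at the real and imaginary parts of (a, b), and B
  is their polar value. Then P Q - B^2 is det A times the squared determinant of these two real
  vectors, and 4 P Q \<le> (P + Q)^2.\<close>

lemma quad_sq_ge:
  fixes A :: "real^2^2"
  assumes "A $ 1 $ 2 = A $ 2 $ 1"
  shows "4 * det A * (Im (b * cnj a))\<^sup>2 \<le> (quad A a b)\<^sup>2"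
proof -
  define P where "P = A $ 1 $ 1 * (Re a)\<^sup>2 + 2 * A $ 1 $ 2 * Re a * Re b + A $ 2 $ 2 * (Re b)\<^sup>2"
  define Q where "Q = A $ 1 $ 1 * (Im a)\<^sup>2 + 2 * A $ 1 $ 2 * Im a * Im b + A $ 2 $ 2 * (Im b)\<^sup>2"
  define B where "B = A $ 1 $ 1 * Re a * Im a + A $ 1 $ 2 * (Re a * Im b + Im a * Re b) + A $ 2 $ 2 * Re b * Im b"
  have "quad A a b = P + Q"
    unfolding quad_def cmod_power2 P_def Q_def by (simp add: power2_eq_square algebra_simps)
  moreover have "P * Q = B\<^sup>2 + det A * (Im (b * cnj a))\<^sup>2"
    unfolding P_def Q_def B_def det_2 assms by (simp add: power2_eq_square algebra_simps)
  moreover have "4 * (P * Q) \<le> (P + Q)\<^sup>2"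
    using zero_le_power2[of "P - Q"] by (simp add: power2_eq_square algebra_simps)
  moreover have "0 \<le> B\<^sup>2" by simp
  ultimately have "4 * (det A * (Im (b * cnj a))\<^sup>2) \<le> (P + Q)\<^sup>2" by linarith
  then show ?thesis using \<open>quad A a b = P + Q\<close> by (simp add: mult.assoc)
qed

lemma Omega_symmetric:
  assumes "continuous_on UNIV \<phi>"
  shows "Omega (ham_of_angle \<phi>) s t $ 1 $ 2 = Omega (ham_of_angle \<phi>) s t $ 2 $ 1"
  by (simp add: Omega_nth[OF assms] ham_of_angle_nth)

lemma Omega_trace:
  assumes "continuous_on UNIV \<phi>" "s \<le> t"
  shows "Omega (ham_of_angle \<phi>) s t $ 1 $ 1 + Omega (ham_of_angle \<phi>) s t $ 2 $ 2 = t - s"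
proof -
  have c: "continuous_on {s..t} \<phi>" using assms continuous_on_subset by blast
  then have "(\<lambda>x. (cos (\<phi> x))\<^sup>2) integrable_on {s..t}" "(\<lambda>x. (sin (\<phi> x))\<^sup>2) integrable_on {s..t}"
    by (auto intro!: integrable_continuous_real continuous_intros)
  then have "integral {s..t} (\<lambda>x. (cos (\<phi> x))\<^sup>2) + integral {s..t} (\<lambda>x. (sin (\<phi> x))\<^sup>2) = integral {s..t} (\<lambda>x. 1)"
    by (subst integral_add[symmetric]) (auto simp: add.commute)
  then show ?thesis using assms by (simp add: Omega_nth ham_of_angle_nth)
qed

section \<open>Energy gained on one interval\<close>

text \<open>Freezing at \<tau> and the trace t - s of \<open>Omega\<close> turn the energy integral
  into the size of the row at \<tau>. It also shows that a nonzero solution has positive L^2(H) norm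
  when the determinant is positive.\<close>

lemma row_sol_integral_ge:
  assumes "row_sol \<phi> z f g" "continuous_on UNIV \<phi>" "0 \<le> s" "s \<le> t" "t \<le> 1" "\<tau> \<in> {s..t}"
  defines "D \<equiv> detO \<phi> s t"
  shows "D * ((norm (f \<tau>))\<^sup>2 + (norm (g \<tau>))\<^sup>2) \<le>
    (t - s) * (2 * (1 + 2 * (norm z)\<^sup>2 * D) * integral {s..t} (\<lambda>x. (norm (row_F \<phi> f g x))\<^sup>2))"
proof -
  have "D * ((norm (f \<tau>))\<^sup>2 + (norm (g \<tau>))\<^sup>2) \<le> (t - s) * quad (Omega (ham_of_angle \<phi>) s t) (f \<tau>) (g \<tau>)"
    unfolding D_def Omega_trace[OF assms(2,4), symmetric]
    by (rule quad_times_trace_ge[OF Omega_symmetric[OF assms(2)]])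
  also have "\<dots> \<le> (t - s) * (2 * (1 + 2 * (norm z)\<^sup>2 * D) * integral {s..t} (\<lambda>x. (norm (row_F \<phi> f g x))\<^sup>2))"
    unfolding D_def using assms by (intro mult_left_mono row_sol_frozen) auto
  finally show ?thesis .
qed

text \<open>The increment y I of the energy q is compared with q at the left end: freezing gives
  quad \<le> 2 (1 + 2 C) I, \<open>quad_sq_ge\<close> gives 2 sqrt(det) q \<le> quad, and y
  sqrt(det) \<ge> sqrt c.\<close>

lemma row_sol_step:
  fixes y :: real
  assumes sol: "row_sol \<phi> (\<i> * of_real y) f g" and \<phi>: "continuous_on UNIV \<phi>" and st: "0 \<le> s" "s \<le> t" "t \<le> 1"
    and y: "0 < y" and D: "c \<le> y\<^sup>2 * detO \<phi> s t" "y\<^sup>2 * detO \<phi> s t \<le> C" "0 < c"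
    and q: "0 \<le> Im (g s * cnj (f s))"
  shows "(1 + sqrt c / (1 + 2 * C)) * Im (g s * cnj (f s)) \<le> Im (g t * cnj (f t))"
proof -
  define I where "I = integral {s..t} (\<lambda>x. (norm (row_F \<phi> f g x))\<^sup>2)"
  define A where "A = Omega (ham_of_angle \<phi>) s t"
  define q0 where "q0 = Im (g s * cnj (f s))"
  have C: "0 < C" using D by linarith
  have I0: "0 \<le> I" unfolding I_def using row_F_sq_integrable[OF sol \<phi> st(1,3)] by (intro integral_nonneg) auto
  have qd: "quad A (f s) (g s) \<le> 2 * (1 + 2 * y\<^sup>2 * det A) * I"
    using row_sol_frozen[OF sol \<phi> st, of s] st by (simp add: A_def I_def norm_mult)
  also have "\<dots> \<le> 2 * (1 + 2 * C) * I"
    using D(2) I0 by (intro mult_right_mono) (auto simp: A_def mult.assoc)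
  finally have 1: "quad A (f s) (g s) \<le> 2 * (1 + 2 * C) * I" .
  have dA: "0 < det A" using D y by (smt (verit) A_def zero_less_mult_iff zero_less_power)
  have "(2 * sqrt (det A) * q0)\<^sup>2 \<le> (quad A (f s) (g s))\<^sup>2"
    using quad_sq_ge[of A "g s" "f s"] Omega_symmetric[OF \<phi>] dA
    by (simp add: A_def q0_def power_mult_distrib)
  moreover have "0 \<le> quad A (f s) (g s)"
    unfolding A_def integral_norm_sq_eq_quad[OF \<phi>, symmetric]
    using continuous_on_subset[OF \<phi>, of "{s..t}"]
    by (intro integral_nonneg) (auto intro!: integrable_continuous_real continuous_intros)
  ultimately have "2 * sqrt (det A) * q0 \<le> quad A (f s) (g s)"
    by (rule power2_le_imp_le)
  with 1 have "sqrt (det A) * q0 \<le> (1 + 2 * C) * I" by linarith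
  then have "y * (sqrt (det A) * q0) \<le> y * ((1 + 2 * C) * I)" using y by (intro mult_left_mono) auto
  moreover have "sqrt c * q0 \<le> y * sqrt (det A) * q0"
  proof (rule mult_right_mono)
    have "sqrt c \<le> sqrt (y\<^sup>2 * det A)" using D by (simp add: A_def)
    then show "sqrt c \<le> y * sqrt (det A)" using y by (simp add: real_sqrt_mult)
  qed (use q in \<open>simp add: q0_def\<close>)
  ultimately have "sqrt c * q0 \<le> (1 + 2 * C) * (y * I)" by (simp add: mult_ac)
  then have "sqrt c * q0 / (1 + 2 * C) \<le> y * I" using C by (simp add: field_simps)
  moreover have "Im (g t * cnj (f t)) = q0 + y * I"
    using row_sol_energy[OF sol \<phi> st] by (simp add: q0_def I_def)
  ultimately show ?thesis unfolding q0_def[symmetric] by (simp add: distrib_right)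
qed

text \<open>Additive counterpart of \<open>row_sol_step\<close>: the gain is measured by the size of
  the row, so it is effective even where the energy vanishes, and it bounds the row at \<tau> by an
  energy increment.\<close>

lemma row_sol_energy_ge:
  fixes y :: real
  assumes sol: "row_sol \<phi> (\<i> * of_real y) f g" and \<phi>: "continuous_on UNIV \<phi>"
    and st: "0 \<le> s" "s < t" "t \<le> 1" "\<tau> \<in> {s..t}"
    and y: "0 < y" and D: "c \<le> y\<^sup>2 * detO \<phi> s t" "y\<^sup>2 * detO \<phi> s t \<le> C" "0 < c"
  shows "c / (2 * (1 + 2 * C)) / y * ((norm (f \<tau>))\<^sup>2 + (norm (g \<tau>))\<^sup>2) \<le> Im (g t * cnj (f t)) - Im (g s * cnj (f s))"
proof -
  define I where "I = integral {s..t} (\<lambda>x. (norm (row_F \<phi> f g x))\<^sup>2)"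
  define d where "d = detO \<phi> s t"
  define U where "U = (norm (f \<tau>))\<^sup>2 + (norm (g \<tau>))\<^sup>2"
  have C: "0 < C" using D by linarith
  have U0: "0 \<le> U" by (simp add: U_def)
  have I0: "0 \<le> I" unfolding I_def using row_F_sq_integrable[OF sol \<phi> st(1,3)] by (intro integral_nonneg) auto
  have "d * U \<le> (t - s) * (2 * (1 + 2 * y\<^sup>2 * d) * I)"
    using row_sol_integral_ge[OF sol \<phi> st(1) less_imp_le[OF st(2)] st(3,4)] by (simp add: d_def I_def U_def norm_mult)
  also have "\<dots> \<le> 1 * (2 * (1 + 2 * C) * I)"
    using D I0 st C det_Omega_nonneg[OF \<phi>, of s t] by (intro mult_mono mult_right_mono) (auto simp: d_def mult.assoc)
  finally have "y\<^sup>2 * (d * U) \<le> y\<^sup>2 * (2 * (1 + 2 * C) * I)" using y by (intro mult_left_mono) auto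
  moreover have "c * U \<le> y\<^sup>2 * d * U" using D U0 by (intro mult_right_mono) (auto simp: d_def)
  ultimately have "c * U \<le> y * (2 * (1 + 2 * C)) * (y * I)" by (simp add: power2_eq_square mult_ac)
  then have "c / (2 * (1 + 2 * C)) / y * U \<le> y * I"
    using C y unfolding divide_divide_eq_left times_divide_eq_left by (subst pos_divide_le_eq) (auto simp: mult_ac)
  moreover have "Im (g t * cnj (f t)) - Im (g s * cnj (f s)) = y * I"
    using row_sol_energy[OF sol \<phi> st(1) less_imp_le[OF st(2)] st(3)] by (simp add: I_def)
  ultimately show ?thesis by (simp add: U_def)
qed

section \<open>Reality and simplicity of the zeros\<close>

text \<open>Self-adjointness in terms of rows. Reality: the energy form vanishes at both ends, so Im
  w times the squared norm I is 0. Simplicity: Lagrange's identity divided by z - w tends to I =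
  f(1) g'(w), where g' is the derivative in the parameter, and I is nonzero.\<close>

lemma row2_zero_real_simple:
  assumes \<phi>: "continuous_on UNIV \<phi>" and det: "0 < detO \<phi> 0 1"
    and zero: "row2 \<phi> 0 1 w 1 = 0"
  shows "Im w = 0" "deriv (\<lambda>z. row2 \<phi> 0 1 z 1) w \<noteq> 0"
proof -
  define f where "f = row1 \<phi> 0 1"
  define g where "g = row2 \<phi> 0 1"
  define F where "F = (\<lambda>z. row_F \<phi> (f z) (g z))"
  have sol: "row_sol \<phi> z (f z) (g z)" for z unfolding f_def g_def by (rule row_sol_rows[OF \<phi>])
  have init: "f z 0 = 0" "g z 0 = 1" for z by (simp_all add: f_def g_def row_initial[OF \<phi>])
  have gw: "g w 1 = 0" using zero by (simp add: g_def)
  define I where "I = integral {0..1} (\<lambda>x. (norm (F w x))\<^sup>2)"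
  have "detO \<phi> 0 1 * ((norm (f w 0))\<^sup>2 + (norm (g w 0))\<^sup>2) \<le>
      (1 - 0) * (2 * (1 + 2 * (norm w)\<^sup>2 * detO \<phi> 0 1) * I)"
    unfolding I_def F_def by (rule row_sol_integral_ge[OF sol \<phi>]) auto
  then have I: "I \<noteq> 0" using det by (auto simp: init)
  show real: "Im w = 0"
    using row_sol_energy[OF sol[of w] \<phi>, of 0 1] I by (simp add: init gw I_def F_def)
  then have cw: "cnj w = w" by (simp add: complex_eq_iff)
  \<comment> \<open>For real w the conjugate row solves the same problem with the same initial
    value; hence F^2 = |F|^2 in the limit below.\<close>
  have Freal: "cnj (F w t) = F w t" if "t \<in> {0..1}" for t
  proof -
    have s: "row_sol \<phi> w (\<lambda>t. cnj (f w t)) (\<lambda>t. cnj (g w t))" using row_sol_cnj[OF sol[of w]] by (simp add: cw)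
    have "cnj (f w t) = f w t" "cnj (g w t) = g w t"
      using row_sol_unique[OF s sol \<phi> _ _ that] by (simp_all add: init)
    then show ?thesis by (simp add: F_def row_F_def)
  qed
  define R where "R = norm w + 1"
  have cF: "continuous_on (cball 0 R \<times> {0..1}) (\<lambda>(z, t). F z t)"
    unfolding F_def f_def g_def by (rule row_F_continuous_param[OF \<phi>])
  have "continuous_on (cball 0 R) (\<lambda>z. integral (cbox 0 1) (\<lambda>t. F z t * F w t))"
  proof (rule integral_continuous_on_param)
    have "continuous_on {0..1} (F w)" unfolding F_def by (rule row_F_continuous[OF sol \<phi>])
    then have "continuous_on (cball 0 R \<times> {0..1}) (\<lambda>x. F w (snd x))"
      by (rule continuous_on_compose2[OF _ continuous_on_snd[OF continuous_on_id]]) auto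
    moreover have "continuous_on (cball 0 R \<times> {0..1}) (\<lambda>x. F (fst x) (snd x))"
      using cF by (simp add: case_prod_beta)
    ultimately show "continuous_on (cball 0 R \<times> cbox 0 1) (\<lambda>(z, t). F z t * F w t)"
      unfolding case_prod_beta cbox_interval by (rule continuous_on_mult[rotated])
  qed
  then have "continuous (at w within cball 0 R) (\<lambda>z. integral {0..1} (\<lambda>t. F z t * F w t))"
    by (simp add: continuous_on_eq_continuous_within R_def)
  moreover have "w \<in> interior (cball 0 R)" by (simp add: R_def)
  ultimately have lim1: "((\<lambda>z. integral {0..1} (\<lambda>t. F z t * F w t)) \<longlongrightarrow> integral {0..1} (\<lambda>t. F w t * F w t)) (at w)"
    unfolding continuous_within by (simp only: at_within_interior)
  \<comment> \<open>The boundary term at 0 vanishes as both rows start at (0, 1), and g(w) = 0 at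
    the right end leaves a difference quotient in the parameter.\<close>
  have ev: "integral {0..1} (\<lambda>t. F z t * F w t) = f w 1 * ((g z 1 - g w 1) / (z - w))" if "z \<noteq> w" for z
  proof -
    have "((\<lambda>x. (z - w) * (F z x * F w x)) has_integral g z 1 * f w 1) {0..1}"
      using row_sol_lagrange[OF sol[of z] sol[of w], of 0 1] by (simp add: init gw F_def)
    then have "integral {0..1} (\<lambda>x. (z - w) * (F z x * F w x)) = g z 1 * f w 1" by (rule integral_unique)
    then have "(z - w) * integral {0..1} (\<lambda>t. F z t * F w t) = g z 1 * f w 1" by simp
    then show ?thesis using that by (simp add: gw eq_divide_eq mult.commute)
  qed
  have "((\<lambda>z. g z 1) has_field_derivative deriv (\<lambda>z. g z 1) w) (at w)"
    using row2_holomorphic[OF \<phi>, of 1 0 1] unfolding g_def by (intro holomorphic_derivI[of _ UNIV]) auto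
  then have "((\<lambda>z. f w 1 * ((g z 1 - g w 1) / (z - w))) \<longlongrightarrow> f w 1 * deriv (\<lambda>z. g z 1) w) (at w)"
    unfolding has_field_derivative_iff by (intro tendsto_mult tendsto_const)
  then have "((\<lambda>z. integral {0..1} (\<lambda>t. F z t * F w t)) \<longlongrightarrow> f w 1 * deriv (\<lambda>z. g z 1) w) (at w)"
    by (rule Lim_transform_eventually) (auto simp: eventually_at_filter ev)
  with lim1 have "integral {0..1} (\<lambda>t. F w t * F w t) = f w 1 * deriv (\<lambda>z. g z 1) w"
    by (rule LIM_unique)
  moreover have "integral {0..1} (\<lambda>t. F w t * F w t) = of_real I"
  proof -
    have "integral {0..1} (\<lambda>t. F w t * F w t) = integral {0..1} (\<lambda>t. complex_of_real ((norm (F w t))\<^sup>2))"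
      by (rule integral_cong) (metis Freal complex_norm_square)
    also have "\<dots> = of_real I"
      using integral_linear[OF row_F_sq_integrable[OF sol[of w] \<phi>, of 0 1] bounded_linear_of_real]
      unfolding I_def F_def o_def by simp
    finally show ?thesis .
  qed
  ultimately show "deriv (\<lambda>z. row2 \<phi> 0 1 z 1) w \<noteq> 0" using I by (auto simp: g_def)
qed

section \<open>The monodromy matrix and the spectrum\<close>

lemma has_vector_derivative_matrix:
  fixes w :: "2 \<Rightarrow> 2 \<Rightarrow> real \<Rightarrow> complex"
  assumes "\<And>i j. (w i j has_vector_derivative d i j) (at t within S)"
  shows "((\<lambda>t. \<chi> i j. w i j t) has_vector_derivative (\<chi> i j. d i j)) (at t within S)"
proof -
  define L :: "2 \<Rightarrow> 2 \<Rightarrow> complex \<Rightarrow> complex^2^2" where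
    "L = (\<lambda>i j x. \<chi> k l. if k = i \<and> l = j then x else 0)"
  have bl: "bounded_linear (L i j)" for i j
    by (rule linear_conv_bounded_linear[THEN iffD1], rule linearI) (auto simp: L_def vec_eq_iff)
  have eq: "(\<chi> i j. v i j) = (\<Sum>i\<in>UNIV. \<Sum>j\<in>UNIV. L i j (v i j))" for v
    by (auto simp: vec_eq_iff forall_2 sum_2 L_def)
  have "((\<lambda>t. \<Sum>i\<in>UNIV. \<Sum>j\<in>UNIV. L i j (w i j t)) has_vector_derivative (\<Sum>i\<in>UNIV. \<Sum>j\<in>UNIV. L i j (d i j))) (at t within S)"
    by (intro has_vector_derivative_sum bounded_linear.has_vector_derivative[OF bl] assms)
  then show ?thesis by (simp only: eq)
qed

lemma fund_sol_ode_iff: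
  fixes A W :: "complex^2^2"
  shows "A ** cmat Jmat = mat z ** W ** cmat (ham_of_angle \<phi> t) \<longleftrightarrow>
    (\<forall>i. A $ i $ 1 = - (z * (W $ i $ 1 * of_real (cos (\<phi> t)) + W $ i $ 2 * of_real (sin (\<phi> t))) * of_real (sin (\<phi> t))) \<and>
         A $ i $ 2 = z * (W $ i $ 1 * of_real (cos (\<phi> t)) + W $ i $ 2 * of_real (sin (\<phi> t))) * of_real (cos (\<phi> t)))"
proof -
  have "(A ** cmat Jmat) $ i $ 1 = A $ i $ 2" "(A ** cmat Jmat) $ i $ 2 = - A $ i $ 1" for i
    by (simp_all add: matrix_matrix_mult_def sum_2 cmat_def Jmat_def)
  moreover have "(mat z ** W) $ i $ j = z * W $ i $ j" for i j
    using exhaust_2[of i] by (auto simp: matrix_matrix_mult_def sum_2 mat_def)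
  then have "(mat z ** W ** cmat (ham_of_angle \<phi> t)) $ i $ 1 =
      z * (W $ i $ 1 * of_real (cos (\<phi> t)) + W $ i $ 2 * of_real (sin (\<phi> t))) * of_real (cos (\<phi> t))"
    "(mat z ** W ** cmat (ham_of_angle \<phi> t)) $ i $ 2 =
      z * (W $ i $ 1 * of_real (cos (\<phi> t)) + W $ i $ 2 * of_real (sin (\<phi> t))) * of_real (sin (\<phi> t))" for i
    by (simp_all add: matrix_matrix_mult_def[of "mat z ** W"] sum_2 cmat_def ham_of_angle_nth power2_eq_square algebra_simps)
  ultimately show ?thesis
    by (simp only: vec_eq_iff forall_2) (metis minus_equation_iff)
qed

definition row_matrix :: "(real \<Rightarrow> real) \<Rightarrow> complex \<Rightarrow> real \<Rightarrow> complex^2^2" where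
  "row_matrix \<phi> z t = (\<chi> i j. if j = 1 then row1 \<phi> (if i = 1 then 1 else 0) (if i = 1 then 0 else 1) z t
     else row2 \<phi> (if i = 1 then 1 else 0) (if i = 1 then 0 else 1) z t)"

text \<open>Existence from the power series and uniqueness from the growth bound determine the
  definite description in \<open>W_H\<close>.\<close>

lemma W_H_eq_row_matrix:
  assumes "continuous_on UNIV \<phi>"
  shows "W_H (ham_of_angle \<phi>) 1 z = row_matrix \<phi> z 1"
proof -
  have ex: "fund_sol (ham_of_angle \<phi>) z (row_matrix \<phi> z)"
    unfolding fund_sol_def
  proof (intro conjI ballI)
    show "row_matrix \<phi> z 0 = mat 1"
      by (simp add: row_matrix_def vec_eq_iff forall_2 mat_def row_initial[OF assms])
    fix t :: real assume t: "t \<in> {0..1}"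
    define d :: "2 \<Rightarrow> 2 \<Rightarrow> complex" where "d = (\<lambda>i j. let F = row_F \<phi> (\<lambda>t. row_matrix \<phi> z t $ i $ 1) (\<lambda>t. row_matrix \<phi> z t $ i $ 2) t
      in if j = 1 then - (z * F * of_real (sin (\<phi> t))) else z * F * of_real (cos (\<phi> t)))"
    have "((\<lambda>t. row_matrix \<phi> z t $ i $ j) has_vector_derivative d i j) (at t within {0..1})" for i j
      using row_solD[OF row_sol_rows[OF assms, of z "if i = 1 then 1 else 0" "if i = 1 then 0 else 1"] t]
        exhaust_2[of j]
      by (auto simp: d_def row_matrix_def Let_def)
    then have "((\<lambda>t. \<chi> i j. row_matrix \<phi> z t $ i $ j) has_vector_derivative (\<chi> i j. d i j)) (at t within {0..1})"
      by (rule has_vector_derivative_matrix)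
    then have "(row_matrix \<phi> z has_vector_derivative (\<chi> i j. d i j)) (at t within {0..1})" by simp
    moreover have "(\<chi> i j. d i j) ** cmat Jmat = mat z ** row_matrix \<phi> z t ** cmat (ham_of_angle \<phi> t)"
      unfolding fund_sol_ode_iff by (simp add: d_def row_F_def Let_def)
    ultimately show "\<exists>D. (row_matrix \<phi> z has_vector_derivative D) (at t within {0..1}) \<and>
        D ** cmat Jmat = mat z ** row_matrix \<phi> z t ** cmat (ham_of_angle \<phi> t)" by blast
  qed
  moreover have "W 1 = row_matrix \<phi> z 1" if W: "fund_sol (ham_of_angle \<phi>) z W" for W
  proof -
    have sol: "row_sol \<phi> z (\<lambda>t. W t $ i $ 1) (\<lambda>t. W t $ i $ 2)" for i
      unfolding row_sol_def
    proof
      fix t :: real assume t: "t \<in> {0..1}"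
      then obtain A where A: "(W has_vector_derivative A) (at t within {0..1})"
        "A ** cmat Jmat = mat z ** W t ** cmat (ham_of_angle \<phi> t)"
        using W unfolding fund_sol_def by blast
      have "((\<lambda>t. W t $ i $ j) has_vector_derivative A $ i $ j) (at t within {0..1})" for j
        by (rule bounded_linear.has_vector_derivative[OF bounded_linear_compose[OF
              bounded_linear_vec_nth bounded_linear_vec_nth] A(1)])
      then show "((\<lambda>t. W t $ i $ 1) has_vector_derivative
          - (z * row_F \<phi> (\<lambda>t. W t $ i $ 1) (\<lambda>t. W t $ i $ 2) t * of_real (sin (\<phi> t)))) (at t within {0..1}) \<and>
        ((\<lambda>t. W t $ i $ 2) has_vector_derivative
          z * row_F \<phi> (\<lambda>t. W t $ i $ 1) (\<lambda>t. W t $ i $ 2) t * of_real (cos (\<phi> t))) (at t within {0..1})"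
        using A(2) unfolding fund_sol_ode_iff row_F_def by metis
    qed
    have W0: "W 0 = mat 1" using W by (simp add: fund_sol_def)
    have "W 1 $ i $ 1 = row_matrix \<phi> z 1 $ i $ 1 \<and> W 1 $ i $ 2 = row_matrix \<phi> z 1 $ i $ 2" for i
      using row_sol_unique[OF sol[of i] row_sol_rows[OF assms, of z "if i = 1 then 1 else 0" "if i = 1 then 0 else 1"] assms, of 1]
        exhaust_2[of i]
      by (auto simp: W0 mat_def row_initial[OF assms] row_matrix_def)
    then show ?thesis by (simp add: vec_eq_iff forall_2)
  qed
  ultimately show ?thesis unfolding W_H_def by (intro the_equality) blast+
qed

lemma row2_at_0:
  assumes "continuous_on UNIV \<phi>"
  shows "row2 \<phi> 0 1 0 t = 1"
proof -
  have "row2 \<phi> 0 1 0 t = (\<Sum>n\<in>{0}. 0 ^ n * of_real (snd (row_coeff \<phi> 0 1 n t)))"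
    unfolding row2_def by (rule suminf_finite) auto
  then show ?thesis by simp
qed

lemma L2H_normsq_eq:
  "L2H_normsq (ham_of_angle \<phi>) f =
    integral {0..1} (\<lambda>t. (norm (row_F \<phi> (\<lambda>t. f t $ 1) (\<lambda>t. f t $ 2) t))\<^sup>2)"
  unfolding L2H_normsq_def
proof (rule integral_cong)
  fix t :: real
  have "(\<Sum>i\<in>UNIV. \<Sum>j\<in>UNIV. cnj (f t $ i) * cmat (ham_of_angle \<phi> t) $ i $ j * f t $ j) =
      row_F \<phi> (\<lambda>t. f t $ 1) (\<lambda>t. f t $ 2) t * cnj (row_F \<phi> (\<lambda>t. f t $ 1) (\<lambda>t. f t $ 2) t)"
    by (simp add: sum_2 cmat_def ham_of_angle_nth row_F_def power2_eq_square algebra_simps)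
  then show "Re (\<Sum>i\<in>UNIV. \<Sum>j\<in>UNIV. cnj (f t $ i) * cmat (ham_of_angle \<phi> t) $ i $ j * f t $ j) =
      (norm (row_F \<phi> (\<lambda>t. f t $ 1) (\<lambda>t. f t $ 2) t))\<^sup>2"
    by (simp only: complex_norm_square[symmetric] Re_complex_of_real)
qed

lemma J_ham_mult_nth:
  fixes v :: "complex^2"
  shows "(cmat Jmat *v (cmat (ham_of_angle \<phi> s) *v (w *s v))) $ 1 =
      - (w * (v $ 1 * of_real (cos (\<phi> s)) + v $ 2 * of_real (sin (\<phi> s))) * of_real (sin (\<phi> s)))"
    "(cmat Jmat *v (cmat (ham_of_angle \<phi> s) *v (w *s v))) $ 2 =
      w * (v $ 1 * of_real (cos (\<phi> s)) + v $ 2 * of_real (sin (\<phi> s))) * of_real (cos (\<phi> s))"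
  by (simp_all add: matrix_vector_mult_def sum_2 cmat_def Jmat_def ham_of_angle_nth power2_eq_square algebra_simps)

lemma J_ham_mult_continuous:
  fixes f :: "real \<Rightarrow> complex^2"
  assumes "continuous_on S \<phi>" "continuous_on S f"
  shows "continuous_on S (\<lambda>s. cmat Jmat *v (cmat (ham_of_angle \<phi> s) *v (w *s f s)))" (is "continuous_on S ?v")
proof -
  have f: "continuous_on S (\<lambda>t. f t $ i)" for i
    using continuous_on_component[OF assms(2)] .
  have "continuous_on S (\<lambda>s. ?v s $ 1)" "continuous_on S (\<lambda>s. ?v s $ 2)"
    unfolding J_ham_mult_nth by (intro continuous_intros f assms(1))+
  then have "continuous_on S (\<lambda>s. ?v s $ i)" for i using exhaust_2[of i] by metis
  then have "continuous_on S (\<lambda>s. \<chi> i. ?v s $ i)" by (rule continuous_on_vec_lambda)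
  then show ?thesis by (simp only: vec_lambda_eta)
qed

text \<open>Transposed rows solve f' = J H w f. The condition at 0 leaves the multiples of the row
  starting at (0, 1), the condition at 1 is the vanishing of its second entry, and the positive
  determinant keeps its L^2(H) norm from being 0.\<close>

lemma spectrum_H_eq_zeros:
  assumes \<phi>: "continuous_on UNIV \<phi>" and det: "0 < detO \<phi> 0 1"
  shows "spectrum_H (ham_of_angle \<phi>) = {w. row2 \<phi> 0 1 w 1 = 0}"
proof (intro set_eqI iffI)
  fix w assume "w \<in> spectrum_H (ham_of_angle \<phi>)"
  then obtain f :: "real \<Rightarrow> complex^2" where cf: "continuous_on {0..1} f"
    and eq: "\<And>t. t \<in> {0..1} \<Longrightarrow> f t = f 0 + integral {0..t} (\<lambda>s. cmat Jmat *v (cmat (ham_of_angle \<phi> s) *v (w *s f s)))"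
    and bc: "f 0 $ 1 = 0" "f 1 $ 2 = 0" and nz: "L2H_normsq (ham_of_angle \<phi>) f \<noteq> 0"
    unfolding spectrum_H_def by blast
  define v where "v = (\<lambda>s. cmat Jmat *v (cmat (ham_of_angle \<phi> s) *v (w *s f s)))"
  have c\<phi>: "continuous_on {0..1} \<phi>" using \<phi> continuous_on_subset by blast
  have cv: "continuous_on {0..1} v" unfolding v_def by (rule J_ham_mult_continuous[OF c\<phi> cf])
  have cvi: "continuous_on {0..1} (\<lambda>s. v s $ i)" for i by (rule continuous_on_component[OF cv])
  have fi: "f t $ i = f 0 $ i + integral {0..t} (\<lambda>s. v s $ i)" if t: "t \<in> {0..1}" for t i
  proof -
    have "v integrable_on {0..t}"
      using t by (intro integrable_continuous_real continuous_on_subset[OF cv]) auto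
    then have "integral {0..t} (\<lambda>s. v s $ i) = integral {0..t} v $ i"
      using integral_linear[OF _ bounded_linear_vec_nth, of v "{0..t}" i] by (simp add: o_def)
    then show ?thesis using eq[OF t] by (simp add: v_def)
  qed
  have d: "((\<lambda>t. f t $ i) has_vector_derivative v t $ i) (at t within {0..1})" if t: "t \<in> {0..1}" for t i
  proof -
    have "((\<lambda>t. f 0 $ i + integral {0..t} (\<lambda>s. v s $ i)) has_vector_derivative 0 + v t $ i) (at t within {0..1})"
      by (intro has_vector_derivative_add has_vector_derivative_const integral_has_vector_derivative[OF cvi t])
    from has_vector_derivative_transform[OF t _ this, of "\<lambda>t. f t $ i"] fi
    show ?thesis by (simp only: add_0)
  qed
  have sol: "row_sol \<phi> w (\<lambda>t. f t $ 1) (\<lambda>t. f t $ 2)"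
    unfolding row_sol_def
  proof
    fix t :: real assume t: "t \<in> {0..1}"
    show "((\<lambda>t. f t $ 1) has_vector_derivative
          - (w * row_F \<phi> (\<lambda>t. f t $ 1) (\<lambda>t. f t $ 2) t * of_real (sin (\<phi> t)))) (at t within {0..1}) \<and>
        ((\<lambda>t. f t $ 2) has_vector_derivative
          w * row_F \<phi> (\<lambda>t. f t $ 1) (\<lambda>t. f t $ 2) t * of_real (cos (\<phi> t))) (at t within {0..1})"
      using d[OF t, of 1] d[OF t, of 2] unfolding v_def J_ham_mult_nth row_F_def by (rule conjI)
  qed
  have "row_sol \<phi> w (\<lambda>t. f 0 $ 2 * row1 \<phi> 0 1 w t + 0 * row1 \<phi> 0 1 w t) (\<lambda>t. f 0 $ 2 * row2 \<phi> 0 1 w t + 0 * row2 \<phi> 0 1 w t)"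
    by (intro row_sol_lincomb row_sol_rows \<phi>)
  then have sol': "row_sol \<phi> w (\<lambda>t. f 0 $ 2 * row1 \<phi> 0 1 w t) (\<lambda>t. f 0 $ 2 * row2 \<phi> 0 1 w t)" by simp
  have f: "f t $ 1 = f 0 $ 2 * row1 \<phi> 0 1 w t" "f t $ 2 = f 0 $ 2 * row2 \<phi> 0 1 w t" if "t \<in> {0..1}" for t
    using row_sol_unique[OF sol sol' \<phi> _ _ that] by (simp_all add: bc row_initial[OF \<phi>])
  have "f 0 $ 2 \<noteq> 0"
  proof
    assume 0: "f 0 $ 2 = 0"
    have "integral {0..1} (\<lambda>t. (norm (row_F \<phi> (\<lambda>t. f t $ 1) (\<lambda>t. f t $ 2) t))\<^sup>2) = integral {0..1::real} (\<lambda>t. 0)"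
      by (rule integral_cong) (simp add: row_F_def f 0)
    with nz show False by (simp add: L2H_normsq_eq)
  qed
  then show "w \<in> {w. row2 \<phi> 0 1 w 1 = 0}" using f(2)[of 1] bc by simp
next
  fix w assume "w \<in> {w. row2 \<phi> 0 1 w 1 = 0}"
  then have zero: "row2 \<phi> 0 1 w 1 = 0" by simp
  note sol = row_sol_rows[OF \<phi>, of w 0 1]
  define f :: "real \<Rightarrow> complex^2" where "f = (\<lambda>t. \<chi> i. if i = 1 then row1 \<phi> 0 1 w t else row2 \<phi> 0 1 w t)"
  have f12: "f t $ 1 = row1 \<phi> 0 1 w t" "f t $ 2 = row2 \<phi> 0 1 w t" for t by (simp_all add: f_def)
  define v where "v = (\<lambda>s. cmat Jmat *v (cmat (ham_of_angle \<phi> s) *v (w *s f s)))"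
  have c\<phi>: "continuous_on {0..1} \<phi>" using \<phi> continuous_on_subset by blast
  have cfi: "continuous_on {0..1} (\<lambda>t. f t $ i)" for i
    using exhaust_2[of i] row_sol_continuous[OF sol] by (auto simp: f12)
  then have "continuous_on {0..1} (\<lambda>s. \<chi> i. f s $ i)" by (rule continuous_on_vec_lambda)
  then have cf: "continuous_on {0..1} f" by (simp only: vec_lambda_eta)
  have cv: "continuous_on {0..1} v" unfolding v_def by (rule J_ham_mult_continuous[OF c\<phi> cf])
  have d: "((\<lambda>t. f t $ i) has_vector_derivative v t $ i) (at t within {0..1})" if "t \<in> {0..1}" for t i
    using row_solD[OF sol that] exhaust_2[of i] by (auto simp: v_def J_ham_mult_nth f12 row_F_def)
  have eq: "f t = f 0 + integral {0..t} v" if t: "t \<in> {0..1}" for t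
  proof -
    have "v integrable_on {0..t}"
      using t by (intro integrable_continuous_real continuous_on_subset[OF cv]) auto
    then have 1: "integral {0..t} (\<lambda>s. v s $ i) = integral {0..t} v $ i" for i
      using integral_linear[OF _ bounded_linear_vec_nth, of v "{0..t}" i] by (simp add: o_def)
    have "((\<lambda>s. v s $ i) has_integral (f t $ i - f 0 $ i)) {0..t}" for i
      using t by (intro fundamental_theorem_of_calculus has_vector_derivative_within_subset[OF d]) auto
    then have "integral {0..t} (\<lambda>s. v s $ i) = f t $ i - f 0 $ i" for i by (rule integral_unique)
    then show ?thesis by (simp add: vec_eq_iff 1[symmetric])
  qed
  have "detO \<phi> 0 1 * ((norm (row1 \<phi> 0 1 w 0))\<^sup>2 + (norm (row2 \<phi> 0 1 w 0))\<^sup>2) \<le>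
      (1 - 0) * (2 * (1 + 2 * (norm w)\<^sup>2 * detO \<phi> 0 1) * L2H_normsq (ham_of_angle \<phi>) f)"
    unfolding L2H_normsq_eq f12 by (rule row_sol_integral_ge[OF sol \<phi>]) auto
  then have "L2H_normsq (ham_of_angle \<phi>) f \<noteq> 0" using det by (auto simp: row_initial[OF \<phi>])
  moreover have "f 0 $ 1 = 0" "f 1 $ 2 = 0" using zero by (simp_all add: f12 row_initial[OF \<phi>])
  ultimately show "w \<in> spectrum_H (ham_of_angle \<phi>)"
    unfolding spectrum_H_def using cf eq[unfolded v_def] by blast
qed

section \<open>Operator norm and rows of a matrix\<close>

lemma bounded_linear_complex_matrix: "bounded_linear (\<lambda>v :: complex^2. (M :: complex^2^2) *v v)"
  by (rule linear_conv_bounded_linear[THEN iffD1], rule linearI)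
     (auto simp: matrix_vector_mult_def vec_eq_iff sum_2 algebra_simps scaleR_right_distrib)

lemma norm_complex_2: "(norm (v :: complex^2))\<^sup>2 = (norm (v $ 1))\<^sup>2 + (norm (v $ 2))\<^sup>2"
  by (simp add: norm_vec_def L2_set_def sum_2)

lemma mat_norm_le:
  fixes M :: "complex^2^2"
  assumes "\<And>i j. norm (M $ i $ j) \<le> K"
  shows "mat_norm M \<le> 4 * K"
proof -
  have K: "0 \<le> K" using assms[of 1 1] norm_ge_zero order_trans by blast
  have "norm (M *v v) \<le> 4 * K * norm v" for v :: "complex^2"
  proof -
    have vi: "norm (v $ j) \<le> norm v" for j by (rule Finite_Cartesian_Product.norm_nth_le)
    have i: "norm ((M *v v) $ i) \<le> 2 * K * norm v" for i
    proof -
      have "norm ((M *v v) $ i) \<le> norm (M $ i $ 1 * v $ 1) + norm (M $ i $ 2 * v $ 2)"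
        unfolding matrix_vector_mult_def by (simp add: sum_2 norm_triangle_ineq)
      also have "\<dots> \<le> K * norm v + K * norm v"
        unfolding norm_mult using assms vi K by (intro add_mono mult_mono) auto
      finally show ?thesis by simp
    qed
    have "norm (M *v v) \<le> (\<Sum>i\<in>UNIV. norm ((M *v v) $ i))"
      unfolding norm_vec_def by (rule L2_set_le_sum) simp
    also have "\<dots> \<le> 4 * K * norm v" using i[of 1] i[of 2] by (simp add: sum_2)
    finally show ?thesis .
  qed
  then show ?thesis unfolding mat_norm_def by (rule onorm_le)
qed

text \<open>\<open>mat_norm\<close> is defined through the action on columns; testing it on the
  conjugate of the row (x, y) M and applying Cauchy-Schwarz transfers it to rows.\<close>

lemma row_norm_le_mat_norm:
  fixes M :: "complex^2^2" and x y :: complex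
  defines "m1 \<equiv> x * M $ 1 $ 1 + y * M $ 2 $ 1" and "m2 \<equiv> x * M $ 1 $ 2 + y * M $ 2 $ 2"
  shows "(norm m1)\<^sup>2 + (norm m2)\<^sup>2 \<le> (mat_norm M)\<^sup>2 * ((norm x)\<^sup>2 + (norm y)\<^sup>2)"
proof -
  define v :: "complex^2" where "v = (\<chi> i. if i = 1 then cnj m1 else cnj m2)"
  define S where "S = (norm m1)\<^sup>2 + (norm m2)\<^sup>2"
  have S0: "0 \<le> S" by (simp add: S_def)
  have nv: "(norm v)\<^sup>2 = S" by (simp add: norm_complex_2 v_def S_def)
  have "norm (M *v v) \<le> mat_norm M * norm v"
    unfolding mat_norm_def by (rule onorm[OF bounded_linear_complex_matrix])
  then have Mv: "(norm (M *v v))\<^sup>2 \<le> (mat_norm M)\<^sup>2 * S"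
    using power_mono[of "norm (M *v v)" "mat_norm M * norm v" 2] nv by (simp add: power_mult_distrib)
  have "of_real S = x * (M *v v) $ 1 + y * (M *v v) $ 2"
  proof -
    have "of_real S = m1 * cnj m1 + m2 * cnj m2" unfolding S_def of_real_add complex_norm_square ..
    also have "\<dots> = x * (M *v v) $ 1 + y * (M *v v) $ 2"
      by (simp add: matrix_vector_mult_def sum_2 v_def) (simp add: m1_def m2_def algebra_simps)
    finally show ?thesis .
  qed
  then have "S = norm (x * (M *v v) $ 1 + y * (M *v v) $ 2)"
    using S0 by (metis norm_of_real abs_of_nonneg)
  also have "\<dots> \<le> norm x * norm ((M *v v) $ 1) + norm y * norm ((M *v v) $ 2)"
    by (rule order_trans[OF norm_triangle_ineq]) (simp add: norm_mult)
  finally have "S\<^sup>2 \<le> (norm x * norm ((M *v v) $ 1) + norm y * norm ((M *v v) $ 2))\<^sup>2"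
    using S0 by (intro power_mono)
  also have "\<dots> \<le> ((norm x)\<^sup>2 + (norm y)\<^sup>2) * ((norm ((M *v v) $ 1))\<^sup>2 + (norm ((M *v v) $ 2))\<^sup>2)"
    using zero_le_power2[of "norm x * norm ((M *v v) $ 2) - norm y * norm ((M *v v) $ 1)"]
    by (simp add: power2_eq_square algebra_simps)
  also have "\<dots> \<le> ((norm x)\<^sup>2 + (norm y)\<^sup>2) * ((mat_norm M)\<^sup>2 * S)"
    using Mv by (intro mult_left_mono) (auto simp: norm_complex_2)
  finally have "S * S \<le> ((mat_norm M)\<^sup>2 * ((norm x)\<^sup>2 + (norm y)\<^sup>2)) * S"
    by (simp add: power2_eq_square mult_ac)
  then show ?thesis
    using S0 unfolding S_def[symmetric] by (cases "S = 0") auto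
qed

section \<open>Growth, step counts and eigenvalues for the Weierstrass function\<close>

context weierstrass_angle
begin

definition \<rho> :: real where "\<rho> = 1 / (1 + \<nu>)"

lemma rho: "0 < \<rho>" "\<rho> < 1" "\<rho> * (1 + \<nu>) = 1" "1 - \<rho> * \<nu> = \<rho>"
  using nu by (auto simp: \<rho>_def field_simps)

lemma continuous_D: "continuous_on {s..1} (D s)"
proof -
  have "continuous_on {s..1} (\<lambda>t. Omega H s t $ i $ j)" for i j
  proof -
    have "continuous_on {s..1} (\<lambda>x. H x $ i $ j)"
      by (intro continuous_on_component continuous_on_ham_of_angle continuous_on_subset[OF continuous_phi]) auto
    then show ?thesis unfolding Omega_nth[OF continuous_phi]
      by (intro indefinite_integral_continuous_1 integrable_continuous_real)
  qed
  then show ?thesis unfolding det_2 by (intro continuous_on_diff continuous_on_mult)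
qed

lemma D_self: "D s s = 0"
  unfolding det_2 Omega_nth[OF continuous_phi] by simp

lemma D_pos: "s < t \<Longrightarrow> t \<le> s + 1 \<Longrightarrow> 0 < D s t"
  using det_ge by (smt (verit) powr_gt_zero mult_pos_pos)

lemma D_strict_mono: "s \<le> t \<Longrightarrow> t < u \<Longrightarrow> u \<le> s + 1 \<Longrightarrow> D s t < D s u"
  using det_Omega_superadditive[OF continuous_phi, of s t u] D_pos[of t u] by linarith

section \<open>Step count of the algorithm\<close>

lemma kappa_bounds:
  assumes "0 < c"
  shows "\<exists>C1 C2. 0 < C1 \<and> 0 < C2 \<and> (\<forall>r>1. C1 * r powr \<rho> \<le> real (kappa_H H c r) \<and>
    real (kappa_H H c r) \<le> C2 * r powr \<rho>)"
proof -
  obtain c0 where c0: "0 < c0" "\<And>s t. s < t \<Longrightarrow> t \<le> s + 1 \<Longrightarrow> c0 * (t - s) powr (2 * (1 + \<nu>)) \<le> D s t"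
    using det_ge by blast
  obtain C0 where C0: "0 < C0" "\<And>s t. s < t \<Longrightarrow> t \<le> s + 1 \<Longrightarrow> D s t \<le> C0 * (t - s) powr (2 * (1 + \<nu>))"
    using det_le by blast
  \<comment> \<open>The power law for the determinant is inverted at the value c / r^2: every full
    step has length between k1 r^(-\<rho>) and k2 r^(-\<rho>).\<close>
  define k1 where "k1 = (c / C0) powr (\<rho> / 2)"
  define k2 where "k2 = (c / c0) powr (\<rho> / 2)"
  have k: "0 < k1" "0 < k2" using assms c0 C0 by (auto simp: k1_def k2_def)
  have root: "(x powr (2 * (1 + \<nu>))) powr (\<rho> / 2) = x" if "0 < x" for x
  proof -
    have "2 * (1 + \<nu>) * (\<rho> / 2) = 1" using rho(3) by (simp add: algebra_simps)
    then show ?thesis using that by (simp only: powr_powr powr_one)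
  qed
  have "1 / k2 * r powr \<rho> \<le> real (kappa_H H c r) \<and> real (kappa_H H c r) \<le> (1 + 1 / k1) * r powr \<rho>"
    if r: "1 < r" for r
  proof -
    define h where "h = c / r\<^sup>2"
    have h: "0 < h" using assms r by (simp add: h_def)
    have hp: "(h / x) powr (\<rho> / 2) = (c / x) powr (\<rho> / 2) * r powr (- \<rho>)" if "0 < x" for x
    proof -
      have "h / x = c / x / r powr 2" using r by (simp add: h_def)
      then have "(h / x) powr (\<rho> / 2) = (c / x / r powr 2) powr (\<rho> / 2)" by (rule arg_cong)
      also have "\<dots> = (c / x) powr (\<rho> / 2) / (r powr 2) powr (\<rho> / 2)" by (rule powr_divide)
      also have "(r powr 2) powr (\<rho> / 2) = r powr \<rho>" by (simp add: powr_powr)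
      finally show ?thesis by (simp add: powr_minus_divide)
    qed
    define l1 where "l1 = k1 * r powr (- \<rho>)"
    define l2 where "l2 = k2 * r powr (- \<rho>)"
    have l: "0 < l1" "0 < l2" using k r by (auto simp: l1_def l2_def)
    have lower: "l1 \<le> t - s" if "s < t" "t \<le> s + 1" "h \<le> D s t" for s t
    proof -
      have "h / C0 \<le> (t - s) powr (2 * (1 + \<nu>))" using C0(2)[OF that(1,2)] that(3) C0(1) by (simp add: field_simps)
      then have "(h / C0) powr (\<rho> / 2) \<le> ((t - s) powr (2 * (1 + \<nu>))) powr (\<rho> / 2)"
        using h C0 rho by (intro powr_mono2) auto
      then show ?thesis using that root[of "t - s"] C0 by (simp add: hp l1_def k1_def)
    qed
    have upper: "t - s \<le> l2" if "s < t" "t \<le> s + 1" "D s t \<le> h" for s t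
    proof -
      have "(t - s) powr (2 * (1 + \<nu>)) \<le> h / c0" using c0(2)[OF that(1,2)] that(3) c0(1) by (simp add: field_simps)
      then have "((t - s) powr (2 * (1 + \<nu>))) powr (\<rho> / 2) \<le> (h / c0) powr (\<rho> / 2)"
        using rho by (intro powr_mono2) auto
      then show ?thesis using that root[of "t - s"] c0 by (simp add: hp l2_def k2_def)
    qed
    define \<sigma> where "\<sigma> = alg_sigma H c r"
    define P where "P = (\<lambda>j. h < D (\<sigma> j) 1)"
    have step: "\<sigma> j < \<sigma> (Suc j) \<and> \<sigma> (Suc j) < 1 \<and> D (\<sigma> j) (\<sigma> (Suc j)) = h"
      if "0 \<le> \<sigma> j" "\<sigma> j < 1" "P j" for j
    proof -
      have "\<exists>x\<ge>\<sigma> j. x \<le> 1 \<and> D (\<sigma> j) x = h"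
        using that h by (intro IVT') (auto simp: P_def D_self continuous_D)
      then obtain x where x: "\<sigma> j \<le> x" "x \<le> 1" "D (\<sigma> j) x = h" by blast
      then have x': "\<sigma> j < x" "x < 1"
        using h that D_self[of "\<sigma> j"] by (auto simp: P_def order.order_iff_strict)
      have uniq: "x' = x" if "\<sigma> j < x'" "x' < 1" "D (\<sigma> j) x' = h" for x'
        using D_strict_mono[of "\<sigma> j" x x'] D_strict_mono[of "\<sigma> j" x' x] x x' that \<open>0 \<le> \<sigma> j\<close>
        by (cases x x' rule: linorder_cases) auto
      have "(THE s. \<sigma> j < s \<and> s < 1 \<and> D (\<sigma> j) s = h) = x"
        by (rule the_equality) (use x(3) x' uniq in blast)+
      moreover have "\<sigma> (Suc j) = (THE s. \<sigma> j < s \<and> s < 1 \<and> D (\<sigma> j) s = h)"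
        using that(3) by (simp add: \<sigma>_def P_def h_def)
      ultimately show ?thesis using x x' by simp
    qed
    have inv: "0 \<le> \<sigma> j \<and> \<sigma> j < 1 \<and> real j * l1 \<le> \<sigma> j \<and> \<sigma> j \<le> real j * l2" if "\<forall>i<j. P i" for j
      using that
    proof (induction j)
      case 0
      then show ?case by (simp add: \<sigma>_def)
    next
      case (Suc j)
      then have IH: "0 \<le> \<sigma> j" "\<sigma> j < 1" "real j * l1 \<le> \<sigma> j" "\<sigma> j \<le> real j * l2" by auto
      note s = step[OF IH(1,2)]
      have "P j" using Suc by auto
      then show ?case
        using s lower[of "\<sigma> j" "\<sigma> (Suc j)"] upper[of "\<sigma> j" "\<sigma> (Suc j)"] IH by (simp add: algebra_simps)
    qed
    have ex: "\<exists>j. \<not> P j"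
    proof (rule ccontr)
      assume "\<nexists>j. \<not> P j"
      then have "real j * l1 < 1" for j using inv[of j] by (auto intro: le_less_trans)
      moreover obtain j :: nat where "1 / l1 < real j" using reals_Archimedean2 by blast
      ultimately show False using l by (auto simp: field_simps dest: less_asym)
    qed
    define j0 where "j0 = (LEAST j. \<not> P j)"
    have j0: "\<not> P j0" "\<forall>i<j0. P i"
      unfolding j0_def using LeastI_ex[OF ex] not_less_Least by blast+
    \<comment> \<open>\<open>j0\<close> full steps precede the final one, which ends at 1 and is
      counted as well; hence the successor.\<close>
    have kap: "kappa_H H c r = Suc j0"
      unfolding kappa_H_def
    proof (rule Least_equality)
      show "1 \<le> Suc j0 \<and> \<not> c / r\<^sup>2 < D (alg_sigma H c r (Suc j0 - 1)) 1"
        using j0 by (simp add: P_def h_def \<sigma>_def)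
      fix j assume "1 \<le> j \<and> \<not> c / r\<^sup>2 < D (alg_sigma H c r (j - 1)) 1"
      then have "1 \<le> j" "\<not> P (j - 1)" by (auto simp: P_def h_def \<sigma>_def)
      then show "Suc j0 \<le> j" using j0(2) by (metis Suc_le_eq Suc_pred' less_Suc_eq_le not_less One_nat_def)
    qed
    note i = inv[OF j0(2)]
    \<comment> \<open>The final step may be short but never exceeds \<open>l2\<close>, so j0 + 1
      steps of length at most \<open>l2\<close> cover [0,1]; only the \<open>j0\<close> full steps
      have length at least \<open>l1\<close>.\<close>
    have "1 - \<sigma> j0 \<le> l2" using i j0(1) by (intro upper) (auto simp: P_def)
    then have "1 \<le> real (Suc j0) * l2" using i by (simp add: algebra_simps)
    then have "1 / k2 * r powr \<rho> \<le> real (kappa_H H c r)"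
      unfolding kap using k r by (simp add: l2_def powr_minus field_simps)
    moreover have "real j0 * l1 \<le> 1" using i by linarith
    then have "real j0 \<le> 1 / k1 * r powr \<rho>"
      using k r by (simp add: l1_def powr_minus field_simps)
    then have "real (kappa_H H c r) \<le> (1 + 1 / k1) * r powr \<rho>"
      unfolding kap using ge_one_powr_ge_zero[of r \<rho>] r rho by (simp add: distrib_right)
    ultimately show ?thesis by simp
  qed
  then show ?thesis using k by (intro exI[of _ "1 / k2"] exI[of _ "1 + 1 / k1"]) (auto simp: add_pos_pos)
qed

section \<open>Upper bound for the growth of rows\<close>

lemma rows_upper:
  "\<exists>C>0. \<forall>z f g. row_sol \<phi> z f g \<longrightarrow> (norm (f 0))\<^sup>2 + (norm (g 0))\<^sup>2 = 1 \<longrightarrow> 1 \<le> norm z \<longrightarrow>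
     norm (f 1) \<le> exp (C * norm z powr \<rho>) \<and> norm (g 1) \<le> exp (C * norm z powr \<rho>)"
proof -
  define a where "a = 1 / (1 - \<alpha>)"
  define k2 where "k2 = pi / (\<alpha> * b - 1) / a"
  have a: "1 \<le> a" using alpha by (simp add: a_def)
  have k2: "0 < k2" using ab_gt a by (simp add: k2_def)
  define C where "C = 2 + a\<^sup>2 + (4 * a * b powr \<nu> + k2 * (1 + a\<^sup>2))"
  have C: "0 < C" unfolding C_def using a k2 b_nz by (intro add_pos_pos mult_pos_pos) auto
  have "norm (f 1) \<le> exp (C * norm z powr \<rho>) \<and> norm (g 1) \<le> exp (C * norm z powr \<rho>)"
    if sol: "row_sol \<phi> z f g" and init: "(norm (f 0))\<^sup>2 + (norm (g 0))\<^sup>2 = 1" and z: "1 \<le> norm z" for z f g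
  proof -
    define r where "r = norm z"
    define x where "x = r powr \<rho>"
    have x: "1 \<le> x" using z rho by (simp add: x_def r_def ge_one_powr_ge_zero)
    \<comment> \<open>b^k agrees with x = r^\<rho> up to a factor b; at this k both r \<alpha>^k and
      b^k are of order r^\<rho>.\<close>
    define k where "k = nat \<lfloor>log b x\<rfloor>"
    have lb: "0 \<le> log b x" using x b_gt_1 by simp
    then have kl: "real k \<le> log b x" "log b x < real k + 1" by (auto simp: k_def)
    have bx: "b powr log b x = x" using x b_gt_1 by simp
    have "b powr real k \<le> b powr log b x" using kl b_gt_1 by (intro powr_mono) auto
    then have bk: "b ^ k \<le> x" using b_gt_1 bx by (simp add: powr_realpow)
    have "b powr log b x \<le> b powr (real k + 1)" using kl b_gt_1 by (intro powr_mono) auto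
    then have bk': "x \<le> b * b ^ k" using b_gt_1 bx by (simp add: powr_realpow powr_add mult.commute)
    have bk0: "0 < b ^ k" using b_gt_1 by simp
    define A where "A = \<alpha> ^ k / (1 - \<alpha>)"
    define B where "B = pi / (\<alpha> * b - 1) * (\<alpha> * b) ^ k"
    have A: "0 < A" "A \<le> a" using alpha by (auto simp: A_def a_def power_le_one divide_right_mono)
    have Aa: "A = a * \<alpha> ^ k" by (simp add: A_def a_def)
    have BA: "B = k2 * b ^ k * A" using a by (simp add: B_def k2_def Aa power_mult_distrib)
    have "(norm (f 1))\<^sup>2 + (norm (g 1))\<^sup>2 \<le>
      (1 + 1 / A\<^sup>2) * ((1 + A\<^sup>2) * ((norm (f 0))\<^sup>2 + (norm (g 0))\<^sup>2) * exp ((4 * norm z * A + B * (1 / A + A)) * 1))"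
      by (rule row_sol_growth[OF sol theta_derivative[of k]])
        (use A(1) abs_phi_minus_theta_le abs_theta'_le in \<open>auto simp: A_def B_def\<close>)
    also have "\<dots> = (1 + 1 / A\<^sup>2) * ((1 + A\<^sup>2) * exp (4 * r * A + B * (1 / A + A)))"
      by (simp add: init r_def)
    also have "\<dots> \<le> exp (2 * x) * (exp (a\<^sup>2 * x) * exp ((4 * a * b powr \<nu> + k2 * (1 + a\<^sup>2)) * x))"
    proof (intro mult_mono)
      \<comment> \<open>The weight is not smaller than 1 / x, because (\<alpha> b)^k \<ge> 1;
        undoing it therefore costs only a factor exp (2 x).\<close>
      have "1 / A \<le> x"
      proof -
        have "1 \<le> (\<alpha> * b) ^ k" using ab_gt by simp
        also have "\<dots> = \<alpha> ^ k * b ^ k" by (rule power_mult_distrib)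
        also have "\<dots> \<le> A * x"
          using A alpha a bk bk0 by (intro mult_mono) (auto simp: Aa mult_le_cancel_right1)
        finally show ?thesis using A by (simp add: field_simps)
      qed
      then have "(1 / A)\<^sup>2 \<le> x\<^sup>2" using A by (intro power_mono) auto
      then have "1 + 1 / A\<^sup>2 \<le> (1 + x)\<^sup>2" using x by (simp add: power_divide power2_eq_square algebra_simps)
      also have "\<dots> \<le> (exp x)\<^sup>2" using x by (intro power_mono exp_ge_add_one_self) auto
      also have "\<dots> = exp (2 * x)" by (simp add: exp_double)
      finally show "1 + 1 / A\<^sup>2 \<le> exp (2 * x)" .
      have "1 + A\<^sup>2 \<le> 1 + a\<^sup>2" using A by (intro add_left_mono power_mono) auto
      also have "\<dots> \<le> exp (a\<^sup>2)" by (rule exp_ge_add_one_self)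
      also have "\<dots> \<le> exp (a\<^sup>2 * x)" using x by (simp add: mult_le_cancel_left1)
      finally show "1 + A\<^sup>2 \<le> exp (a\<^sup>2 * x)" .
      have "r * \<alpha> ^ k \<le> b powr \<nu> * x"
      proof -
        have "1 / b ^ k \<le> b / x" using bk' bk0 x by (simp add: field_simps)
        then have "\<alpha> ^ k \<le> (b / x) powr \<nu>"
          unfolding alpha_power using nu bk0 by (intro powr_mono2) auto
        also have "\<dots> = b powr \<nu> / x powr \<nu>" by (rule powr_divide)
        also have "\<dots> = b powr \<nu> * r powr (- (\<rho> * \<nu>))"
          by (simp add: x_def powr_powr powr_minus divide_inverse)
        finally have "r * \<alpha> ^ k \<le> r powr 1 * (b powr \<nu> * r powr (- (\<rho> * \<nu>)))"
          using z by (simp add: r_def mult_left_mono)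
        also have "\<dots> = b powr \<nu> * r powr (1 - \<rho> * \<nu>)"
          using z by (simp add: r_def powr_diff powr_minus divide_inverse)
        finally show ?thesis unfolding rho(4) x_def .
      qed
      then have "4 * a * (r * \<alpha> ^ k) \<le> 4 * a * (b powr \<nu> * x)" using a by (intro mult_left_mono) auto
      moreover have "B * (1 / A + A) \<le> k2 * (1 + a\<^sup>2) * x"
      proof -
        have "B * (1 / A + A) = k2 * (1 + A\<^sup>2) * b ^ k" unfolding BA using A by (simp add: field_simps power2_eq_square)
        also have "\<dots> \<le> k2 * (1 + a\<^sup>2) * x"
          using k2 A bk bk0 by (intro mult_mono add_left_mono power_mono) auto
        finally show ?thesis .
      qed
      ultimately have "4 * r * A + B * (1 / A + A) \<le> (4 * a * b powr \<nu> + k2 * (1 + a\<^sup>2)) * x"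
        by (simp add: Aa algebra_simps)
      then show "exp (4 * r * A + B * (1 / A + A)) \<le> exp ((4 * a * b powr \<nu> + k2 * (1 + a\<^sup>2)) * x)" by simp
    qed auto
    also have "\<dots> = exp (C * x)" by (simp add: C_def algebra_simps flip: exp_add)
    finally have le: "(norm (f 1))\<^sup>2 + (norm (g 1))\<^sup>2 \<le> exp (C * x)" .
    have Cx: "1 \<le> exp (C * x)" using C x by simp
    \<comment> \<open>As exp (C x) \<ge> 1, it is at most its own square, so the bound for the
      squared norms serves for the norms too.\<close>
    have *: "u \<le> exp (C * x)" if "u\<^sup>2 \<le> exp (C * x)" for u
    proof (rule power2_le_imp_le)
      have "exp (C * x) * 1 \<le> exp (C * x) * exp (C * x)" using Cx by (intro mult_left_mono) auto
      then show "u\<^sup>2 \<le> (exp (C * x))\<^sup>2" using that unfolding power2_eq_square by linarith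
    qed simp
    show ?thesis
      using le zero_le_power2[of "norm (f 1)"] zero_le_power2[of "norm (g 1)"]
        *[of "norm (f 1)"] *[of "norm (g 1)"]
      unfolding x_def[symmetric] r_def[symmetric] by linarith
  qed
  then show ?thesis using C by blast
qed

section \<open>Lower bound along the imaginary axis\<close>

text \<open>The number of equal pieces into which [0,1] is cut; their length is about y^(-\<rho>),
  at which y^2 det is of order one.\<close>

definition grid :: "real \<Rightarrow> nat" where "grid y = nat \<lceil>y powr \<rho>\<rceil>"

lemma grid_bounds:
  assumes "1 \<le> y"
  shows "y powr \<rho> \<le> real (grid y)" "real (grid y) \<le> 2 * y powr \<rho>" "1 \<le> grid y"
proof -
  have y: "1 \<le> y powr \<rho>" using assms rho by (intro ge_one_powr_ge_zero) auto
  then have g: "real (grid y) = real_of_int \<lceil>y powr \<rho>\<rceil>" by (simp add: grid_def)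
  show 1: "y powr \<rho> \<le> real (grid y)" unfolding g by (rule le_of_int_ceiling)
  show "real (grid y) \<le> 2 * y powr \<rho>" unfolding g using y ceiling_correct[of "y powr \<rho>"] by linarith
  show "1 \<le> grid y" using 1 y by simp
qed

lemma grid_det:
  "\<exists>c1 C1. 0 < c1 \<and> 0 < C1 \<and> (\<forall>y i. 1 \<le> y \<longrightarrow> i < grid y \<longrightarrow>
    c1 \<le> y\<^sup>2 * D (real i / real (grid y)) (real (Suc i) / real (grid y)) \<and>
    y\<^sup>2 * D (real i / real (grid y)) (real (Suc i) / real (grid y)) \<le> C1)"
proof -
  obtain c0 where c0: "0 < c0" "\<And>s t. s < t \<Longrightarrow> t \<le> s + 1 \<Longrightarrow> c0 * (t - s) powr (2 * (1 + \<nu>)) \<le> D s t"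
    using det_ge by blast
  obtain C0 where C0: "0 < C0" "\<And>s t. s < t \<Longrightarrow> t \<le> s + 1 \<Longrightarrow> D s t \<le> C0 * (t - s) powr (2 * (1 + \<nu>))"
    using det_le by blast
  have "c0 / 16 \<le> y\<^sup>2 * D (real i / real (grid y)) (real (Suc i) / real (grid y)) \<and>
    y\<^sup>2 * D (real i / real (grid y)) (real (Suc i) / real (grid y)) \<le> C0" if y: "1 \<le> y" for y i
  proof -
    define N where "N = real (grid y)"
    have N: "y powr \<rho> \<le> N" "N \<le> 2 * y powr \<rho>" "1 \<le> N" using grid_bounds[OF y] by (auto simp: N_def)
    define s where "s = real i / N"
    define t where "t = real (Suc i) / N"
    have ts: "t - s = 1 / N" by (simp add: s_def t_def diff_divide_distrib[symmetric])
    have "0 < 1 / N" "1 / N \<le> 1" using N by auto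
    then have st: "s < t" "t \<le> s + 1" using ts by linarith+
    \<comment> \<open>As \<rho> (1 + \<nu>) = 1, V lies between y and 4 y. Its square is the
      reciprocal of the power in \<open>det_ge\<close> and \<open>det_le\<close>, whence the 16 in
      the lower constant.\<close>
    define V where "V = N powr (1 + \<nu>)"
    have yr: "(y powr \<rho>) powr (1 + \<nu>) = y" using y rho(3) by (simp add: powr_powr)
    have "(y powr \<rho>) powr (1 + \<nu>) \<le> V" unfolding V_def using N nu by (intro powr_mono2) auto
    then have V1: "y \<le> V" by (simp only: yr)
    have "V \<le> (2 * y powr \<rho>) powr (1 + \<nu>)" unfolding V_def using N nu by (intro powr_mono2) auto
    also have "\<dots> = 2 powr (1 + \<nu>) * y" using y by (simp add: powr_mult yr)
    also have "\<dots> \<le> 2 powr 2 * y" using nu y by (intro mult_right_mono powr_mono) auto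
    finally have V2: "V \<le> 4 * y" by simp
    have V0: "0 < V" using V1 y by linarith
    have "(t - s) powr (2 * (1 + \<nu>)) = ((1 / N) powr (1 + \<nu>)) powr 2"
      unfolding ts by (simp add: powr_powr mult.commute)
    also have "(1 / N) powr (1 + \<nu>) = 1 / V" using N by (simp add: V_def powr_divide)
    also have "(1 / V) powr 2 = 1 / V\<^sup>2" using V0 by (simp add: powr_divide powr_numeral)
    finally have p: "(t - s) powr (2 * (1 + \<nu>)) = 1 / V\<^sup>2" .
    have sq: "y\<^sup>2 \<le> V\<^sup>2" "V\<^sup>2 \<le> 16 * y\<^sup>2"
      using power_mono[OF V1, of 2] power_mono[OF V2, of 2] y V0 by (auto simp: power_mult_distrib)
    have "y\<^sup>2 * D s t \<le> y\<^sup>2 * (C0 * (1 / V\<^sup>2))" using C0(2)[OF st] unfolding p by (rule mult_left_mono) simp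
    also have "\<dots> \<le> C0" using sq V0 C0 by (simp add: field_simps)
    finally have 1: "y\<^sup>2 * D s t \<le> C0" .
    have "c0 / 16 \<le> y\<^sup>2 * (c0 * (1 / V\<^sup>2))" using sq V0 c0 by (simp add: field_simps)
    also have "\<dots> \<le> y\<^sup>2 * D s t" using c0(2)[OF st] unfolding p by (rule mult_left_mono) simp
    finally show ?thesis using 1 by (simp add: s_def t_def N_def)
  qed
  then show ?thesis using c0(1) C0(1) by (intro exI[of _ "c0 / 16"] exI[of _ C0]) auto
qed

text \<open>Two kinds of initial data. A nonnegative initial form is multiplied on every grid
  interval; this serves the monodromy matrix. The row (0, 1) starts with form 0: its first interval
  creates at least \<kappa> / y, and \<open>grid y - 1\<close> intervals are left to multiply
  it.\<close>

lemma rows_lower: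
  "\<exists>\<delta>>0. \<exists>\<kappa>>0. \<forall>y f g. 1 \<le> y \<longrightarrow> row_sol \<phi> (\<i> * of_real y) f g \<longrightarrow>
    (0 \<le> Im (g 0 * cnj (f 0)) \<longrightarrow> (1 + \<delta>) ^ grid y * Im (g 0 * cnj (f 0)) \<le> Im (g 1 * cnj (f 1))) \<and>
    (f 0 = 0 \<longrightarrow> g 0 = 1 \<longrightarrow> (1 + \<delta>) ^ (grid y - 1) * (\<kappa> / y)\<^sup>2 \<le> (norm (g 1))\<^sup>2)"
proof -
  obtain c1 C1 where c1: "0 < c1" "0 < C1"
    and det: "\<And>y i. 1 \<le> y \<Longrightarrow> i < grid y \<Longrightarrow> c1 \<le> y\<^sup>2 * D (real i / real (grid y)) (real (Suc i) / real (grid y))"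
      "\<And>y i. 1 \<le> y \<Longrightarrow> i < grid y \<Longrightarrow> y\<^sup>2 * D (real i / real (grid y)) (real (Suc i) / real (grid y)) \<le> C1"
    using grid_det by blast
  define \<delta> where "\<delta> = sqrt c1 / (1 + 2 * C1)"
  define \<kappa> where "\<kappa> = c1 / (2 * (1 + 2 * C1))"
  have pos: "0 < \<delta>" "0 < \<kappa>" using c1 by (auto simp: \<delta>_def \<kappa>_def)
  have main: "(0 \<le> Im (g 0 * cnj (f 0)) \<longrightarrow> (1 + \<delta>) ^ grid y * Im (g 0 * cnj (f 0)) \<le> Im (g 1 * cnj (f 1))) \<and>
    (f 0 = 0 \<longrightarrow> g 0 = 1 \<longrightarrow> (1 + \<delta>) ^ (grid y - 1) * (\<kappa> / y)\<^sup>2 \<le> (norm (g 1))\<^sup>2)"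
    if y: "1 \<le> y" and sol: "row_sol \<phi> (\<i> * of_real y) f g" for y f g
  proof -
    define N where "N = grid y"
    have N: "1 \<le> N" using grid_bounds[OF y] by (simp add: N_def)
    define t where "t = (\<lambda>i. real i / real N)"
    define q where "q = (\<lambda>i. Im (g (t i) * cnj (f (t i))))"
    have t: "0 \<le> t i" "i \<le> N \<Longrightarrow> t i \<le> 1" "t i < t (Suc i)" for i
      using N by (auto simp: t_def divide_strict_right_mono)
    have t0: "t 0 = 0" "t N = 1" using N by (auto simp: t_def)
    have dt: "c1 \<le> y\<^sup>2 * D (t i) (t (Suc i))" "y\<^sup>2 * D (t i) (t (Suc i)) \<le> C1" if "i < N" for i
      using det[OF y, of i] that by (auto simp: t_def N_def)
    have y0: "0 < y" using y by simp
    have one_step: "(1 + \<delta>) * q i \<le> q (Suc i)" if "i < N" "0 \<le> q i" for i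
      unfolding q_def \<delta>_def using that t[of i] t(2)[of "Suc i"]
      by (intro row_sol_step[OF sol continuous_phi _ _ _ y0 dt c1(1)]) (auto simp: q_def)
    have steps: "(1 + \<delta>) ^ (j - i) * q i \<le> q j" if "i \<le> j" "j \<le> N" "0 \<le> q i" for i j
      using that(1,2)
    proof (induction j rule: dec_induct)
      case (step n)
      have IH: "(1 + \<delta>) ^ (n - i) * q i \<le> q n" using step by simp
      moreover have "0 \<le> (1 + \<delta>) ^ (n - i) * q i" using pos that(3) by simp
      ultimately have "(1 + \<delta>) * q n \<le> q (Suc n)" using step by (intro one_step) auto
      moreover have "(1 + \<delta>) * ((1 + \<delta>) ^ (n - i) * q i) \<le> (1 + \<delta>) * q n"
        using IH pos by (intro mult_left_mono) auto
      ultimately show ?case using step by (simp add: Suc_diff_le mult.assoc)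
    qed simp
    have first: "(1 + \<delta>) ^ grid y * Im (g 0 * cnj (f 0)) \<le> Im (g 1 * cnj (f 1))" if "0 \<le> Im (g 0 * cnj (f 0))"
      using steps[of 0 N] that by (simp add: q_def t0 N_def[symmetric])
    have "(1 + \<delta>) ^ (grid y - 1) * (\<kappa> / y)\<^sup>2 \<le> (norm (g 1))\<^sup>2" if init: "f 0 = 0" "g 0 = 1"
    proof -
      have q0: "q 0 = 0" by (simp add: q_def t0 init)
      \<comment> \<open>\<open>row_sol_energy_ge\<close> with \<tau> at the left end, where the row
        has norm 1.\<close>
      have "\<kappa> / y * ((norm (f (t 0)))\<^sup>2 + (norm (g (t 0)))\<^sup>2) \<le> q 1 - q 0"
        unfolding q_def \<kappa>_def using N t[of 0] t(2)[of 1]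
        by (intro order_trans[OF _ row_sol_energy_ge[OF sol continuous_phi, of "t 0" "t 1" "t 0" c1 C1]])
           (use y0 dt[of 0] c1 in auto)
      then have q1: "\<kappa> / y \<le> q 1" by (simp add: q0 t0 init)
      then have "0 \<le> q 1" using pos y0 by (meson divide_nonneg_pos less_imp_le order_trans)
      then have "(1 + \<delta>) ^ (N - 1) * q 1 \<le> q N" using N by (intro steps) auto
      then have qN: "(1 + \<delta>) ^ (N - 1) * (\<kappa> / y) \<le> q N"
        using q1 pos mult_left_mono[OF q1, of "(1 + \<delta>) ^ (N - 1)"] by simp
      have "0 \<le> q (N - 1)" using steps[of 0 "N - 1"] q0 by simp
      \<comment> \<open>Now \<tau> is the right end. The form there is at most |f| |g|, so this
        forces (\<kappa> / y) |f| \<le> |g|: the second entry alone carries the growth up to a power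
        of y.\<close>
      moreover have "\<kappa> / y * ((norm (f (t N)))\<^sup>2 + (norm (g (t N)))\<^sup>2) \<le> q N - q (N - 1)"
      proof -
        have S: "Suc (N - 1) = N" using N by simp
        show ?thesis unfolding q_def \<kappa>_def
          using N t[of "N - 1"] t(2)[of N] dt[of "N - 1"] c1 y0 unfolding S
          by (intro row_sol_energy_ge[OF sol continuous_phi]) auto
      qed
      ultimately have e: "\<kappa> / y * ((norm (f 1))\<^sup>2 + (norm (g 1))\<^sup>2) \<le> q N" by (simp add: t0)
      define X where "X = norm (f 1)"
      define Y where "Y = norm (g 1)"
      have XY: "0 \<le> X" "0 \<le> Y" by (auto simp: X_def Y_def)
      have qXY: "q N \<le> Y * X"
        using abs_Im_le_cmod[of "g 1 * cnj (f 1)"] by (simp add: q_def t0 X_def Y_def norm_mult)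
      have ky: "0 < \<kappa> / y" using pos y0 by simp
      have "\<kappa> / y * X * X \<le> Y * X"
        using e qXY mult_nonneg_nonneg[of "\<kappa> / y" "Y\<^sup>2"] ky
        by (simp add: X_def[symmetric] Y_def[symmetric] power2_eq_square algebra_simps)
      then have X: "\<kappa> / y * X \<le> Y" 
        using XY mult_right_le_imp_le[of "\<kappa> / y * X" X Y] by (cases "X = 0") auto
      have "(1 + \<delta>) ^ (N - 1) * (\<kappa> / y)\<^sup>2 = (1 + \<delta>) ^ (N - 1) * (\<kappa> / y) * (\<kappa> / y)"
        by (simp add: power2_eq_square)
      also have "\<dots> \<le> Y * X * (\<kappa> / y)" using qN qXY ky by (intro mult_right_mono) auto
      also have "\<dots> \<le> Y * Y" using mult_left_mono[OF X XY(2)] by (simp add: mult_ac)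
      finally show ?thesis by (simp add: Y_def N_def power2_eq_square)
    qed
    with first show ?thesis by blast
  qed
  show ?thesis
    by (rule exI[of _ \<delta>], intro conjI pos(1), rule exI[of _ \<kappa>], intro conjI pos(2) allI impI) (use main in blast)+
qed

section \<open>Growth of the monodromy matrix and density of the eigenvalues\<close>

lemma W_H_eq: "W_H H 1 z = row_matrix \<phi> z 1"
  by (rule W_H_eq_row_matrix[OF continuous_phi])

lemma log_W_bounds:
  "\<exists>C1 C2. 0 < C1 \<and> 0 < C2 \<and> (\<forall>r>1.
     C1 * r powr \<rho> \<le> ln (Sup ((\<lambda>z. mat_norm (W_H H 1 z)) ` sphere 0 r)) \<and>
     ln (Sup ((\<lambda>z. mat_norm (W_H H 1 z)) ` sphere 0 r)) \<le> C2 * r powr \<rho>)"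
proof -
  obtain C where C: "0 < C" and up: "\<And>z f g. row_sol \<phi> z f g \<Longrightarrow> (norm (f 0))\<^sup>2 + (norm (g 0))\<^sup>2 = 1 \<Longrightarrow> 1 \<le> norm z \<Longrightarrow>
     norm (f 1) \<le> exp (C * norm z powr \<rho>) \<and> norm (g 1) \<le> exp (C * norm z powr \<rho>)"
    using rows_upper by blast
  obtain \<delta> where \<delta>: "0 < \<delta>" and low: "\<And>y f g. 1 \<le> y \<Longrightarrow> row_sol \<phi> (\<i> * of_real y) f g \<Longrightarrow>
    0 \<le> Im (g 0 * cnj (f 0)) \<Longrightarrow> (1 + \<delta>) ^ grid y * Im (g 0 * cnj (f 0)) \<le> Im (g 1 * cnj (f 1))"
    using rows_lower by blast
  \<comment> \<open>Half the growth rate, because the form bounds the square of the matrix norm from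
    below.\<close>
  define C1 where "C1 = ln (1 + \<delta>) / 2"
  have C1: "0 < C1" using \<delta> by (simp add: C1_def)
  have "C1 * r powr \<rho> \<le> ln (Sup ((\<lambda>z. mat_norm (W_H H 1 z)) ` sphere 0 r)) \<and>
     ln (Sup ((\<lambda>z. mat_norm (W_H H 1 z)) ` sphere 0 r)) \<le> (3 + C) * r powr \<rho>" if r: "1 < r" for r
  proof -
    let ?S = "Sup ((\<lambda>z. mat_norm (W_H H 1 z)) ` sphere 0 r)"
    have x: "1 \<le> r powr \<rho>" using r rho by (intro ge_one_powr_ge_zero) auto
    have U: "mat_norm (W_H H 1 z) \<le> 4 * exp (C * r powr \<rho>)" if "z \<in> sphere 0 r" for z
    proof (rule mat_norm_le)
      fix i j :: 2
      have "norm (row1 \<phi> 1 0 z 1) \<le> exp (C * r powr \<rho>) \<and> norm (row2 \<phi> 1 0 z 1) \<le> exp (C * r powr \<rho>)"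
        "norm (row1 \<phi> 0 1 z 1) \<le> exp (C * r powr \<rho>) \<and> norm (row2 \<phi> 0 1 z 1) \<le> exp (C * r powr \<rho>)"
        using up[OF row_sol_rows[OF continuous_phi, of z 1 0]] up[OF row_sol_rows[OF continuous_phi, of z 0 1]] that r
        by (auto simp: row_initial[OF continuous_phi])
      then show "norm (W_H H 1 z $ i $ j) \<le> exp (C * r powr \<rho>)"
        by (simp add: W_H_eq row_matrix_def)
    qed
    then have bdd: "bdd_above ((\<lambda>z. mat_norm (W_H H 1 z)) ` sphere 0 r)"
      by (intro bdd_aboveI2)
    define z where "z = \<i> * complex_of_real r"
    have z: "z \<in> sphere 0 r" using r by (simp add: z_def norm_mult)
    then have zS: "mat_norm (W_H H 1 z) \<le> ?S" using bdd by (intro cSup_upper) auto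
    define M where "M = mat_norm (W_H H 1 z)"
    \<comment> \<open>The row (1, \<i>) W starts with Im (g cnj f) = 1, so the multiplicative bound
      is effective from the first interval on.\<close>
    define f where "f = (\<lambda>t. 1 * row1 \<phi> 1 0 z t + \<i> * row1 \<phi> 0 1 z t)"
    define g where "g = (\<lambda>t. 1 * row2 \<phi> 1 0 z t + \<i> * row2 \<phi> 0 1 z t)"
    have sol: "row_sol \<phi> (\<i> * of_real r) f g"
      unfolding f_def g_def z_def by (intro row_sol_lincomb row_sol_rows continuous_phi)
    have init: "f 0 = 1" "g 0 = \<i>" by (simp_all add: f_def g_def row_initial[OF continuous_phi])
    have "(1 + \<delta>) ^ grid r \<le> Im (g 1 * cnj (f 1))"
      using low[OF _ sol] r by (simp add: init)
    also have "\<dots> \<le> norm (g 1) * norm (f 1)"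
      using abs_Im_le_cmod[of "g 1 * cnj (f 1)"] by (simp add: norm_mult)
    also have "2 * (norm (g 1) * norm (f 1)) \<le> (norm (f 1))\<^sup>2 + (norm (g 1))\<^sup>2"
      using zero_le_power2[of "norm (f 1) - norm (g 1)"] by (simp add: power2_eq_square algebra_simps)
    then have "norm (g 1) * norm (f 1) \<le> ((norm (f 1))\<^sup>2 + (norm (g 1))\<^sup>2) / 2" by simp
    also have "\<dots> \<le> M\<^sup>2"
      using row_norm_le_mat_norm[of 1 "W_H H 1 z" \<i>]
      by (simp add: M_def W_H_eq row_matrix_def f_def g_def)
    finally have M2: "(1 + \<delta>) ^ grid r \<le> M\<^sup>2" .
    have M0: "0 \<le> M" unfolding M_def mat_norm_def by (rule onorm_pos_le[OF bounded_linear_complex_matrix])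
    have "0 < (1 + \<delta>) ^ grid r" using \<delta> by simp
    then have Mpos: "0 < M" using M2 M0 by (cases "M = 0") auto
    have "ln ((1 + \<delta>) ^ grid r) \<le> ln (M\<^sup>2)" using M2 \<delta> by (intro ln_mono) auto
    then have "real (grid r) * ln (1 + \<delta>) \<le> 2 * ln M" using \<delta> Mpos by (simp add: ln_realpow)
    moreover have "r powr \<rho> * ln (1 + \<delta>) \<le> real (grid r) * ln (1 + \<delta>)"
      using grid_bounds(1)[of r] r \<delta> by (intro mult_right_mono) auto
    ultimately have "C1 * r powr \<rho> \<le> ln M" by (simp add: C1_def mult.commute)
    also have "\<dots> \<le> ln ?S" using zS Mpos by (intro ln_mono) (auto simp: M_def)
    finally have 1: "C1 * r powr \<rho> \<le> ln ?S" .
    have Spos: "0 < ?S" using zS Mpos by (simp add: M_def)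
    have "?S \<le> 4 * exp (C * r powr \<rho>)" using U z by (intro cSup_least) auto
    then have "ln ?S \<le> ln (4 * exp (C * r powr \<rho>))" using Spos by (intro ln_mono) auto
    also have "\<dots> = ln 4 + C * r powr \<rho>" by (simp add: ln_mult)
    also have "\<dots> \<le> (3 + C) * r powr \<rho>"
      using ln_le_minus_one[of "4::real"] x by (simp add: distrib_right)
    finally show ?thesis using 1 by simp
  qed
  then show ?thesis using C C1 by (intro exI[of _ C1] exI[of _ "3 + C"]) auto
qed

text \<open>With x = y^\<rho> the squared modulus is at least exp (L (x - 1)) (\<kappa> / y)^2. Half
  of the exponent L x eventually absorbs the power of y and the constants, and the square root
  leaves L / 4.\<close>

lemma row2_lower_eventually:
  "\<exists>c>0. \<forall>\<^sub>F y in at_top. exp (c * y powr \<rho>) \<le> norm (row2 \<phi> 0 1 (\<i> * of_real y) 1)"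
proof -
  obtain \<delta> \<kappa> where \<delta>: "0 < \<delta>" "0 < \<kappa>" and low: "\<And>y f g. 1 \<le> y \<Longrightarrow> row_sol \<phi> (\<i> * of_real y) f g \<Longrightarrow>
    f 0 = 0 \<Longrightarrow> g 0 = 1 \<Longrightarrow> (1 + \<delta>) ^ (grid y - 1) * (\<kappa> / y)\<^sup>2 \<le> (norm (g 1))\<^sup>2"
    using rows_lower by blast
  define L where "L = ln (1 + \<delta>)"
  have L: "0 < L" using \<delta> by (simp add: L_def)
  have "((\<lambda>y. exp (- (L / 2 * y powr \<rho>)) * y\<^sup>2) \<longlongrightarrow> 0) at_top"
    using L rho(1) by real_asymp
  then have "\<forall>\<^sub>F y in at_top. exp (- (L / 2 * y powr \<rho>)) * y\<^sup>2 < \<kappa>\<^sup>2 / exp L"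
    using \<delta> by (intro order_tendstoD) auto
  then have "\<forall>\<^sub>F y in at_top. exp (- (L / 2 * y powr \<rho>)) * y\<^sup>2 < \<kappa>\<^sup>2 / exp L \<and> 1 \<le> y"
    by (intro eventually_conj eventually_ge_at_top)
  then have "\<forall>\<^sub>F y in at_top. exp (L / 4 * y powr \<rho>) \<le> norm (row2 \<phi> 0 1 (\<i> * of_real y) 1)"
  proof (rule eventually_mono, elim conjE)
    fix y :: real assume y: "exp (- (L / 2 * y powr \<rho>)) * y\<^sup>2 < \<kappa>\<^sup>2 / exp L" "1 \<le> y"
    define x where "x = y powr \<rho>"
    have "(exp (L / 4 * x))\<^sup>2 = exp (L / 2 * x)" by (simp flip: exp_double)
    also have "\<dots> \<le> exp (L / 2 * x) * (\<kappa>\<^sup>2 / exp L / y\<^sup>2 * exp (L / 2 * x))"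
    proof -
      have "1 \<le> \<kappa>\<^sup>2 / exp L / y\<^sup>2 * exp (L / 2 * x)"
        using y by (simp add: x_def exp_minus field_simps)
      then have "exp (L / 2 * x) * 1 \<le> exp (L / 2 * x) * (\<kappa>\<^sup>2 / exp L / y\<^sup>2 * exp (L / 2 * x))"
        by (intro mult_left_mono) auto
      then show ?thesis by simp
    qed
    also have "\<dots> = exp (L * (x - 1)) * (\<kappa> / y)\<^sup>2"
    proof -
      have "exp (L / 2 * x) * exp (L / 2 * x) / exp L = exp (L * (x - 1))"
        by (simp add: algebra_simps flip: exp_add exp_diff)
      moreover have "e * (k / l / w * e) = e * e / l * (k / w)" for e k l w :: real by simp
      ultimately show ?thesis by (simp only: power_divide)
    qed
    also have "\<dots> \<le> (1 + \<delta>) ^ (grid y - 1) * (\<kappa> / y)\<^sup>2"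
    proof (rule mult_right_mono)
      have "exp (L * (x - 1)) \<le> exp (L * real (grid y - 1))"
        using grid_bounds[OF y(2)] L by (simp add: x_def of_nat_diff)
      also have "\<dots> = (1 + \<delta>) ^ (grid y - 1)"
        using \<delta> by (simp add: L_def exp_of_nat2_mult)
      finally show "exp (L * (x - 1)) \<le> (1 + \<delta>) ^ (grid y - 1)" .
    qed simp
    also have "\<dots> \<le> (norm (row2 \<phi> 0 1 (\<i> * of_real y) 1))\<^sup>2"
      by (rule low[OF y(2) row_sol_rows[OF continuous_phi]]) (simp_all add: row_initial[OF continuous_phi])
    finally have "exp (L / 4 * x) \<le> norm (row2 \<phi> 0 1 (\<i> * of_real y) 1)"
      by (rule power2_le_imp_le) simp
    then show "exp (L / 4 * y powr \<rho>) \<le> norm (row2 \<phi> 0 1 (\<i> * of_real y) 1)" by (simp add: x_def)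
  qed
  then show ?thesis using L by (intro exI[of _ "L / 4"]) auto
qed

lemma n_H_eq: "n_H H r = card {z. row2 \<phi> 0 1 z 1 = 0 \<and> norm z < r}"
  unfolding n_H_def spectrum_H_eq_zeros[OF continuous_phi D_pos[of 0 1, simplified]] by simp

lemma Limsup_n_H:
  "0 < Limsup at_top (\<lambda>r. ereal (real (n_H H r) / r powr \<rho>))"
  "Limsup at_top (\<lambda>r. ereal (real (n_H H r) / r powr \<rho>)) < \<infinity>"
proof -
  define F where "F = (\<lambda>z. row2 \<phi> 0 1 z 1)"
  have hol: "F holomorphic_on UNIV" unfolding F_def by (rule row2_holomorphic[OF continuous_phi]) simp
  have F0: "F 0 = 1" by (simp add: F_def row2_at_0[OF continuous_phi])
  obtain C where C: "0 < C" and up: "\<And>z f g. row_sol \<phi> z f g \<Longrightarrow> (norm (f 0))\<^sup>2 + (norm (g 0))\<^sup>2 = 1 \<Longrightarrow> 1 \<le> norm z \<Longrightarrow>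
     norm (f 1) \<le> exp (C * norm z powr \<rho>) \<and> norm (g 1) \<le> exp (C * norm z powr \<rho>)"
    using rows_upper by blast
  have upper: "norm (F z) \<le> exp (C * norm z powr \<rho>)" if "1 \<le> norm z" for z
    using up[OF row_sol_rows[OF continuous_phi, of z 0 1] _ that] by (simp add: F_def row_initial[OF continuous_phi])
  have simple: "deriv F z \<noteq> 0" if "F z = 0" for z
    using row2_zero_real_simple(2)[OF continuous_phi D_pos[of 0 1, simplified]] that by (simp add: F_def)
  obtain c where c: "0 < c" "\<forall>\<^sub>F y in at_top. exp (c * y powr \<rho>) \<le> norm (F (\<i> * of_real y))"
    using row2_lower_eventually unfolding F_def by blast
  show "0 < Limsup at_top (\<lambda>r. ereal (real (n_H H r) / r powr \<rho>))"
    unfolding n_H_eq using Limsup_card_zeros_pos[OF hol F0 rho(1,2) C c(1) upper simple c(2)] by (simp add: F_def)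
  show "Limsup at_top (\<lambda>r. ereal (real (n_H H r) / r powr \<rho>)) < \<infinity>"
    unfolding n_H_eq using Limsup_card_zeros_finite[OF hol F0 rho(1) upper] by (simp add: F_def)
qed

end

theorem theorem7p4:
  fixes \<alpha> :: real and \<beta> :: int and c :: real
  assumes "0 < \<alpha>" "\<alpha> < 1" "even \<beta>" "\<alpha> * real_of_int \<beta> > 1 + pi / 2" "c > 0"
  defines "\<nu> \<equiv> - ln \<alpha> / ln (real_of_int \<beta>)"
      and "H \<equiv> ham_of_angle (weierstrass \<alpha> (real_of_int \<beta>))"
  shows "(\<exists>C1 C2. 0 < C1 \<and> 0 < C2 \<and> (\<forall>r>1.
            C1 * r powr (1 / (1 + \<nu>)) \<le> ln (Sup ((\<lambda>z. mat_norm (W_H H 1 z)) ` sphere 0 r)) \<and>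
            ln (Sup ((\<lambda>z. mat_norm (W_H H 1 z)) ` sphere 0 r)) \<le> C2 * r powr (1 / (1 + \<nu>))))
       \<and> (\<exists>C1 C2. 0 < C1 \<and> 0 < C2 \<and> (\<forall>r>1.
            C1 * r powr (1 / (1 + \<nu>)) \<le> real (kappa_H H c r) \<and>
            real (kappa_H H c r) \<le> C2 * r powr (1 / (1 + \<nu>))))
       \<and> 0 < Limsup at_top (\<lambda>r. ereal (real (n_H H r) / r powr (1 / (1 + \<nu>))))
       \<and> Limsup at_top (\<lambda>r. ereal (real (n_H H r) / r powr (1 / (1 + \<nu>)))) < \<infinity>"
proof -
  interpret w: weierstrass_angle \<alpha> \<beta>
    by unfold_locales (use assms in auto)
  have \<rho>: "1 / (1 + \<nu>) = w.\<rho>" and H: "H = ham_of_angle w.\<phi>"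
    unfolding w.\<rho>_def w.\<nu>_def w.b_def w.\<phi>_def \<nu>_def H_def by (rule refl)+
  show ?thesis
    unfolding \<rho> H
    by (intro conjI w.log_W_bounds w.kappa_bounds[OF assms(5)] w.Limsup_n_H)
qed

end
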